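(* Let $S$ be a smooth connected proper complex surface. Assume that $c_1=0$ and that $s_2=q^2$ for some $q\in H^2(S,\mathbb Q)$. Let $\mathfrak w^+(S)$ be the Lie algebra spanned by elements $z^mD^n\lambda$ with $m\ge1$, $n\ge0$, $\lambda\in H^*(S,\mathbb Q)$, subject to the relations $$[z^mD^n\lambda,\,z^{m'}D^{n'}\mu]=z^{m+m'}\,\frac{(D+m'q)^nD^{n'}-D^n(D+mq)^{n'}}{q}\,\lambda\mu .$$ Then there is an isomorphism of algebras $W^+(S)\simeq U(\mathfrak w^+(S))$.
   Context: $c_1,c_2$ are the Chern classes of $S$ and $s_2=c_1^2-c_2$. $\Delta_S\in H^*(S,\mathbb Q)\otimes H^*(S,\mathbb Q)$ is the diagonal class, $\lambda\mu=\lambda\cup\mu$. All algebras are superalgebras (parity = cohomological degree mod 2), $[a,b]=ab-(-1)^{|a||b|}ba$, $\{a,b\}=ab+(-1)^{|a||b|}ba$. In $\mathfrak w^+(S)$ the symbol $z^mD^n\lambda$ is linear in $\lambda$ (as a vector space $\mathfrak w^+(S)=\bigoplus_{m\ge1,n\ge0}z^mD^n\otimes H^*(S,\mathbb Q)$). The right-hand side of the bracket is understood by first expanding the numerator as a polynomial in commuting formal variables $D,q$, dividing formally by $q$, and then reading $z^{a}D^{b}q^{i}\lambda\mu$ as $z^aD^b(q^i\lambda\mu)$. $W^{\ge}(S)$ is the unital associative $\mathbb Q$-algebra generated by $\psi_n(\lambda),T_n(\lambda)$ ($n\ge0$, $\lambda\in H^*(S,\mathbb Q)$) and a central element $\mathbf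 c$, with relations: (a),(b) $\psi_n(\lambda)$, $T_n(\lambda)$ are linear in $\lambda$; (c) $[\psi_m(\lambda),\psi_n(\mu)]=0$; (d) $[\psi_m(\lambda),T_n(\mu)]=mT_{m+n-1}(\lambda\mu)$; (e) $[T_m(\lambda\mu),T_n(\nu)]=[T_m(\lambda),T_n(\mu\nu)]$; (f) $[T_m(\lambda),T_{n+3}(\mu)]-3[T_{m+1}(\lambda),T_{n+2}(\mu)]+3[T_{m+2}(\lambda),T_{n+1}(\mu)]-[T_{m+3}(\lambda),T_n(\mu)]-[T_m(\lambda),T_{n+1}(s_2\mu)]+[T_{m+1}(\lambda),T_n(s_2\mu)]+\{T_m,T_n\}(c_1\Delta_S\lambda\mu)=0$, with $\{T_m,T_n\}(\sum a\otimes b)=\sum\{T_m(a),T_n(b)\}$; (g) $\sum_{w\in S_3}w\cdot[T_{m_3}(\lambda_3),[T_{m_2}(\lambda_2),T_{m_1+1}(\lambda_1)]]=0$, $w$ permuting the pairs $(m_i,\lambda_i)$ (with Koszul signs); (h) $\psi_n(\lambda)=0$ if $2n-2+\deg\lambda<0$. $W^+(S)\subset W^{\ge}(S)$ is the subalgebra generated by the $T_n(\lambda)$. *)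

theory Defs
  imports
    "HOL-Analysis.Analysis"
    "HOL-Homology.Homology"
    "HOL-Algebra.QuotRing"
    "HOL-Algebra.Generated_Rings"
    "HOL-Computational_Algebra.Polynomial"
begin

section \<open>Rational singular cohomology\<close>

class rat_algebra = ring_1 +
  fixes scaleQ :: "rat \<Rightarrow> 'a \<Rightarrow> 'a"  (infixr "*\<^sub>Q" 75)
  assumes scaleQ_add_right: "r *\<^sub>Q (x + y) = r *\<^sub>Q x + r *\<^sub>Q y"
    and scaleQ_add_left: "(r + s) *\<^sub>Q x = r *\<^sub>Q x + s *\<^sub>Q x"
    and scaleQ_scaleQ: "r *\<^sub>Q s *\<^sub>Q x = (r * s) *\<^sub>Q x"
    and scaleQ_one: "1 *\<^sub>Q x = x"
    and mult_scaleQ_left: "(r *\<^sub>Q x) * y = r *\<^sub>Q (x * y)"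
    and mult_scaleQ_right: "x * (r *\<^sub>Q y) = r *\<^sub>Q (x * y)"

type_synonym 'a sing_simplex = "(nat \<Rightarrow> real) \<Rightarrow> 'a"

text \<open>A singular simplex of dimension \<open>p + r\<close> restricts to its front \<open>p\<close>-face and its back
  \<open>r\<close>-face; the standard \<open>p\<close>-simplex is already a subset of the standard \<open>(p + r)\<close>-simplex.\<close>

definition front_face :: "nat \<Rightarrow> 'a sing_simplex \<Rightarrow> 'a sing_simplex" where
  "front_face p \<sigma> = restrict \<sigma> (standard_simplex p)"

definition shift :: "nat \<Rightarrow> (nat \<Rightarrow> real) \<Rightarrow> nat \<Rightarrow> real" where
  "shift p x = (\<lambda>i. if i < p then 0 else x (i - p))"

definition back_face :: "nat \<Rightarrow> nat \<Rightarrow> 'a sing_simplex \<Rightarrow> 'a sing_simplex" where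
  "back_face p r \<sigma> = restrict (\<sigma> \<circ> shift p) (standard_simplex r)"

definition coboundary :: "nat \<Rightarrow> ('a sing_simplex \<Rightarrow> rat) \<Rightarrow> 'a sing_simplex \<Rightarrow> rat" where
  "coboundary p f \<sigma> = (\<Sum>k\<le>Suc p. (-1) ^ k * f (singular_face (Suc p) k \<sigma>))"

lemma shift_in_standard_simplex:
  assumes "x \<in> standard_simplex r"
  shows "shift p x \<in> standard_simplex (p + r)"
proof -
  have "(\<Sum>i\<le>p + r. shift p x i) = (\<Sum>i\<in>{p..p + r}. shift p x i)"
    by (rule sum.mono_neutral_right) (auto simp: shift_def)
  also have "\<dots> = (\<Sum>i\<in>{0..r}. x i)"
    by (rule sum.reindex_bij_witness[of _ "\<lambda>i. i + p" "\<lambda>i. i - p"]) (auto simp: shift_def)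
  finally show ?thesis
    using assms by (auto simp: standard_simplex_def shift_def atMost_atLeast0)
qed

lemma singular_simplex_front_face:
  assumes "singular_simplex n X \<sigma>" "p \<le> n"
  shows "singular_simplex p X (front_face p \<sigma>)"
  unfolding front_face_def singular_simplex_def
proof
  have "continuous_map (subtopology (powertop_real UNIV) (standard_simplex p)) X \<sigma>"
    using assms standard_simplex_mono[OF assms(2)] unfolding singular_simplex_def
    by (metis continuous_map_from_subtopology_mono)
  then show "continuous_map (subtopology (powertop_real UNIV) (standard_simplex p)) X
      (restrict \<sigma> (standard_simplex p))"
    by (rule continuous_map_eq) auto
qed auto

lemma continuous_map_shift:
  "continuous_map (powertop_real UNIV) (powertop_real UNIV) (shift p)"
  unfolding continuous_map_componentwise_UNIV shift_def
  by (auto intro: continuous_map_product_projection)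

lemma singular_simplex_back_face:
  assumes "singular_simplex n X \<sigma>" "p + r = n"
  shows "singular_simplex r X (back_face p r \<sigma>)"
  unfolding back_face_def singular_simplex_def
proof
  have "continuous_map (subtopology (powertop_real UNIV) (standard_simplex r))
     (subtopology (powertop_real UNIV) (standard_simplex n)) (shift p)"
    using shift_in_standard_simplex[of _ r p] assms(2) continuous_map_shift
    by (auto simp: continuous_map_in_subtopology intro!: continuous_map_from_subtopology)
  then have "continuous_map (subtopology (powertop_real UNIV) (standard_simplex r)) X (\<sigma> \<circ> shift p)"
    using assms unfolding singular_simplex_def by (meson continuous_map_compose)
  then show "continuous_map (subtopology (powertop_real UNIV) (standard_simplex r)) X
      (restrict (\<sigma> \<circ> shift p) (standard_simplex r))"
    by (rule continuous_map_eq) auto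
qed auto

lemma front_face_face_le:
  assumes "k \<le> p" "p \<le> n"
  shows "front_face p (singular_face (Suc n) k \<sigma>) = singular_face (Suc p) k (front_face (Suc p) \<sigma>)"
proof
  fix x
  show "front_face p (singular_face (Suc n) k \<sigma>) x = singular_face (Suc p) k (front_face (Suc p) \<sigma>) x"
    using standard_simplex_mono[OF assms(2)] assms
      simplical_face_in_standard_simplex[of "Suc p" k x]
    by (auto simp: front_face_def singular_face_def restrict_def)
qed

lemma front_face_face_gt:
  assumes "p < k" "p \<le> n"
  shows "front_face p (singular_face (Suc n) k \<sigma>) = front_face p \<sigma>"
proof -
  have "simplical_face k x = x" if "x \<in> standard_simplex p" for x
    using that assms by (auto simp: standard_simplex_def simplical_face_def)
  then show ?thesis
    using standard_simplex_mono[OF assms(2)] 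
    by (intro ext) (auto simp: front_face_def singular_face_def restrict_def subset_iff)
qed

lemma back_face_face_le:
  assumes "k \<le> p" "p + r = n"
  shows "back_face p r (singular_face (Suc n) k \<sigma>) = back_face (Suc p) r \<sigma>"
proof -
  have *: "simplical_face k (shift p x) = shift (Suc p) x" for x
    using assms by (auto simp: simplical_face_def shift_def fun_eq_iff)
  show ?thesis
    using shift_in_standard_simplex[of _ r p] assms *
    by (intro ext) (auto simp: back_face_def singular_face_def restrict_def)
qed

lemma back_face_face_gt:
  assumes "p < k" "p + r = n" "k \<le> Suc n"
  shows "back_face p r (singular_face (Suc n) k \<sigma>) = singular_face (Suc r) (k - p) (back_face p (Suc r) \<sigma>)"
proof -
  have *: "simplical_face k (shift p x) = shift p (simplical_face (k - p) x)" for x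
    using assms by (auto simp: simplical_face_def shift_def fun_eq_iff)
  have "simplical_face (k - p) x \<in> standard_simplex (Suc r)" if "x \<in> standard_simplex r" for x
    using that assms simplical_face_in_standard_simplex[of "Suc r" "k - p" x] by auto
  then show ?thesis
    using shift_in_standard_simplex[of _ r p] assms *
    by (intro ext) (auto simp: back_face_def singular_face_def restrict_def)
qed

lemma front_face_front_face: "p \<le> m \<Longrightarrow> front_face p (front_face m \<sigma>) = front_face p \<sigma>"
  using standard_simplex_mono[of p m] by (auto simp: front_face_def restrict_def fun_eq_iff)

lemma back_face_front_face:
  "m = p + r \<Longrightarrow> back_face p r (front_face m \<sigma>) = front_face r (back_face p (r + s) \<sigma>)"
  using shift_in_standard_simplex[of _ r p] standard_simplex_mono[of r "r + s"]
  by (auto simp: front_face_def back_face_def restrict_def fun_eq_iff subset_iff)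

lemma back_face_back_face:
  "back_face r s (back_face p (r + s) \<sigma>) = back_face (p + r) s \<sigma>"
proof -
  have "shift p (shift r x) = shift (p + r) x" for x
    by (auto simp: shift_def fun_eq_iff)
  then show ?thesis
    using shift_in_standard_simplex[of _ s r]
    by (intro ext) (auto simp: back_face_def restrict_def)
qed

lemma front_face_id: "singular_simplex n X \<sigma> \<Longrightarrow> front_face n \<sigma> = \<sigma>"
  by (auto simp: front_face_def singular_simplex_def extensional_restrict)

lemma back_face_id: "singular_simplex n X \<sigma> \<Longrightarrow> back_face 0 n \<sigma> = \<sigma>"
  by (auto simp: back_face_def shift_def singular_simplex_def extensional_def restrict_def fun_eq_iff)

text \<open>The algebra of rational singular cochains of the space \<open>'a\<close>: finitely supported families
  of cochains, a cochain being a function on singular simplices (extended by zero).\<close>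

typedef (overloaded) 'a cochain =
  "{c :: nat \<Rightarrow> 'a::topological_space sing_simplex \<Rightarrow> rat.
      (\<forall>p \<sigma>. \<not> singular_simplex p euclidean \<sigma> \<longrightarrow> c p \<sigma> = 0) \<and> finite {p. \<exists>\<sigma>. c p \<sigma> \<noteq> 0}}"
  morphisms cochain_at Abs_cochain
  by (rule exI[of _ "\<lambda>_ _. 0"]) auto

setup_lifting type_definition_cochain

lemma cochain_at_outside: "\<not> singular_simplex p euclidean \<sigma> \<Longrightarrow> cochain_at c p \<sigma> = 0"
  by transfer auto

lemma cochain_eqI:
  "(\<And>p \<sigma>. singular_simplex p euclidean \<sigma> \<Longrightarrow> cochain_at a p \<sigma> = cochain_at b p \<sigma>) \<Longrightarrow> a = b"
  by transfer (metis (no_types, lifting) ext mem_Collect_eq)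

instantiation cochain :: (topological_space) ab_group_add
begin

lift_definition zero_cochain :: "'a cochain" is "\<lambda>_ _. 0" by auto

lift_definition plus_cochain :: "'a cochain \<Rightarrow> 'a cochain \<Rightarrow> 'a cochain"
  is "\<lambda>a b p \<sigma>. a p \<sigma> + b p \<sigma>"
proof -
  fix a b :: "nat \<Rightarrow> 'a sing_simplex \<Rightarrow> rat"
  have "{p. \<exists>\<sigma>. a p \<sigma> + b p \<sigma> \<noteq> 0} \<subseteq> {p. \<exists>\<sigma>. a p \<sigma> \<noteq> 0} \<union> {p. \<exists>\<sigma>. b p \<sigma> \<noteq> 0}"
    by auto
  then show "?thesis a b" if "(\<forall>p \<sigma>. \<not> singular_simplex p euclidean \<sigma> \<longrightarrow> a p \<sigma> = 0) \<and> finite {p. \<exists>\<sigma>. a p \<sigma> \<noteq> 0}"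
    "(\<forall>p \<sigma>. \<not> singular_simplex p euclidean \<sigma> \<longrightarrow> b p \<sigma> = 0) \<and> finite {p. \<exists>\<sigma>. b p \<sigma> \<noteq> 0}"
    using that by (auto intro: finite_subset)
qed

lift_definition uminus_cochain :: "'a cochain \<Rightarrow> 'a cochain" is "\<lambda>a p \<sigma>. - a p \<sigma>"
  by (auto simp: fun_eq_iff)

definition minus_cochain :: "'a cochain \<Rightarrow> 'a cochain \<Rightarrow> 'a cochain" where
  "minus_cochain a b = a + - b"

instance
  by standard (auto simp: minus_cochain_def, (transfer, auto simp: algebra_simps)+)

end


lemma minus_cochain_at: "cochain_at (a - b) p \<sigma> = cochain_at a p \<sigma> - cochain_at b p \<sigma>"
  unfolding minus_cochain_def by transfer simp

lift_definition delta :: "'a::topological_space cochain \<Rightarrow> 'a cochain" is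
  "\<lambda>c n \<sigma>. case n of 0 \<Rightarrow> 0
     | Suc p \<Rightarrow> if singular_simplex (Suc p) euclidean \<sigma> then coboundary p (c p) \<sigma> else 0"
proof -
  fix c :: "nat \<Rightarrow> 'a sing_simplex \<Rightarrow> rat"
  assume "(\<forall>p \<sigma>. \<not> singular_simplex p euclidean \<sigma> \<longrightarrow> c p \<sigma> = 0) \<and> finite {p. \<exists>\<sigma>. c p \<sigma> \<noteq> 0}"
  moreover have "{n. \<exists>\<sigma>. (case n of 0 \<Rightarrow> 0
     | Suc p \<Rightarrow> if singular_simplex (Suc p) euclidean \<sigma> then coboundary p (c p) \<sigma> else 0) \<noteq> 0}
     \<subseteq> Suc ` {p. \<exists>\<sigma>. c p \<sigma> \<noteq> 0}" (is "?L \<subseteq> ?R")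
  proof
    fix n assume "n \<in> ?L"
    then obtain p \<sigma> where p: "n = Suc p" "coboundary p (c p) \<sigma> \<noteq> 0"
      by (cases n) (auto split: if_splits)
    then obtain k where "(-1) ^ k * c p (singular_face (Suc p) k \<sigma>) \<noteq> 0"
      unfolding coboundary_def by (meson sum.neutral)
    then show "n \<in> ?R"
      using p(1) by (metis (mono_tags, lifting) imageI mem_Collect_eq mult_zero_right)
  qed
  ultimately have "finite {n. \<exists>\<sigma>. (case n of 0 \<Rightarrow> 0
     | Suc p \<Rightarrow> if singular_simplex (Suc p) euclidean \<sigma> then coboundary p (c p) \<sigma> else 0) \<noteq> 0}"
    by (meson finite_imageI finite_subset)
  then show "?thesis c"
    by (simp split: nat.split)
qed

lift_definition sign_inv :: "'a::topological_space cochain \<Rightarrow> 'a cochain" is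
  "\<lambda>c p \<sigma>. (-1) ^ p * c p \<sigma>"
  by (auto simp: fun_eq_iff)

lift_definition cochain_scale :: "rat \<Rightarrow> 'a::topological_space cochain \<Rightarrow> 'a cochain" is
  "\<lambda>r c p \<sigma>. r * c p \<sigma>"
  by (auto simp: fun_eq_iff elim: finite_subset[rotated])

lemma cup_finite:
  fixes a b :: "nat \<Rightarrow> 'a::topological_space sing_simplex \<Rightarrow> rat"
  assumes "finite {p. \<exists>\<sigma>. a p \<sigma> \<noteq> 0}" "finite {p. \<exists>\<sigma>. b p \<sigma> \<noteq> 0}"
  shows "finite {n. \<exists>\<sigma>. (if singular_simplex n euclidean \<sigma>
       then \<Sum>p\<le>n. a p (front_face p \<sigma>) * b (n - p) (back_face p (n - p) \<sigma>) else 0) \<noteq> 0}"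
    (is "finite ?L")
proof (rule finite_subset)
  show "?L \<subseteq> (\<lambda>(p, r). p + r) ` ({p. \<exists>\<sigma>. a p \<sigma> \<noteq> 0} \<times> {p. \<exists>\<sigma>. b p \<sigma> \<noteq> 0})"
  proof
    fix n assume "n \<in> ?L"
    then obtain \<sigma> where "(\<Sum>p\<le>n. a p (front_face p \<sigma>) * b (n - p) (back_face p (n - p) \<sigma>)) \<noteq> 0"
      by (auto split: if_splits)
    then obtain p where "p \<le> n" "a p (front_face p \<sigma>) * b (n - p) (back_face p (n - p) \<sigma>) \<noteq> 0"
      by (meson atMost_iff sum.neutral)
    then have "p \<le> n" "a p (front_face p \<sigma>) \<noteq> 0" "b (n - p) (back_face p (n - p) \<sigma>) \<noteq> 0"
      by auto
    then show "n \<in> (\<lambda>(p, r). p + r) ` ({p. \<exists>\<sigma>. a p \<sigma> \<noteq> 0} \<times> {p. \<exists>\<sigma>. b p \<sigma> \<noteq> 0})"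
      by (intro rev_image_eqI[of "(p, n - p)"]) auto
  qed
qed (use assms in auto)

instantiation cochain :: (topological_space) "{times, one}"
begin

lift_definition times_cochain :: "'a cochain \<Rightarrow> 'a cochain \<Rightarrow> 'a cochain" is
  "\<lambda>a b n \<sigma>. if singular_simplex n euclidean \<sigma>
     then \<Sum>p\<le>n. a p (front_face p \<sigma>) * b (n - p) (back_face p (n - p) \<sigma>) else 0"
  by (intro conjI cup_finite) auto

lift_definition one_cochain :: "'a cochain" is
  "\<lambda>n \<sigma>. if n = 0 \<and> singular_simplex 0 euclidean \<sigma> then 1 else 0"
  by (auto intro: finite_subset[of _ "{0}"])

instance ..

end

lemma cochain_at_times:
  "singular_simplex n euclidean \<sigma> \<Longrightarrow> cochain_at (a * b) n \<sigma> =
     (\<Sum>p\<le>n. cochain_at a p (front_face p \<sigma>) * cochain_at b (n - p) (back_face p (n - p) \<sigma>))"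
  by (simp add: times_cochain.rep_eq)

lemma cochain_at_delta_0: "cochain_at (delta c) 0 \<sigma> = 0"
  by (simp add: delta.rep_eq)

lemma cochain_at_delta_Suc:
  "singular_simplex (Suc p) euclidean \<sigma> \<Longrightarrow>
     cochain_at (delta c) (Suc p) \<sigma> = coboundary p (cochain_at c p) \<sigma>"
  by (simp add: delta.rep_eq)

lemma singular_simplex_const: "\<exists>\<sigma>. singular_simplex 0 (euclidean :: 'a::topological_space topology) \<sigma>"
  by (rule exI[of _ "restrict (\<lambda>_. undefined) (standard_simplex 0)"])
     (auto simp: singular_simplex_def intro: continuous_map_eq[of _ _ "\<lambda>_. undefined"])

instance cochain :: (topological_space) ring_1
proof
  fix a b c :: "'a cochain"
  show "(a + b) * c = a * c + b * c"
    by (rule cochain_eqI) (simp add: cochain_at_times plus_cochain.rep_eq algebra_simps sum.distrib)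
  show "a * (b + c) = a * b + a * c"
    by (rule cochain_eqI) (simp add: cochain_at_times plus_cochain.rep_eq algebra_simps sum.distrib)
  show "1 * a = a"
  proof (rule cochain_eqI)
    fix n and \<sigma> :: "'a sing_simplex" assume *: "singular_simplex n euclidean \<sigma>"
    then have "singular_simplex 0 euclidean (front_face 0 \<sigma>)"
      by (auto intro: singular_simplex_front_face)
    then have "cochain_at (1 * a) n \<sigma> =
      (\<Sum>p\<le>n. if p = 0 then cochain_at a (n - p) (back_face p (n - p) \<sigma>) else 0)"
      unfolding cochain_at_times[OF *] by (intro sum.cong) (auto simp: one_cochain.rep_eq)
    then show "cochain_at (1 * a) n \<sigma> = cochain_at a n \<sigma>"
      using * by (simp add: back_face_id)
  qed
  show "a * 1 = a"
  proof (rule cochain_eqI)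
    fix n and \<sigma> :: "'a sing_simplex" assume *: "singular_simplex n euclidean \<sigma>"
    then have "singular_simplex 0 euclidean (back_face n 0 \<sigma>)"
      by (auto intro: singular_simplex_back_face)
    then have "cochain_at (a * 1) n \<sigma> =
      (\<Sum>p\<le>n. if p = n then cochain_at a p (front_face p \<sigma>) else 0)"
      unfolding cochain_at_times[OF *] by (intro sum.cong) (auto simp: one_cochain.rep_eq)
    then show "cochain_at (a * 1) n \<sigma> = cochain_at a n \<sigma>"
      using * by (simp add: front_face_id)
  qed
  show "a * b * c = a * (b * c)"
  proof (rule cochain_eqI)
    fix n and \<sigma> :: "'a sing_simplex" assume *: "singular_simplex n euclidean \<sigma>"
    define F where "F p r s = cochain_at a p (front_face p \<sigma>) *
      cochain_at b r (back_face p r (front_face (p + r) \<sigma>)) *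
      cochain_at c s (back_face (p + r) s \<sigma>)" for p r s
    have "cochain_at (a * b * c) n \<sigma> = (\<Sum>m\<le>n. \<Sum>p\<le>m. F p (m - p) (n - m))"
      unfolding cochain_at_times[OF *]
      by (intro sum.cong refl)
         (use * in \<open>auto simp: cochain_at_times singular_simplex_front_face F_def sum_distrib_right
            front_face_front_face\<close>)
    also have "\<dots> = (\<Sum>(m, p)\<in>(SIGMA m:{..n}. {..m}). F p (m - p) (n - m))"
      by (simp add: sum.Sigma)
    also have "\<dots> = (\<Sum>(p, r)\<in>(SIGMA p:{..n}. {..n - p}). F p r (n - p - r))"
      by (rule sum.reindex_bij_witness[of _ "\<lambda>(p, r). (p + r, p)" "\<lambda>(m, p). (p, m - p)"]) auto
    also have "\<dots> = (\<Sum>p\<le>n. \<Sum>r\<le>n - p. F p r (n - p - r))"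
      by (simp add: sum.Sigma)
    also have "\<dots> = cochain_at (a * (b * c)) n \<sigma>"
      unfolding cochain_at_times[OF *]
    proof (intro sum.cong refl)
      fix p assume "p \<in> {..n}"
      then have p: "p \<le> n" by simp
      then have **: "singular_simplex (n - p) euclidean (back_face p (n - p) \<sigma>)"
        using * by (auto intro: singular_simplex_back_face)
      have "F p r (n - p - r) = cochain_at a p (front_face p \<sigma>) *
          (cochain_at b r (front_face r (back_face p (n - p) \<sigma>)) *
           cochain_at c (n - p - r) (back_face r (n - p - r) (back_face p (n - p) \<sigma>)))"
        if "r \<le> n - p" for r
      proof -
        have "r + (n - p - r) = n - p" "p + r - p = r" using that by auto
        then show ?thesis
          using back_face_front_face[of "p + r" p r \<sigma> "n - p - r"]
            back_face_back_face[of r "n - p - r" p \<sigma>]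
          by (simp add: F_def mult.assoc)
      qed
      then show "(\<Sum>r\<le>n - p. F p r (n - p - r)) =
          cochain_at a p (front_face p \<sigma>) * cochain_at (b * c) (n - p) (back_face p (n - p) \<sigma>)"
        unfolding cochain_at_times[OF **] sum_distrib_left by (intro sum.cong) auto
    qed
    finally show "cochain_at (a * b * c) n \<sigma> = cochain_at (a * (b * c)) n \<sigma>" .
  qed
  obtain \<sigma> :: "'a sing_simplex" where "singular_simplex 0 euclidean \<sigma>"
    using singular_simplex_const by blast
  then have "cochain_at 0 0 \<sigma> \<noteq> cochain_at (1 :: 'a cochain) 0 \<sigma>"
    by (simp add: zero_cochain.rep_eq one_cochain.rep_eq)
  then show "(0 :: 'a cochain) \<noteq> 1" by metis
qed

lemma delta_add: "delta (a + b) = delta a + delta b"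
  by (rule cochain_eqI)
     (auto simp: delta.rep_eq plus_cochain.rep_eq coboundary_def algebra_simps sum.distrib split: nat.splits)

lemma delta_scale: "delta (cochain_scale r a) = cochain_scale r (delta a)"
  by (rule cochain_eqI)
     (auto simp: delta.rep_eq cochain_scale.rep_eq coboundary_def algebra_simps sum_distrib_left split: nat.splits)

lemma delta_0 [simp]: "delta 0 = 0"
  using delta_add[of 0 0] by simp

lemma delta_minus: "delta (- a) = - delta a"
  using delta_add[of a "- a"] by (simp add: eq_neg_iff_add_eq_0 add.commute)

lemma delta_diff: "delta (a - b) = delta a - delta b"
  using delta_add[of a "- b"] by (simp add: delta_minus)

lemma delta_sign_inv: "delta (sign_inv a) = - sign_inv (delta a)"
  by (rule cochain_eqI)
     (auto simp: delta.rep_eq sign_inv.rep_eq uminus_cochain.rep_eq coboundary_def algebra_simps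
        sum_distrib_left sum_negf split: nat.splits)

lemma sign_inv_sign_inv: "sign_inv (sign_inv a) = a"
  by (rule cochain_eqI) (auto simp: sign_inv.rep_eq simp flip: mult.assoc power_add)

lemma sign_inv_0 [simp]: "sign_inv 0 = 0"
  by (rule cochain_eqI) (auto simp: sign_inv.rep_eq zero_cochain.rep_eq)

lemma delta_one: "delta 1 = 0"
proof (rule cochain_eqI)
  fix n and \<sigma> :: "'a sing_simplex" assume *: "singular_simplex n euclidean \<sigma>"
  show "cochain_at (delta 1) n \<sigma> = cochain_at 0 n \<sigma>"
  proof (cases n)
    case (Suc p)
    have "singular_simplex p euclidean (singular_face (Suc p) k \<sigma>)" if "k \<le> Suc p" for k
      using that * Suc singular_simplex_singular_face[of "Suc p" euclidean \<sigma> k] by auto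
    then have "singular_simplex 0 euclidean (singular_face (Suc 0) k \<sigma>)" if "p = 0" "k \<le> 1" for k
      using that by fastforce
    then show ?thesis
      using Suc * by (cases "p = 0")
        (simp_all add: cochain_at_delta_Suc coboundary_def one_cochain.rep_eq zero_cochain.rep_eq)
  qed (simp add: cochain_at_delta_0 zero_cochain.rep_eq)
qed

lemma delta_times: "delta (a * b) = delta a * b + sign_inv a * delta b"
proof (rule cochain_eqI)
  fix n' and \<sigma> :: "'a sing_simplex" assume *: "singular_simplex n' euclidean \<sigma>"
  show "cochain_at (delta (a * b)) n' \<sigma> = cochain_at (delta a * b + sign_inv a * delta b) n' \<sigma>"
  proof (cases n')
    case 0
    then show ?thesis
      using * by (simp add: cochain_at_delta_0 plus_cochain.rep_eq cochain_at_times)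
  next
    case (Suc n)
    note * = *[unfolded Suc]
    define A where "A p = cochain_at a p" for p
    define B where "B p = cochain_at b p" for p
    define U where "U p k = (-1) ^ k * A p (singular_face (Suc p) k (front_face (Suc p) \<sigma>)) *
        B (n - p) (back_face (Suc p) (n - p) \<sigma>)" for p k
    define V where "V p j = (-1) ^ (p + j) * A p (front_face p \<sigma>) *
        B (n - p) (singular_face (Suc (n - p)) j (back_face p (Suc (n - p)) \<sigma>))" for p j
    have face: "singular_simplex n euclidean (singular_face (Suc n) k \<sigma>)" if "k \<le> Suc n" for k
      using that * singular_simplex_singular_face[of "Suc n" euclidean \<sigma> k] by auto
    have "cochain_at (delta (a * b)) (Suc n) \<sigma> =
       (\<Sum>k\<le>Suc n. \<Sum>p\<le>n. (-1) ^ k * (A p (front_face p (singular_face (Suc n) k \<sigma>)) *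
          B (n - p) (back_face p (n - p) (singular_face (Suc n) k \<sigma>))))"
      unfolding cochain_at_delta_Suc[OF *] coboundary_def
      by (intro sum.cong refl) (simp add: cochain_at_times[OF face] sum_distrib_left A_def B_def)
    also have "\<dots> = (\<Sum>p\<le>n. \<Sum>k\<le>Suc n. (-1) ^ k * (A p (front_face p (singular_face (Suc n) k \<sigma>)) *
          B (n - p) (back_face p (n - p) (singular_face (Suc n) k \<sigma>))))"
      by (rule sum.swap)
    also have "\<dots> = (\<Sum>p\<le>n. (\<Sum>k\<le>Suc p. U p k) + (\<Sum>j\<le>Suc (n - p). V p j))"
    proof (rule sum.cong[OF refl])
      fix p assume "p \<in> {..n}"
      then have p: "p \<le> n" by simp
      let ?t = "\<lambda>k. (-1) ^ k * (A p (front_face p (singular_face (Suc n) k \<sigma>)) *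
          B (n - p) (back_face p (n - p) (singular_face (Suc n) k \<sigma>)))"
      have "{..Suc n} = {..p} \<union> {Suc p..Suc n}" using p by auto
      then have "sum ?t {..Suc n} = sum ?t {..p} + sum ?t {Suc p..Suc n}"
        by (simp add: sum.union_disjoint)
      also have "sum ?t {..p} = sum (U p) {..p}"
        using p by (intro sum.cong) (auto simp: U_def front_face_face_le back_face_face_le)
      also have "sum ?t {Suc p..Suc n} = (\<Sum>j\<in>{1..Suc (n - p)}. V p j)"
        using p by (intro sum.reindex_bij_witness[of _ "\<lambda>j. j + p" "\<lambda>k. k - p"])
          (auto simp: V_def front_face_face_gt back_face_face_gt)
      also have "sum (U p) {..p} = (\<Sum>k\<le>Suc p. U p k) - U p (Suc p)"
        by simp
      also have "(\<Sum>j\<in>{1..Suc (n - p)}. V p j) = (\<Sum>j\<le>Suc (n - p). V p j) - V p 0"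
        by (simp add: atMost_atLeast0 sum.atLeast_Suc_atMost)
      also have "U p (Suc p) = - V p 0"
      proof -
        have "singular_face (Suc p) (Suc p) (front_face (Suc p) \<sigma>) = front_face p \<sigma>"
        proof -
          have "singular_face (Suc p) (Suc p) \<tau> = front_face p (singular_face (Suc p) (Suc p) \<tau>)"
            for \<tau> :: "'a sing_simplex"
            by (simp add: front_face_def singular_face_def)
          then show ?thesis
            using front_face_face_gt[of p "Suc p" p "front_face (Suc p) \<sigma>"]
            by (simp add: front_face_front_face)
        qed
        moreover have "singular_face (Suc (n - p)) 0 (back_face p (Suc (n - p)) \<sigma>) = back_face (Suc p) (n - p) \<sigma>"
        proof -
          have "simplical_face 0 x = shift 1 x" for x :: "nat \<Rightarrow> real"
            by (auto simp: simplical_face_def shift_def)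
          then have "singular_face (Suc (n - p)) 0 (back_face p (Suc (n - p)) \<sigma>) =
             back_face 1 (n - p) (back_face p (1 + (n - p)) \<sigma>)"
            by (simp add: singular_face_def back_face_def comp_def)
          then show ?thesis
            by (simp only: back_face_back_face) simp
        qed
        ultimately show ?thesis by (simp add: U_def V_def)
      qed
      finally show "sum ?t {..Suc n} = (\<Sum>k\<le>Suc p. U p k) + (\<Sum>j\<le>Suc (n - p). V p j)"
        by simp
    qed
    also have "\<dots> = (\<Sum>p\<le>n. \<Sum>k\<le>Suc p. U p k) + (\<Sum>p\<le>n. \<Sum>j\<le>Suc (n - p). V p j)"
      by (rule sum.distrib)
    also have "(\<Sum>p\<le>n. \<Sum>k\<le>Suc p. U p k) = cochain_at (delta a * b) (Suc n) \<sigma>"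
    proof -
      have "cochain_at (delta a * b) (Suc n) \<sigma> =
         (\<Sum>p\<le>n. cochain_at (delta a) (Suc p) (front_face (Suc p) \<sigma>) * B (n - p) (back_face (Suc p) (n - p) \<sigma>))"
        unfolding cochain_at_times[OF *] sum.atMost_Suc_shift
        by (simp add: cochain_at_delta_0 B_def)
      also have "\<dots> = (\<Sum>p\<le>n. \<Sum>k\<le>Suc p. U p k)"
      proof (intro sum.cong refl)
        fix p assume "p \<in> {..n}"
        then have "singular_simplex (Suc p) euclidean (front_face (Suc p) \<sigma>)"
          using * by (auto intro: singular_simplex_front_face)
        then show "cochain_at (delta a) (Suc p) (front_face (Suc p) \<sigma>) * B (n - p) (back_face (Suc p) (n - p) \<sigma>)
            = (\<Sum>k\<le>Suc p. U p k)"
          unfolding U_def A_def by (simp only: cochain_at_delta_Suc coboundary_def sum_distrib_right)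
      qed
      finally show ?thesis ..
    qed
    also have "(\<Sum>p\<le>n. \<Sum>j\<le>Suc (n - p). V p j) = cochain_at (sign_inv a * delta b) (Suc n) \<sigma>"
    proof -
      have "cochain_at (sign_inv a * delta b) (Suc n) \<sigma> =
         (\<Sum>p\<le>n. (-1) ^ p * A p (front_face p \<sigma>) * cochain_at (delta b) (Suc (n - p)) (back_face p (Suc (n - p)) \<sigma>))"
        unfolding cochain_at_times[OF *] sum.atMost_Suc
        by (simp add: cochain_at_delta_0 A_def sign_inv.rep_eq Suc_diff_le)
      also have "\<dots> = (\<Sum>p\<le>n. \<Sum>j\<le>Suc (n - p). V p j)"
      proof (intro sum.cong refl)
        fix p assume "p \<in> {..n}"
        then have "singular_simplex (Suc (n - p)) euclidean (back_face p (Suc (n - p)) \<sigma>)"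
          using * by (auto intro: singular_simplex_back_face)
        then show "(-1) ^ p * A p (front_face p \<sigma>) * cochain_at (delta b) (Suc (n - p)) (back_face p (Suc (n - p)) \<sigma>)
            = (\<Sum>j\<le>Suc (n - p). V p j)"
          unfolding cochain_at_delta_Suc[OF \<open>singular_simplex (Suc (n - p)) euclidean _\<close>]
            coboundary_def sum_distrib_left V_def B_def
          by (intro sum.cong refl) (simp add: power_add)
      qed
      finally show ?thesis ..
    qed
    finally show ?thesis
      by (simp add: Suc plus_cochain.rep_eq)
  qed
qed

lemma cochain_scale_times:
  "cochain_scale r a * b = cochain_scale r (a * b)" "a * cochain_scale r b = cochain_scale r (a * b)"
  by (rule cochain_eqI; simp add: cochain_at_times cochain_scale.rep_eq sum_distrib_left algebra_simps)+

text \<open>\<open>H\<^sup>*(X, \<rat>)\<close> for the space \<open>X = 'a\<close>, as cocycles modulo coboundaries.\<close>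

quotient_type (overloaded) 'a cohomology = "'a::topological_space cochain" / partial:
  "\<lambda>a b. delta a = 0 \<and> delta b = 0 \<and> a - b \<in> range delta"
proof (rule part_equivpI)
  show "\<exists>x :: 'a cochain. delta x = 0 \<and> delta x = 0 \<and> x - x \<in> range delta"
    by (rule exI[of _ 0]) (auto intro: image_eqI[of _ _ 0])
  show "symp (\<lambda>a b :: 'a cochain. delta a = 0 \<and> delta b = 0 \<and> a - b \<in> range delta)"
  proof (rule sympI)
    fix a b :: "'a cochain"
    assume *: "delta a = 0 \<and> delta b = 0 \<and> a - b \<in> range delta"
    then obtain c where "a - b = delta c" by auto
    then have "b - a = delta (- c)" by (metis delta_minus minus_diff_eq)
    with * show "delta b = 0 \<and> delta a = 0 \<and> b - a \<in> range delta" by auto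
  qed
  show "transp (\<lambda>a b :: 'a cochain. delta a = 0 \<and> delta b = 0 \<and> a - b \<in> range delta)"
  proof (rule transpI)
    fix a b c :: "'a cochain"
    assume *: "delta a = 0 \<and> delta b = 0 \<and> a - b \<in> range delta"
      "delta b = 0 \<and> delta c = 0 \<and> b - c \<in> range delta"
    then obtain d e where "a - b = delta d" "b - c = delta e" by auto
    then have "a - c = delta (d + e)" by (simp add: delta_add algebra_simps)
    with * show "delta a = 0 \<and> delta c = 0 \<and> a - c \<in> range delta" by auto
  qed
qed

instantiation cohomology :: (topological_space) "{zero, plus, uminus, minus, one, times}"
begin

lift_definition zero_cohomology :: "'a cohomology" is 0
  by (auto intro: image_eqI[of _ _ 0])

lift_definition one_cohomology :: "'a cohomology" is 1
  by (auto simp: delta_one intro: image_eqI[of _ _ 0])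

lift_definition plus_cohomology :: "'a cohomology \<Rightarrow> 'a cohomology \<Rightarrow> 'a cohomology" is "(+)"
proof -
  fix a a' b b' :: "'a cochain"
  assume *: "delta a = 0 \<and> delta a' = 0 \<and> a - a' \<in> range delta"
     "delta b = 0 \<and> delta b' = 0 \<and> b - b' \<in> range delta"
  then obtain x y where "a - a' = delta x" "b - b' = delta y" by auto
  then have "a + b - (a' + b') = delta (x + y)" by (simp add: delta_add algebra_simps)
  then have "a + b - (a' + b') \<in> range delta" by (rule range_eqI)
  with * show "delta (a + b) = 0 \<and> delta (a' + b') = 0 \<and> a + b - (a' + b') \<in> range delta"
    by (simp add: delta_add)
qed

lift_definition uminus_cohomology :: "'a cohomology \<Rightarrow> 'a cohomology" is "uminus"
proof -
  fix a a' :: "'a cochain"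
  assume *: "delta a = 0 \<and> delta a' = 0 \<and> a - a' \<in> range delta"
  then obtain x where "a - a' = delta x" by auto
  then have "- a - - a' = delta (- x)" unfolding delta_minus by (metis minus_diff_eq minus_diff_minus)
  then have "- a - - a' \<in> range delta" by (rule range_eqI)
  with * show "delta (- a) = 0 \<and> delta (- a') = 0 \<and> - a - - a' \<in> range delta"
    by (simp add: delta_minus)
qed

definition minus_cohomology :: "'a cohomology \<Rightarrow> 'a cohomology \<Rightarrow> 'a cohomology" where
  "minus_cohomology a b = a + - b"

lift_definition times_cohomology :: "'a cohomology \<Rightarrow> 'a cohomology \<Rightarrow> 'a cohomology" is "(*)"
proof -
  fix a a' b b' :: "'a cochain"
  assume *: "delta a = 0 \<and> delta a' = 0 \<and> a - a' \<in> range delta"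
     "delta b = 0 \<and> delta b' = 0 \<and> b - b' \<in> range delta"
  then obtain x y where xy: "a - a' = delta x" "b - b' = delta y" by auto
  have "delta (x * b + sign_inv a' * y) = delta x * b + a' * delta y"
    using * by (simp add: delta_add delta_times delta_sign_inv sign_inv_sign_inv)
  moreover have "a * b - a' * b' = (a - a') * b + a' * (b - b')"
    by (simp add: algebra_simps)
  ultimately have "a * b - a' * b' = delta (x * b + sign_inv a' * y)"
    by (simp only: xy)
  with * show "delta (a * b) = 0 \<and> delta (a' * b') = 0 \<and> a * b - a' * b' \<in> range delta"
    by (auto simp: delta_times)
qed

instance ..

end

instance cohomology :: (topological_space) ring_1
proof
  have refl: "x - x \<in> range delta" for x :: "'a cochain"
    by (auto intro: image_eqI[of _ _ 0])
  fix a b c :: "'a cohomology"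
  show "a + b + c = a + (b + c)" "a + b = b + a" "0 + a = a" "- a + a = 0"
    "a * b * c = a * (b * c)" "1 * a = a" "a * 1 = a"
    "(a + b) * c = a * c + b * c" "a * (b + c) = a * b + a * c"
    by (transfer; use refl in \<open>simp add: delta_add delta_times delta_minus delta_one algebra_simps\<close>)+
  show "a - b = a + - b" by (simp add: minus_cohomology_def)
  show "(0 :: 'a cohomology) \<noteq> 1"
  proof transfer
    obtain \<sigma> :: "'a sing_simplex" where "singular_simplex 0 euclidean \<sigma>"
      using singular_simplex_const by blast
    then have "cochain_at (0 - 1) 0 \<sigma> \<noteq> cochain_at (delta x) 0 \<sigma>" for x :: "'a cochain"
      by (simp add: cochain_at_delta_0 minus_cochain_at uminus_cochain.rep_eq
          zero_cochain.rep_eq one_cochain.rep_eq)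
    then have "0 - 1 \<noteq> delta x" for x :: "'a cochain" by metis
    then show "\<not> (delta 0 = 0 \<and> delta (1 :: 'a cochain) = 0 \<and> (0 :: 'a cochain) - 1 \<in> range delta)"
      by blast
  qed
qed

instantiation cohomology :: (topological_space) rat_algebra
begin

lift_definition scaleQ_cohomology :: "rat \<Rightarrow> 'a cohomology \<Rightarrow> 'a cohomology" is cochain_scale
proof -
  fix r and a a' :: "'a cochain"
  assume *: "delta a = 0 \<and> delta a' = 0 \<and> a - a' \<in> range delta"
  then obtain x where "a - a' = delta x" by auto
  moreover have "cochain_scale r a - cochain_scale r a' = cochain_scale r (a - a')"
    by (rule cochain_eqI) (simp add: cochain_scale.rep_eq minus_cochain_at algebra_simps)
  moreover have "cochain_scale r (0 :: 'a cochain) = 0"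
    by (rule cochain_eqI) (simp add: cochain_scale.rep_eq zero_cochain.rep_eq)
  ultimately have "cochain_scale r a - cochain_scale r a' = delta (cochain_scale r x)"
    "cochain_scale r (0 :: 'a cochain) = 0"
    by (simp_all add: delta_scale)
  then show "delta (cochain_scale r a) = 0 \<and> delta (cochain_scale r a') = 0 \<and>
      cochain_scale r a - cochain_scale r a' \<in> range delta"
    using * by (metis delta_scale rangeI)
qed

instance
proof
  have refl: "x - x \<in> range delta" for x :: "'a cochain"
    by (auto intro: image_eqI[of _ _ 0])
  have zero: "cochain_scale r (0 :: 'a cochain) = 0" for r
    by (rule cochain_eqI) (simp add: cochain_scale.rep_eq zero_cochain.rep_eq)
  have add: "cochain_scale r (a + b) = cochain_scale r a + cochain_scale r b"
    "cochain_scale (r + s) a = cochain_scale r a + cochain_scale s a"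
    "cochain_scale r (cochain_scale s a) = cochain_scale (r * s) a"
    "cochain_scale 1 a = a" for r s and a b :: "'a cochain"
    by (rule cochain_eqI; simp add: cochain_scale.rep_eq plus_cochain.rep_eq algebra_simps)+
  fix r s and a b :: "'a cohomology"
  show "r *\<^sub>Q (a + b) = r *\<^sub>Q a + r *\<^sub>Q b" "(r + s) *\<^sub>Q a = r *\<^sub>Q a + s *\<^sub>Q a"
    "r *\<^sub>Q s *\<^sub>Q a = (r * s) *\<^sub>Q a" "1 *\<^sub>Q a = a"
    "(r *\<^sub>Q a) * b = r *\<^sub>Q (a * b)" "a * (r *\<^sub>Q b) = r *\<^sub>Q (a * b)"
    by (transfer; use refl in \<open>simp add: add zero delta_add delta_scale delta_times cochain_scale_times\<close>)+
qed

end


lift_definition single_cochain :: "nat \<Rightarrow> ('a sing_simplex \<Rightarrow> rat) \<Rightarrow> 'a::topological_space cochain" is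
  "\<lambda>p f n \<sigma>. if n = p \<and> singular_simplex p euclidean \<sigma> then f \<sigma> else 0"
  by (auto intro: finite_subset[of _ "{p}" for p])

definition cohomology_class :: "nat \<Rightarrow> ('a sing_simplex \<Rightarrow> rat) \<Rightarrow> 'a::topological_space cohomology" where
  "cohomology_class p f = abs_cohomology (single_cochain p f)"

text \<open>\<open>H\<^sup>p(X, \<rat>)\<close> as a subspace of \<open>H\<^sup>*(X, \<rat>)\<close>.\<close>

definition cohomology_group :: "nat \<Rightarrow> 'a::topological_space cohomology set" where
  "cohomology_group p = {cohomology_class p f | f. delta (single_cochain p f) = (0 :: 'a cochain)}"


section \<open>Euler classes of complex vector bundles\<close>

text \<open>A complex vector bundle of rank \<open>CARD('n)\<close> on the space \<open>'a\<close> is given by open sets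
  \<open>U i\<close>, \<open>i \<in> I\<close>, covering \<open>'a\<close>, and a cocycle of transition matrices: \<open>g i j x\<close> takes
  coordinates with respect to \<open>i\<close> to coordinates with respect to \<open>j\<close>. A vector over \<open>x\<close>
  is the family of its coordinate vectors with respect to all \<open>i \<in> I\<close> such that \<open>x \<in> U i\<close>.\<close>

definition bundle_point :: "'i set \<Rightarrow> ('i \<Rightarrow> 'a set) \<Rightarrow> ('i \<Rightarrow> 'i \<Rightarrow> 'a \<Rightarrow> complex^'n^'n) \<Rightarrow>
    'i \<Rightarrow> 'a \<Rightarrow> complex^'n \<Rightarrow> 'a \<times> ('i \<Rightarrow> complex^'n)" where
  "bundle_point I U g i x v = (x, \<lambda>j. if j \<in> I \<and> x \<in> U j then g i j x *v v else 0)"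

definition bundle_topology :: "'i set \<Rightarrow> ('i \<Rightarrow> 'a::topological_space set) \<Rightarrow>
    ('i \<Rightarrow> 'i \<Rightarrow> 'a \<Rightarrow> complex^'n^'n) \<Rightarrow> ('a \<times> ('i \<Rightarrow> complex^'n)) topology" where
  "bundle_topology I U g = topology (\<lambda>W.
     W \<subseteq> {bundle_point I U g i x v | i x v. i \<in> I \<and> x \<in> U i} \<and>
     (\<forall>i\<in>I. open {(x, v). x \<in> U i \<and> bundle_point I U g i x v \<in> W}))"

lemma openin_bundle_topology:
  assumes "\<And>i. i \<in> I \<Longrightarrow> open (U i)"
  shows "openin (bundle_topology I U g) W \<longleftrightarrow>
     W \<subseteq> {bundle_point I U g i x v | i x v. i \<in> I \<and> x \<in> U i} \<and>
     (\<forall>i\<in>I. open {(x, v). x \<in> U i \<and> bundle_point I U g i x v \<in> W})"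
proof -
  have "istopology (\<lambda>W. W \<subseteq> {bundle_point I U g i x v | i x v. i \<in> I \<and> x \<in> U i} \<and>
     (\<forall>i\<in>I. open {(x, v). x \<in> U i \<and> bundle_point I U g i x v \<in> W}))"
    unfolding istopology_def
  proof (intro conjI allI impI ballI)
    fix S T and i
    assume S: "S \<subseteq> {bundle_point I U g i x v | i x v. i \<in> I \<and> x \<in> U i} \<and>
        (\<forall>i\<in>I. open {(x, v). x \<in> U i \<and> bundle_point I U g i x v \<in> S})"
      and T: "T \<subseteq> {bundle_point I U g i x v | i x v. i \<in> I \<and> x \<in> U i} \<and>
        (\<forall>i\<in>I. open {(x, v). x \<in> U i \<and> bundle_point I U g i x v \<in> T})"
    show "S \<inter> T \<subseteq> {bundle_point I U g i x v | i x v. i \<in> I \<and> x \<in> U i}" using S by blast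
    assume "i \<in> I"
    then have "open ({(x, v). x \<in> U i \<and> bundle_point I U g i x v \<in> S} \<inter>
        {(x, v). x \<in> U i \<and> bundle_point I U g i x v \<in> T})"
      using S T by blast
    then show "open {(x, v). x \<in> U i \<and> bundle_point I U g i x v \<in> S \<inter> T}"
      by (rule back_subst[of "open"]) auto
  next
    fix K and i
    assume K: "\<forall>W\<in>K. W \<subseteq> {bundle_point I U g i x v | i x v. i \<in> I \<and> x \<in> U i} \<and>
        (\<forall>i\<in>I. open {(x, v). x \<in> U i \<and> bundle_point I U g i x v \<in> W})"
    show "\<Union>K \<subseteq> {bundle_point I U g i x v | i x v. i \<in> I \<and> x \<in> U i}" using K by blast
    assume "i \<in> I"
    then have "open (\<Union>W\<in>K. {(x, v). x \<in> U i \<and> bundle_point I U g i x v \<in> W})"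
      using K by blast
    then show "open {(x, v). x \<in> U i \<and> bundle_point I U g i x v \<in> \<Union>K}"
      by (rule back_subst[of "open"]) auto
  qed
  then show ?thesis by (simp add: bundle_topology_def)
qed

text \<open>The affine simplex in \<open>\<complex>\<^sup>r\<close> with vertices \<open>-\<Sum>\<^sub>k (1 + \<i>) e\<^sub>k\<close>, \<open>e\<^sub>b\<^sub>0\<close>, \<open>\<i> e\<^sub>b\<^sub>0\<close>,
  \<open>e\<^sub>b\<^sub>1\<close>, \<open>\<i> e\<^sub>b\<^sub>1\<close>, \dots, for an enumeration \<open>b\<close> of the coordinates. It contains the origin in its
  interior and it is positively oriented for the complex orientation of \<open>\<complex>\<^sup>r\<close>, whatever \<open>b\<close> is.\<close>

definition affine_simplex :: "nat \<Rightarrow> (nat \<Rightarrow> 'v::real_vector) \<Rightarrow> 'v sing_simplex" where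
  "affine_simplex p l = restrict (\<lambda>t. \<Sum>j\<le>p. t j *\<^sub>R l j) (standard_simplex p)"

definition frame_vertex :: "(nat \<Rightarrow> 'n::finite) \<Rightarrow> nat \<Rightarrow> complex^'n" where
  "frame_vertex b j =
     (if j = 0 then (\<chi> k. - (1 + \<i>))
      else axis (b ((j - 1) div 2)) (if odd j then 1 else \<i>))"

text \<open>A cocycle on the total space \<open>E\<close> relative to the complement of the zero section that
  represents the Thom class: on each fibre it is the generator of
  \<open>H\<^sup>2\<^sup>r(E\<^sub>x, E\<^sub>x - 0)\<close> which takes the value \<open>1\<close> on positively oriented simplices around \<open>0\<close>.\<close>

definition thom_cocycle :: "'i set \<Rightarrow> ('i \<Rightarrow> 'a::topological_space set) \<Rightarrow>
    ('i \<Rightarrow> 'i \<Rightarrow> 'a \<Rightarrow> complex^'n^'n) \<Rightarrow> (('a \<times> ('i \<Rightarrow> complex^'n)) sing_simplex \<Rightarrow> rat) \<Rightarrow> bool" where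
  "thom_cocycle I U g u \<longleftrightarrow>
     (let E = bundle_topology I U g; n = 2 * CARD('n) in
       (\<forall>\<sigma>. singular_simplex (Suc n) E \<sigma> \<longrightarrow> coboundary n u \<sigma> = 0) \<and>
       (\<forall>\<sigma>. singular_simplex n (subtopology E (- range (\<lambda>x. (x, \<lambda>_. 0)))) \<sigma> \<longrightarrow> u \<sigma> = 0) \<and>
       (\<forall>i\<in>I. \<forall>x\<in>U i. \<forall>b. bij_betw b {..<CARD('n)} UNIV \<longrightarrow>
          u (simplex_map n (bundle_point I U g i x) (affine_simplex n (frame_vertex b))) = 1))"

definition euler_class :: "'i set \<Rightarrow> ('i \<Rightarrow> 'a::topological_space set) \<Rightarrow>
    ('i \<Rightarrow> 'i \<Rightarrow> 'a \<Rightarrow> complex^'n^'n) \<Rightarrow> 'a cohomology" where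
  "euler_class I U g = (THE e. \<exists>u. thom_cocycle I U g u \<and>
     e = cohomology_class (2 * CARD('n)) (\<lambda>\<sigma>. u (simplex_map (2 * CARD('n)) (\<lambda>x. (x, \<lambda>_. 0)) \<sigma>)))"


section \<open>Complex surfaces\<close>

type_synonym 'a chart = "'a set \<times> ('a \<Rightarrow> complex^2)"

definition transition :: "'a chart \<Rightarrow> 'a chart \<Rightarrow> complex^2 \<Rightarrow> complex^2" where
  "transition c d = snd d \<circ> inv_into (fst c) (snd c)"

text \<open>A holomorphic atlas; a map between open subsets of \<open>\<complex>\<^sup>2\<close> is holomorphic iff it has a
  complex linear derivative everywhere.\<close>

definition complex_surface :: "'a::topological_space chart set \<Rightarrow> bool" where
  "complex_surface A \<longleftrightarrow>
     (\<Union>c\<in>A. fst c) = UNIV \<and>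
     (\<forall>c\<in>A. open (fst c) \<and> open (snd c ` fst c) \<and>
        homeomorphism (fst c) (snd c ` fst c) (snd c) (inv_into (fst c) (snd c))) \<and>
     (\<forall>c\<in>A. \<forall>d\<in>A. \<forall>x\<in>fst c \<inter> fst d.
        \<exists>J. (transition c d has_derivative (\<lambda>h. J *v h)) (at (snd c x)))"

definition jacobian :: "'a chart \<Rightarrow> 'a chart \<Rightarrow> 'a \<Rightarrow> complex^2^2" where
  "jacobian c d x = (THE J. (transition c d has_derivative (\<lambda>h. J *v h)) (at (snd c x)))"

text \<open>Chern classes of the tangent bundle \<open>T\<close>, which has rank two: \<open>c\<^sub>2(T)\<close> is the Euler class
  of \<open>T\<close>, and \<open>c\<^sub>1(T)\<close> is the first Chern class, i.e. the Euler class, of the line bundle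
  \<open>det T\<close>.\<close>

definition chern1 :: "'a::topological_space chart set \<Rightarrow> 'a cohomology" where
  "chern1 A = euler_class A fst (\<lambda>c d x. (\<chi> i j. det (jacobian c d x)) :: complex^1^1)"

definition chern2 :: "'a::topological_space chart set \<Rightarrow> 'a cohomology" where
  "chern2 A = euler_class A fst jacobian"

definition s2_class :: "'a::topological_space chart set \<Rightarrow> 'a cohomology" where
  "s2_class A = chern1 A ^ 2 - chern2 A"

text \<open>A cycle representing the fundamental class: near every point it is homologous to a small
  simplex around that point which is positively oriented in a chart.\<close>

definition fundamental_cycle :: "'a::topological_space chart set \<Rightarrow> 'a chain \<Rightarrow> bool" where
  "fundamental_cycle A z \<longleftrightarrow>
     singular_relcycle 4 euclidean {} z \<and>
     (\<forall>c\<in>A. \<forall>x\<in>fst c. \<forall>\<epsilon>>0. \<forall>b. bij_betw b {..<2} UNIV \<longrightarrow>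
       (let \<tau> = affine_simplex 4 (\<lambda>j. snd c x + \<epsilon> *\<^sub>R frame_vertex b j) in
         \<tau> ` standard_simplex 4 \<subseteq> snd c ` fst c \<longrightarrow>
         homologous_rel 4 euclidean (- {x}) z
           (frag_of (simplex_map 4 (inv_into (fst c) (snd c)) \<tau>))))"

definition integral_over :: "'a::topological_space chart set \<Rightarrow> 'a cohomology \<Rightarrow> rat" where
  "integral_over A \<alpha> = (THE r. \<exists>z c. fundamental_cycle A z \<and> delta c = 0 \<and> \<alpha> = abs_cohomology c \<and>
     r = (\<Sum>\<sigma>\<in>Poly_Mapping.keys z. of_int (Poly_Mapping.lookup z \<sigma>) * cochain_at c 4 \<sigma>))"

text \<open>A list of entries \<open>((i, a), (j, b))\<close> with \<open>a \<in> H\<^sup>i\<close> and \<open>b \<in> H\<^sup>j\<close> stands for the tensor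
  \<open>\<Sum> a \<otimes> b\<close>. The diagonal class \<open>\<Delta>\<close> is the class in \<open>H\<^sup>*(S \<times> S) = H\<^sup>*(S) \<otimes> H\<^sup>*(S)\<close> with
  \<open>\<integral>\<^sub>S\<^sub>\<times>\<^sub>S \<Delta> \<cup> (\<alpha> \<otimes> \<beta>) = \<integral>\<^sub>S \<delta>\<^sup>*(\<alpha> \<otimes> \<beta>) = \<integral>\<^sub>S \<alpha> \<beta>\<close> for all \<open>\<alpha>\<close>, \<open>\<beta>\<close>, where \<open>\<delta>\<close> is the diagonal map;
  here \<open>(a \<otimes> b) (\<alpha> \<otimes> \<beta>) = (-1)\<^sup>j\<^sup>p a \<alpha> \<otimes> b \<beta>\<close> for \<open>\<alpha>\<close> of degree \<open>p\<close>.\<close>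

type_synonym 'h tensor = "((nat \<times> 'h) \<times> (nat \<times> 'h)) list"

definition represents_diagonal :: "'a::topological_space chart set \<Rightarrow> 'a cohomology tensor \<Rightarrow> bool" where
  "represents_diagonal A ts \<longleftrightarrow>
     (\<forall>((i, a), (j, b))\<in>set ts. a \<in> cohomology_group i \<and> b \<in> cohomology_group j) \<and>
     (\<forall>p r. \<forall>\<alpha>\<in>cohomology_group p. \<forall>\<beta>\<in>cohomology_group r.
        (\<Sum>((i, a), (j, b))\<leftarrow>ts. (-1) ^ (j * p) * integral_over A (a * \<alpha>) * integral_over A (b * \<beta>))
          = integral_over A (\<alpha> * \<beta>))"

definition diagonal_class :: "'a::topological_space chart set \<Rightarrow> 'a cohomology tensor" where
  "diagonal_class A = (SOME ts. represents_diagonal A ts)"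


section \<open>Superalgebras presented by generators and relations\<close>

datatype 'g word = Word (letters: "'g list")

instantiation word :: (type) monoid_add
begin

definition zero_word :: "'g word" where "zero_word = Word []"

definition plus_word :: "'g word \<Rightarrow> 'g word \<Rightarrow> 'g word" where
  "plus_word u v = Word (letters u @ letters v)"

instance
  by standard (simp_all add: zero_word_def plus_word_def)

end

type_synonym 'g free_algebra = "'g word \<Rightarrow>\<^sub>0 rat"

definition gen :: "'g \<Rightarrow> 'g free_algebra" where
  "gen g = Poly_Mapping.single (Word [g]) 1"

definition const :: "rat \<Rightarrow> 'g free_algebra" where
  "const r = Poly_Mapping.single 0 r"

definition free_ring :: "'g free_algebra ring" where
  "free_ring = \<lparr>carrier = UNIV, monoid.mult = (*), one = 1, ring.zero = 0, add = (+)\<rparr>"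

text \<open>\<open>component False\<close> and \<open>component True\<close> are the even and the odd part.\<close>

record 'x superalgebra = "'x ring" +
  scalar :: "rat \<Rightarrow> 'x \<Rightarrow> 'x"
  component :: "bool \<Rightarrow> 'x set"

text \<open>\<open>P e\<close> is the set of those generators that have parity \<open>e\<close>.\<close>

fun list_parity :: "(bool \<Rightarrow> 'g set) \<Rightarrow> bool \<Rightarrow> 'g list \<Rightarrow> bool" where
  "list_parity P e [] \<longleftrightarrow> \<not> e"
| "list_parity P e (g # gs) \<longleftrightarrow>
     g \<in> P False \<and> list_parity P e gs \<or> g \<in> P True \<and> list_parity P (\<not> e) gs"

definition presented_superalgebra ::
    "(bool \<Rightarrow> 'g set) \<Rightarrow> 'g free_algebra set \<Rightarrow> 'g free_algebra set superalgebra" where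
  "presented_superalgebra P R =
     (let I = genideal free_ring R; Q = FactRing free_ring I in
       \<lparr>carrier = carrier Q, monoid.mult = monoid.mult Q, one = one Q, ring.zero = ring.zero Q,
        add = add Q,
        scalar = (\<lambda>r x. monoid.mult Q (a_r_coset free_ring I (const r)) x),
        component = (\<lambda>e. a_r_coset free_ring I `
           {x. \<forall>w\<in>Poly_Mapping.keys x. list_parity P e (letters w)})\<rparr>)"

definition generated_subalgebra :: "'x superalgebra \<Rightarrow> 'x set \<Rightarrow> 'x superalgebra" where
  "generated_subalgebra A X =
     (let B = generate_ring A (X \<union> range (\<lambda>r. scalar A r (one A))) in
       A\<lparr>carrier := B, component := (\<lambda>e. component A e \<inter> B)\<rparr>)"

definition superalgebra_iso :: "'x superalgebra \<Rightarrow> 'y superalgebra \<Rightarrow> ('x \<Rightarrow> 'y) set" where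
  "superalgebra_iso A B = {h \<in> ring_iso A B.
     (\<forall>r. \<forall>x\<in>carrier A. h (scalar A r x) = scalar B r (h x)) \<and>
     (\<forall>e. h ` component A e = component B e)}"

text \<open>\<open>[a, b]\<close> and \<open>{a, b}\<close> for \<open>a\<close>, \<open>b\<close> of degrees \<open>p\<close>, \<open>r\<close>.\<close>

definition scomm :: "nat \<Rightarrow> nat \<Rightarrow> 'x::ring_1 \<Rightarrow> 'x \<Rightarrow> 'x" where
  "scomm p r a b = a * b - (-1) ^ (p * r) * (b * a)"

definition santicomm :: "nat \<Rightarrow> nat \<Rightarrow> 'x::ring_1 \<Rightarrow> 'x \<Rightarrow> 'x" where
  "santicomm p r a b = a * b + (-1) ^ (p * r) * (b * a)"

definition parity_part :: "(nat \<Rightarrow> 'h::ab_group_add set) \<Rightarrow> bool \<Rightarrow> 'h set" where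
  "parity_part H e = {\<Sum>d\<le>N. f d | f N. \<forall>d\<le>N. f d \<in> H d \<and> (odd d \<noteq> e \<longrightarrow> f d = 0)}"


section \<open>The algebras \<open>W\<^sup>\<ge>\<close> and \<open>W\<^sup>+\<close>\<close>

datatype 'h W_gen = Psi nat 'h | T nat 'h | Central

abbreviation psi :: "nat \<Rightarrow> 'h \<Rightarrow> 'h W_gen free_algebra" where
  "psi n \<xi> \<equiv> gen (Psi n \<xi>)"

abbreviation t :: "nat \<Rightarrow> 'h \<Rightarrow> 'h W_gen free_algebra" where
  "t n \<xi> \<equiv> gen (T n \<xi>)"

text \<open>The sign by which reordering \<open>\<xi>\<^sub>1, \<xi>\<^sub>2, \<xi>\<^sub>3\<close> (of degrees \<open>d\<^sub>i\<close>) to \<open>\<xi>\<^sub>w\<^sub>1, \<xi>\<^sub>w\<^sub>2, \<xi>\<^sub>w\<^sub>3\<close> changes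
  a graded commutative product.\<close>

definition koszul_sign :: "(nat \<Rightarrow> nat) \<Rightarrow> (nat \<Rightarrow> nat) \<Rightarrow> 'x::ring_1" where
  "koszul_sign d w =
     (-1) ^ (\<Sum>(i, j)\<in>{(i, j). i \<in> {1..3} \<and> j \<in> {1..3} \<and> i < j \<and> w j < w i}. d (w i) * d (w j))"

text \<open>The relators for a graded algebra \<open>H\<close> with classes \<open>c\<^sub>1\<close>, \<open>s\<^sub>2\<close> and a tensor \<open>\<Delta>\<close>.
  The tensor \<open>c\<^sub>1 \<Delta> \<xi> \<mu>\<close> is \<open>\<Sum> c\<^sub>1 a \<otimes> b \<xi> \<mu>\<close> when \<open>\<Delta> = \<Sum> a \<otimes> b\<close>; there are no signs since
  \<open>c\<^sub>1\<close> is even, and by the defining property of the diagonal class it does not matter which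
  tensor factor \<open>c\<^sub>1\<close>, \<open>\<xi>\<close>, \<open>\<mu>\<close> are multiplied to.\<close>

inductive_set W_relators ::
    "(nat \<Rightarrow> 'h::rat_algebra set) \<Rightarrow> 'h \<Rightarrow> 'h \<Rightarrow> 'h tensor \<Rightarrow> 'h W_gen free_algebra set"
  for H c1 s2 \<Delta> where
  psi_add: "psi n (\<xi> + \<mu>) - psi n \<xi> - psi n \<mu> \<in> W_relators H c1 s2 \<Delta>"
| psi_scale: "psi n (r *\<^sub>Q \<xi>) - const r * psi n \<xi> \<in> W_relators H c1 s2 \<Delta>"
| T_add: "t n (\<xi> + \<mu>) - t n \<xi> - t n \<mu> \<in> W_relators H c1 s2 \<Delta>"
| T_scale: "t n (r *\<^sub>Q \<xi>) - const r * t n \<xi> \<in> W_relators H c1 s2 \<Delta>"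
| central: "gen Central * gen g - gen g * gen Central \<in> W_relators H c1 s2 \<Delta>"
| psi_psi: "\<lbrakk>\<xi> \<in> H p; \<mu> \<in> H r\<rbrakk> \<Longrightarrow>
    scomm p r (psi m \<xi>) (psi n \<mu>) \<in> W_relators H c1 s2 \<Delta>"
| psi_T: "\<lbrakk>\<xi> \<in> H p; \<mu> \<in> H r\<rbrakk> \<Longrightarrow>
    scomm p r (psi m \<xi>) (t n \<mu>) - of_nat m * t (m + n - 1) (\<xi> * \<mu>) \<in> W_relators H c1 s2 \<Delta>"
| T_T: "\<lbrakk>\<xi> \<in> H p; \<mu> \<in> H r; \<nu> \<in> H l\<rbrakk> \<Longrightarrow>
    scomm (p + r) l (t m (\<xi> * \<mu>)) (t n \<nu>) - scomm p (r + l) (t m \<xi>) (t n (\<mu> * \<nu>))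
      \<in> W_relators H c1 s2 \<Delta>"
| quadratic: "\<lbrakk>\<xi> \<in> H p; \<mu> \<in> H r\<rbrakk> \<Longrightarrow>
    scomm p r (t m \<xi>) (t (n + 3) \<mu>) - 3 * scomm p r (t (m + 1) \<xi>) (t (n + 2) \<mu>)
      + 3 * scomm p r (t (m + 2) \<xi>) (t (n + 1) \<mu>) - scomm p r (t (m + 3) \<xi>) (t n \<mu>)
      - scomm p r (t m \<xi>) (t (n + 1) (s2 * \<mu>)) + scomm p r (t (m + 1) \<xi>) (t n (s2 * \<mu>))
      + (\<Sum>((i, a), (j, b))\<leftarrow>\<Delta>. santicomm i (j + p + r) (t m (c1 * a)) (t n (b * \<xi> * \<mu>)))
      \<in> W_relators H c1 s2 \<Delta>"
| cubic: "\<lbrakk>\<And>i. i \<in> {1..3} \<Longrightarrow> \<xi> i \<in> H (d i)\<rbrakk> \<Longrightarrow>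
    (\<Sum>w | w permutes {1..3}. koszul_sign d w *
       scomm (d (w 3)) (d (w 2) + d (w 1)) (t (m (w 3)) (\<xi> (w 3)))
         (scomm (d (w 2)) (d (w 1)) (t (m (w 2)) (\<xi> (w 2))) (t (m (w 1) + 1) (\<xi> (w 1)))))
      \<in> W_relators H c1 s2 \<Delta>"
| psi_vanish: "\<lbrakk>\<xi> \<in> H p; 2 * int n - 2 + int p < 0\<rbrakk> \<Longrightarrow> psi n \<xi> \<in> W_relators H c1 s2 \<Delta>"

definition W_parity :: "(nat \<Rightarrow> 'h::rat_algebra set) \<Rightarrow> bool \<Rightarrow> 'h W_gen set" where
  "W_parity H e = {Psi n \<xi> | n \<xi>. \<xi> \<in> parity_part H e} \<union> {T n \<xi> | n \<xi>. \<xi> \<in> parity_part H e} \<union>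
     (if e then {} else {Central})"

definition W_ge :: "(nat \<Rightarrow> 'h::rat_algebra set) \<Rightarrow> 'h \<Rightarrow> 'h \<Rightarrow> 'h tensor \<Rightarrow>
    'h W_gen free_algebra set superalgebra" where
  "W_ge H c1 s2 \<Delta> = presented_superalgebra (W_parity H) (W_relators H c1 s2 \<Delta>)"

definition W_plus :: "(nat \<Rightarrow> 'h::rat_algebra set) \<Rightarrow> 'h \<Rightarrow> 'h \<Rightarrow> 'h tensor \<Rightarrow>
    'h W_gen free_algebra set superalgebra" where
  "W_plus H c1 s2 \<Delta> = generated_subalgebra (W_ge H c1 s2 \<Delta>)
     {a_r_coset free_ring (genideal free_ring (W_relators H c1 s2 \<Delta>)) (t n \<xi>) | n \<xi>. True}"

definition W_plus_surface :: "'a::topological_space chart set \<Rightarrow>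
    'a cohomology W_gen free_algebra set superalgebra" where
  "W_plus_surface A = W_plus cohomology_group (chern1 A) (s2_class A) (diagonal_class A)"


section \<open>The Lie superalgebra \<open>w\<^sup>+\<close> and enveloping algebras\<close>

text \<open>The coefficient of \<open>(k, n)\<close> is the coefficient of \<open>z\<^sup>k\<^sup>+\<^sup>1 D\<^sup>n\<close>: in this way exactly the
  exponents \<open>m \<ge> 1\<close> of \<open>z\<close> occur.\<close>

type_synonym 'h w_plus = "nat \<times> nat \<Rightarrow>\<^sub>0 'h"

definition zD :: "nat \<Rightarrow> nat \<Rightarrow> 'h::zero \<Rightarrow> 'h w_plus" where
  "zD m n \<xi> = Poly_Mapping.single (m - 1, n) \<xi>"

text \<open>Polynomials in \<open>q\<close> whose coefficients are polynomials in \<open>D\<close>.\<close>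

definition bracket_poly :: "nat \<Rightarrow> nat \<Rightarrow> nat \<Rightarrow> nat \<Rightarrow> rat poly poly" where
  "bracket_poly m n m' n' =
     (let D = [:[:0, 1:]:]; q = [:0, 1:] in
       ((D + of_nat m' * q) ^ n * D ^ n' - D ^ n * (D + of_nat m * q) ^ n') div q)"

definition basis_bracket ::
    "'h::rat_algebra \<Rightarrow> nat \<Rightarrow> nat \<Rightarrow> 'h \<Rightarrow> nat \<Rightarrow> nat \<Rightarrow> 'h \<Rightarrow> 'h w_plus" where
  "basis_bracket q m n \<xi> m' n' \<mu> =
     (let p = bracket_poly m n m' n' in
       \<Sum>i\<le>Polynomial.degree p. \<Sum>b\<le>Polynomial.degree (poly.coeff p i).
         zD (m + m') b (poly.coeff (poly.coeff p i) b *\<^sub>Q (q ^ i * (\<xi> * \<mu>))))"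

definition w_bracket :: "'h::rat_algebra \<Rightarrow> 'h w_plus \<Rightarrow> 'h w_plus \<Rightarrow> 'h w_plus" where
  "w_bracket q x y =
     (\<Sum>(k, n)\<in>Poly_Mapping.keys x. \<Sum>(k', n')\<in>Poly_Mapping.keys y.
        basis_bracket q (k + 1) n (Poly_Mapping.lookup x (k, n))
          (k' + 1) n' (Poly_Mapping.lookup y (k', n')))"

definition w_scale :: "rat \<Rightarrow> 'h::rat_algebra w_plus \<Rightarrow> 'h w_plus" where
  "w_scale r x = (\<Sum>k\<in>Poly_Mapping.keys x. Poly_Mapping.single k (r *\<^sub>Q Poly_Mapping.lookup x k))"

definition w_parity :: "(nat \<Rightarrow> 'h::rat_algebra set) \<Rightarrow> bool \<Rightarrow> 'h w_plus set" where
  "w_parity H e = {x. \<forall>k. Poly_Mapping.lookup x k \<in> parity_part H e}"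

inductive_set U_relators ::
    "(rat \<Rightarrow> 'l::ab_group_add \<Rightarrow> 'l) \<Rightarrow> ('l \<Rightarrow> 'l \<Rightarrow> 'l) \<Rightarrow> (bool \<Rightarrow> 'l set) \<Rightarrow> 'l free_algebra set"
  for sc br P where
  add: "gen (x + y) - gen x - gen y \<in> U_relators sc br P"
| scale: "gen (sc r x) - const r * gen x \<in> U_relators sc br P"
| bracket: "\<lbrakk>x \<in> P e; y \<in> P f\<rbrakk> \<Longrightarrow>
    scomm (of_bool e) (of_bool f) (gen x) (gen y) - gen (br x y) \<in> U_relators sc br P"

definition enveloping_algebra ::
    "(rat \<Rightarrow> 'l::ab_group_add \<Rightarrow> 'l) \<Rightarrow> ('l \<Rightarrow> 'l \<Rightarrow> 'l) \<Rightarrow> (bool \<Rightarrow> 'l set) \<Rightarrow>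
      'l free_algebra set superalgebra" where
  "enveloping_algebra sc br P = presented_superalgebra P (U_relators sc br P)"

definition U_w_plus :: "'a::topological_space cohomology \<Rightarrow>
    'a cohomology w_plus free_algebra set superalgebra" where
  "U_w_plus q = enveloping_algebra w_scale (w_bracket q) (w_parity cohomology_group)"

end

theory Submission
  imports Defs
begin

text \<open>The isomorphism sends \<open>T\<^sub>n(\<lambda>)\<close> to \<open>z D\<^sup>n \<lambda>\<close>. It exists because \<open>W\<^sup>\<ge>(S)\<close> acts on \<open>U(w\<^sup>+)\<close>: the
  generator \<open>T\<^sub>n(\<lambda>)\<close> multiplies from the left by \<open>z D\<^sup>n \<lambda>\<close>, and \<open>\<psi>\<^sub>m(\<lambda>)\<close> acts as a superderivation.
  If elements of \<open>z\<close>-degree zero were admitted in \<open>w\<^sup>+\<close>, this derivation would be the adjoint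
  action of \<open>B(D) \<lambda>\<close>, where \<open>B\<close> is the polynomial \<open>q\<^sup>m B\<^sub>m(D/q)\<close> made from the Bernoulli polynomial
  \<open>B\<^sub>m\<close>. Since \<open>B(D + q) - B(D) = m q D\<^sup>m\<^sup>-\<^sup>1\<close>, it maps \<open>z\<^sup>k D\<^sup>n \<mu>\<close> to
  \<open>z\<^sup>k m (D\<^sup>m\<^sup>-\<^sup>1 + (D + q)\<^sup>m\<^sup>-\<^sup>1 + \<dots> + (D + (k - 1) q)\<^sup>m\<^sup>-\<^sup>1) D\<^sup>n \<lambda>\<mu>\<close>, and this formula only involves
  positive powers of \<open>z\<close> (\<open>power_sum_der\<close>). All defining relations of \<open>W\<^sup>\<ge>\<close> hold for these
  operators (\<open>relator_acts_trivially\<close>): those between the \<open>T\<^sub>n(\<lambda>)\<close> alone are identities between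
  polynomials in \<open>D\<close> and \<open>q\<close>, where \<open>c\<^sub>1 = 0\<close> removes the anticommutator and \<open>s\<^sub>2 = q\<^sup>2\<close> is what the
  third difference of the brackets requires. An element of \<open>W\<^sup>+\<close> that is zero in \<open>W\<^sup>\<ge>\<close> therefore
  acts as zero, and applying it to \<open>1\<close> shows that its image in \<open>U(w\<^sup>+)\<close> is zero.

  For injectivity and surjectivity an inverse is needed, that is, a homomorphism of Lie
  superalgebras from \<open>w\<^sup>+\<close> to \<open>W\<^sup>+\<close> with \<open>z D\<^sup>n \<lambda> \<mapsto> T\<^sub>n(\<lambda>)\<close> (\<open>lie_map\<close>, \<open>lie_map_bracket\<close>). The
  operator \<open>ad z\<close> maps the part of \<open>w\<^sup>+\<close> of \<open>z\<close>-degree \<open>k\<close> onto that of degree \<open>k + 1\<close>, with the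
  multiples \<open>z\<^sup>k \<lambda>\<close> in its kernel. So the homomorphism is determined by recursion on \<open>k\<close>: the image
  of \<open>[z, x]\<close> has to be the commutator of \<open>T\<^sub>0(1)\<close> with the image of \<open>x\<close>. The point is that \<open>T\<^sub>0(1)\<close>
  commutes with the resulting images of \<open>z\<^sup>k \<lambda>\<close>. In degree one all commutators are determined by
  the quadratic relation, because a sequence with vanishing third differences is quadratic, and
  vanishes if it is antisymmetric and begins with zero (\<open>T_T\<close>). In degree two the cubic relation
  is used, which contains the Serre relation \<open>[T\<^sub>0(1), [T\<^sub>0(1), T\<^sub>1(1)]] = 0\<close>; this Serre relation
  alone carries the induction to higher degrees, for \<open>ad z\<close> and \<open>ad z D\<close> simultaneously
  (\<open>commutes_step\<close>). Then \<open>\<psi>\<^sub>2(1)\<close>, which raises \<open>n\<close>, gives the brackets with \<open>z D\<^sup>n \<lambda>\<close> from those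
  with \<open>z \<lambda>\<close>, and \<open>ad z\<close> gives the remaining ones.

  The algebras are quotients of free algebras, and an element of a quotient is represented by an
  endomorphism of the free algebra (\<open>quotient_representation\<close>), so that congruences modulo the
  ideals become equations in an algebra. The signs in these arguments rest on the graded
  commutativity of the cup product, which is proved by means of Steenrod's cup-1 product
  (\<open>cohomology_group_supercomm\<close>).\<close>

section \<open>Rational algebras and linear extension\<close>

lemma scaleQ_zero_right [simp]: "r *\<^sub>Q (0::'a::rat_algebra) = 0"
  using scaleQ_add_right[of r 0 0] by simp

lemma scaleQ_zero_left [simp]: "0 *\<^sub>Q (x::'a::rat_algebra) = 0"
  using scaleQ_add_left[of 0 0 x] by simp

lemma scaleQ_minus_right: "r *\<^sub>Q (- x) = - (r *\<^sub>Q (x::'a::rat_algebra))"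
  using scaleQ_add_right[of r x "- x"] by (simp add: eq_neg_iff_add_eq_0 add.commute)

lemma scaleQ_minus_left: "(- r) *\<^sub>Q x = - (r *\<^sub>Q (x::'a::rat_algebra))"
  using scaleQ_add_left[of r "- r" x] by (simp add: eq_neg_iff_add_eq_0 add.commute)

lemma scaleQ_diff_right: "r *\<^sub>Q (x - y) = r *\<^sub>Q x - r *\<^sub>Q (y::'a::rat_algebra)"
  using scaleQ_add_right[of r x "- y"] by (simp add: scaleQ_minus_right)

lemma scaleQ_sum_right: "r *\<^sub>Q (\<Sum>i\<in>A. f i) = (\<Sum>i\<in>A. r *\<^sub>Q (f i :: 'a::rat_algebra))"
  by (induction A rule: infinite_finite_induct) (auto simp: scaleQ_add_right)

lemma scaleQ_of_nat: "of_nat n *\<^sub>Q (x::'a::rat_algebra) = of_nat n * x"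
  by (induction n) (simp_all add: scaleQ_add_left scaleQ_one distrib_right)

lemma scaleQ_numeral: "numeral n *\<^sub>Q (x::'a::rat_algebra) = numeral n * x"
  using scaleQ_of_nat[of "numeral n" x] by simp

lemma scaleQ_neg1: "(-1) *\<^sub>Q (x::'a::rat_algebra) = - x"
  by (simp add: scaleQ_minus_left scaleQ_one)

lemma scaleQ_cancel: "r \<noteq> 0 \<Longrightarrow> r *\<^sub>Q x = r *\<^sub>Q y \<longleftrightarrow>
    x = (y::'a::rat_algebra)"
  by (metis scaleQ_scaleQ scaleQ_one left_inverse)

lemma scaleQ_eq_0: "r \<noteq> 0 \<Longrightarrow> r *\<^sub>Q x = 0 \<longleftrightarrow> x = (0::'a::rat_algebra)"
  using scaleQ_cancel[of r x 0] by simp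

lemma scaleQ_half: "(1/2) *\<^sub>Q x + (1/2) *\<^sub>Q x = (x::'a::rat_algebra)"
  by (simp add: scaleQ_one flip: scaleQ_add_left)

instantiation rat :: rat_algebra
begin
definition scaleQ_rat :: "rat \<Rightarrow> rat \<Rightarrow> rat" where "scaleQ_rat r x = r * x"
instance by standard (simp_all add: scaleQ_rat_def algebra_simps)
end

lemma finite_support_induct [case_names zero single add]:
  fixes x :: "'a \<Rightarrow>\<^sub>0 'b::comm_monoid_add"
  assumes "P 0" "\<And>k b. P (Poly_Mapping.single k b)" "\<And>x y. P x \<Longrightarrow>
      P y \<Longrightarrow> P (x + y)"
  shows "P x"
proof -
  have "P (\<Sum>k\<in>A. Poly_Mapping.single k (Poly_Mapping.lookup x k))" if "finite A" for A
    using that by (induction A) (use assms in auto)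
  moreover have "(\<Sum>k\<in>Poly_Mapping.keys x. Poly_Mapping.single k (Poly_Mapping.lookup x k)) = x"
    by (rule poly_mapping_eqI)
       (simp add: lookup_sum lookup_single when_def in_keys_iff)
  ultimately show ?thesis by (metis finite_keys)
qed

instantiation poly_mapping :: (monoid_add, rat_algebra) rat_algebra
begin

definition scaleQ_poly_mapping :: "rat \<Rightarrow> ('a \<Rightarrow>\<^sub>0 'b) \<Rightarrow>
    ('a \<Rightarrow>\<^sub>0 'b)" where
  "scaleQ_poly_mapping r x = Poly_Mapping.map (\<lambda>b. r *\<^sub>Q b) x"

lemma lookup_scaleQ: "Poly_Mapping.lookup (r *\<^sub>Q x) k =
    r *\<^sub>Q Poly_Mapping.lookup (x :: 'a \<Rightarrow>\<^sub>0 'b) k"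
  by (simp add: scaleQ_poly_mapping_def Poly_Mapping.map.rep_eq when_def)

lemma scaleQ_single: "r *\<^sub>Q Poly_Mapping.single k (b::'b) = Poly_Mapping.single (k::'a) (r *\<^sub>Q b)"
  by (rule poly_mapping_eqI) (simp add: lookup_scaleQ lookup_single when_def)

lemma scaleQ_eq_single_mult: "r *\<^sub>Q x = Poly_Mapping.single 0 (r *\<^sub>Q (1::'b)) *
    (x :: 'a \<Rightarrow>\<^sub>0 'b)"
proof (induction x rule: finite_support_induct)
  case (single k v)
  then show ?case by (simp add: scaleQ_single mult_single mult_scaleQ_left)
next
  case zero
  show ?case by (rule poly_mapping_eqI) (simp add: lookup_scaleQ)
next
  case (add f g)
  have "r *\<^sub>Q (f + g) = r *\<^sub>Q f + r *\<^sub>Q g"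
    by (rule poly_mapping_eqI) (simp add: lookup_scaleQ lookup_add scaleQ_add_right)
  with add show ?case by (simp add: distrib_left)
qed

lemma scaleQ_eq_mult_single: "r *\<^sub>Q x = (x :: 'a \<Rightarrow>\<^sub>0 'b) * Poly_Mapping.single 0
    (r *\<^sub>Q (1::'b))"
proof (induction x rule: finite_support_induct)
  case (single k v)
  then show ?case by (simp add: scaleQ_single mult_single mult_scaleQ_right)
next
  case zero
  show ?case by (rule poly_mapping_eqI) (simp add: lookup_scaleQ)
next
  case (add f g)
  have "r *\<^sub>Q (f + g) = r *\<^sub>Q f + r *\<^sub>Q g"
    by (rule poly_mapping_eqI) (simp add: lookup_scaleQ lookup_add scaleQ_add_right)
  with add show ?case by (simp add: distrib_right)
qed

instance
proof
  fix r s :: rat and x y :: "'a \<Rightarrow>\<^sub>0 'b"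
  show "r *\<^sub>Q (x + y) = r *\<^sub>Q x + r *\<^sub>Q y" "(r + s) *\<^sub>Q x = r *\<^sub>Q x + s *\<^sub>Q x"
    "r *\<^sub>Q s *\<^sub>Q x = (r * s) *\<^sub>Q x" "1 *\<^sub>Q x = x"
    by (rule poly_mapping_eqI, simp add: lookup_scaleQ lookup_add scaleQ_add_right
        scaleQ_add_left scaleQ_scaleQ scaleQ_one)+
  show "(r *\<^sub>Q x) * y = r *\<^sub>Q (x * y)" by (simp add: scaleQ_eq_single_mult mult.assoc)
  show "x * (r *\<^sub>Q y) = r *\<^sub>Q (x * y)"
    by (simp add: scaleQ_eq_mult_single mult.assoc)
qed

end

lemma w_scale_eq: "w_scale r x = r *\<^sub>Q x"
proof (rule poly_mapping_eqI)
  fix k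
  have "Poly_Mapping.lookup (w_scale r x) k =
      (\<Sum>j\<in>Poly_Mapping.keys x. if j = k then r *\<^sub>Q Poly_Mapping.lookup x j else 0)"
    by (simp add: w_scale_def lookup_sum lookup_single when_def)
  also have "\<dots> = Poly_Mapping.lookup (r *\<^sub>Q x) k"
    by (auto simp: sum.delta lookup_scaleQ in_keys_iff)
  finally show "Poly_Mapping.lookup (w_scale r x) k = Poly_Mapping.lookup (r *\<^sub>Q x) k" .
qed

lemma const_mult: "const r * x = r *\<^sub>Q x"
  by (simp add: const_def scaleQ_eq_single_mult scaleQ_rat_def)

definition linear_extension :: "('k \<Rightarrow> 'b \<Rightarrow> 'c) \<Rightarrow>
    ('k \<Rightarrow>\<^sub>0 'b::zero) \<Rightarrow> 'c::comm_monoid_add" where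
  "linear_extension F x = (\<Sum>k\<in>Poly_Mapping.keys x. F k (Poly_Mapping.lookup x k))"

lemma linear_extension_superset:
  assumes "\<And>k. F k 0 = 0" "finite A" "Poly_Mapping.keys x \<subseteq> A"
  shows "linear_extension F x = (\<Sum>k\<in>A. F k (Poly_Mapping.lookup x k))"
  unfolding linear_extension_def
  by (rule sum.mono_neutral_left) (use assms in \<open>auto simp: in_keys_iff\<close>)

lemma linear_extension_single [simp]: "F k 0 = 0 \<Longrightarrow>
    linear_extension F (Poly_Mapping.single k b) = F k b"
  by (cases "b = 0") (simp_all add: linear_extension_def)

lemma linear_extension_0 [simp]: "linear_extension F 0 = 0"
  by (simp add: linear_extension_def)

lemma linear_extension_add:
  fixes F :: "'k \<Rightarrow> 'b::ab_group_add \<Rightarrow> 'c::ab_group_add"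
  assumes "\<And>k b c. F k (b + c) = F k b + F k c"
  shows "linear_extension F (x + y) = linear_extension F x + linear_extension F y"
proof -
  have 0: "F k 0 = 0" for k using assms[of k 0 0] by simp
  let ?A = "Poly_Mapping.keys x \<union> Poly_Mapping.keys y"
  show ?thesis
    using linear_extension_superset[of F ?A x, OF 0] linear_extension_superset[of F ?A y, OF 0]
      linear_extension_superset[of F ?A "x + y", OF 0] keys_add[of x y]
    by (simp add: lookup_add assms sum.distrib)
qed

lemma linear_extension_scaleQ:
  fixes F :: "'k::monoid_add \<Rightarrow> 'b::rat_algebra \<Rightarrow> 'c::rat_algebra"
  assumes "\<And>k. F k 0 = 0" "\<And>k b. F k (r *\<^sub>Q b) = r *\<^sub>Q F k b"
  shows "linear_extension F (r *\<^sub>Q x) = r *\<^sub>Q linear_extension F x"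
proof -
  have "Poly_Mapping.keys (r *\<^sub>Q x) \<subseteq> Poly_Mapping.keys x"
    by (auto simp: in_keys_iff lookup_scaleQ)
  then show ?thesis
    using linear_extension_superset[of F "Poly_Mapping.keys x" "r *\<^sub>Q x", OF assms(1)]
    by (simp add: linear_extension_def assms(2) lookup_scaleQ scaleQ_sum_right)
qed

definition qlinear :: "('a::rat_algebra \<Rightarrow> 'b::rat_algebra) \<Rightarrow> bool" where
  "qlinear f \<longleftrightarrow> (\<forall>x y. f (x + y) = f x +
      f y) \<and> (\<forall>r x. f (r *\<^sub>Q x) = r *\<^sub>Q f x)"

lemma qlinearI:
  "(\<And>x y. f (x + y) = f x + f y) \<Longrightarrow> (\<And>r x. f (r *\<^sub>Q x) =
      r *\<^sub>Q f x) \<Longrightarrow> qlinear f"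
  by (simp add: qlinear_def)

lemma qlinear_add: "qlinear f \<Longrightarrow> f (x + y) = f x + f y"
  and qlinear_scaleQ: "qlinear f \<Longrightarrow> f (r *\<^sub>Q x) = r *\<^sub>Q f x"
  by (simp_all add: qlinear_def)

lemma qlinear_0: "qlinear f \<Longrightarrow> f 0 = 0"
  using qlinear_scaleQ[of f 0 0] by simp

lemma qlinear_minus: "qlinear f \<Longrightarrow> f (- x) = - f x"
  using qlinear_scaleQ[of f "-1" x] by (simp add: scaleQ_neg1)

lemma qlinear_diff: "qlinear f \<Longrightarrow> f (x - y) = f x - f y"
  using qlinear_add[of f x "- y"] by (simp add: qlinear_minus)

lemma qlinear_sum: "qlinear f \<Longrightarrow> f (\<Sum>i\<in>A. g i) = (\<Sum>i\<in>A. f (g i))"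
  by (induction A rule: infinite_finite_induct) (auto simp: qlinear_0 qlinear_add)

lemmas qlinear_rules = qlinear_0 qlinear_add qlinear_scaleQ qlinear_minus qlinear_diff qlinear_sum

lemma qlinear_linear_extension:
  fixes F :: "'k::monoid_add \<Rightarrow> 'b::rat_algebra \<Rightarrow> 'c::rat_algebra"
  assumes "\<And>k. qlinear (F k)"
  shows "qlinear (linear_extension F)"
  by (rule qlinearI)
     (simp_all add: linear_extension_add linear_extension_scaleQ qlinear_add qlinear_scaleQ qlinear_0 assms)

section \<open>Polynomials in \<open>D\<close> and \<open>q\<close>\<close>

definition Dv :: "rat poly poly" where "Dv = [:[:0, 1:]:]"
definition qv :: "rat poly poly" where "qv = [:0, 1:]"

definition eval_Dq :: "rat \<Rightarrow> rat \<Rightarrow> rat poly poly \<Rightarrow> rat" where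
  "eval_Dq x y P = poly (poly P [:y:]) x"

lemma eval_Dq_simps [simp]:
  "eval_Dq x y (P + Q) = eval_Dq x y P + eval_Dq x y Q" "eval_Dq x y (P - Q) = eval_Dq x y P - eval_Dq x y Q"
  "eval_Dq x y (P * Q) = eval_Dq x y P * eval_Dq x y Q" "eval_Dq x y (P ^ n) = eval_Dq x y P ^ n"
      "eval_Dq x y (- P) = - eval_Dq x y P"
  "eval_Dq x y 0 = 0" "eval_Dq x y 1 = 1" "eval_Dq x y Dv = x" "eval_Dq x y qv = y"
      "eval_Dq x y (of_nat n) = of_nat n"
  "eval_Dq x y [:[:r:]:] = r" "eval_Dq x y (numeral k) = numeral k"
  by (simp_all add: eval_Dq_def of_nat_poly poly_power Dv_def qv_def)

lemma eval_Dq_sum [simp]: "eval_Dq x y (\<Sum>i\<in>A. F i) = (\<Sum>i\<in>A. eval_Dq x y (F i))"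
  by (induction A rule: infinite_finite_induct) auto

lemma eval_Dq_smult [simp]: "eval_Dq x y (Polynomial.smult [:r:] P) = r * eval_Dq x y P"
  by (simp add: eval_Dq_def)

lemma eval_Dq_pCons: "eval_Dq x y (pCons a P) = poly a x + y * eval_Dq x y P"
  by (simp add: eval_Dq_def)

text \<open>The brackets contain a division by \<open>q\<close>. At points with \<open>q = y \<noteq> 0\<close> it becomes division of
  numbers, and infinitely many such points suffice. In this way every identity between brackets
  below is reduced to an identity between rational functions.\<close>

lemma eval_Dq_eqI:
  assumes "\<And>x y. y \<noteq> 0 \<Longrightarrow> eval_Dq x y P = eval_Dq x y Q"
  shows "P = Q"
proof (rule ccontr)
  assume "P \<noteq> Q"
  then have fin: "finite {z. poly (P - Q) z = 0}"
    by (intro poly_roots_finite) simp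
  have "poly (P - Q) [:y:] = 0" if "y \<noteq> 0" for y :: rat
    using assms[OF that] by (simp add: eval_Dq_def poly_eq_poly_eq_iff[symmetric] fun_eq_iff)
  then have "(\<lambda>y. [:y:]) ` {y. y \<noteq> 0} \<subseteq> {z. poly (P - Q) z = 0}"
    by auto
  then have "finite ((\<lambda>y. [:y:]) ` {y::rat. y \<noteq> 0})"
    using fin finite_subset by blast
  then have "finite {y::rat. y \<noteq> 0}"
    by (rule finite_imageD) (auto simp: inj_on_def)
  moreover have "UNIV = insert 0 {y::rat. y \<noteq> 0}" by auto
  ultimately show False using infinite_UNIV_char_0[where ?'a = rat]
    by (metis finite_insert)
qed

lemma shift_exists: "\<exists>S. \<forall>x y. eval_Dq x y S = eval_Dq (x + of_nat c * y) y P"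
proof (induction P)
  case 0
  show ?case by (rule exI[of _ 0]) simp
next
  case (pCons a P)
  then obtain S where S: "eval_Dq x y S = eval_Dq (x + of_nat c * y) y P" for x y by blast
  have "\<exists>S. \<forall>x y. eval_Dq x y S = poly a (x + of_nat c * y)"
  proof (induction a)
    case 0
    show ?case by (rule exI[of _ 0]) simp
  next
    case (pCons r a)
    then obtain S where "eval_Dq x y S = poly a (x + of_nat c * y)" for x y by blast
    then show ?case
      by (intro exI[of _ "[:[:r:]:] + (Dv + of_nat c * qv) * S"]) simp
  qed
  then obtain S' where "eval_Dq x y S' = poly a (x + of_nat c * y)" for x y by blast
  with S show ?case
    by (intro exI[of _ "S' + qv * S"]) (simp add: eval_Dq_pCons)
qed

definition shift_D :: "nat \<Rightarrow> rat poly poly \<Rightarrow> rat poly poly" where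
  "shift_D c P = (SOME S. \<forall>x y. eval_Dq x y S = eval_Dq (x + of_nat c * y) y P)"

lemma eval_Dq_shift_D [simp]: "eval_Dq x y (shift_D c P) = eval_Dq (x + of_nat c * y) y P"
  using someI_ex[OF shift_exists[of c P]] by (simp add: shift_D_def)

text \<open>The bracket of \<open>z\<^sup>j P\<close> and \<open>z\<^sup>k Q\<close> for arbitrary polynomials \<open>P\<close>, \<open>Q\<close> in \<open>D\<close> and \<open>q\<close>, without
  \<open>z\<^sup>j\<^sup>+\<^sup>k\<close> and the coefficients.\<close>

definition poly_bracket :: "nat \<Rightarrow> nat \<Rightarrow> rat poly poly \<Rightarrow> rat poly poly
    \<Rightarrow> rat poly poly" where
  "poly_bracket j k P Q = (shift_D k P * Q - P * shift_D j Q) div qv"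

lemma qv_dvdI:
  assumes "\<And>x. eval_Dq x 0 P = 0"
  shows "qv dvd P"
proof -
  have "poly P 0 = 0"
    using assms by (simp add: eval_Dq_def poly_eq_poly_eq_iff[symmetric] fun_eq_iff)
  then show ?thesis by (simp add: poly_eq_0_iff_dvd qv_def)
qed

text \<open>The division is exact because the numerator vanishes for \<open>q = 0\<close>.\<close>

lemma eval_Dq_poly_bracket: "y \<noteq> 0 \<Longrightarrow> eval_Dq x y (poly_bracket j k P Q) =
   (eval_Dq (x + of_nat k * y) y P * eval_Dq x y Q - eval_Dq x y P * eval_Dq (x + of_nat j * y) y Q) / y"
proof -
  let ?N = "shift_D k P * Q - P * shift_D j Q"
  have "qv dvd ?N" by (rule qv_dvdI) simp
  then have "qv * poly_bracket j k P Q = ?N" by (simp add: poly_bracket_def)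
  then have "eval_Dq x y (qv * poly_bracket j k P Q) = eval_Dq x y ?N" by simp
  then show "y \<noteq> 0 \<Longrightarrow> ?thesis" by (simp add: field_simps)
qed

lemma bracket_poly_eq: "bracket_poly m n m' n' = poly_bracket m m' (Dv ^ n) (Dv ^ n')"
proof -
  have "shift_D c (Dv ^ n) = (Dv + of_nat c * qv) ^ n" for c n
    by (rule eval_Dq_eqI) simp
  then show ?thesis by (simp add: bracket_poly_def poly_bracket_def Let_def Dv_def qv_def)
qed

lemma poly_bracket_add_left: "poly_bracket j k (P + P') Q = poly_bracket j k P Q + poly_bracket j k P' Q"
  by (rule eval_Dq_eqI) (simp add: eval_Dq_poly_bracket field_simps)

lemma poly_bracket_add_right: "poly_bracket j k P (Q + Q') = poly_bracket j k P Q + poly_bracket j k P Q'"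
  by (rule eval_Dq_eqI) (simp add: eval_Dq_poly_bracket field_simps)

lemma poly_bracket_smult_left: "poly_bracket j k (Polynomial.smult [:r:] P) Q =
    Polynomial.smult [:r:] (poly_bracket j k P Q)"
  by (rule eval_Dq_eqI) (simp add: eval_Dq_poly_bracket field_simps)

lemma poly_bracket_smult_right: "poly_bracket j k P (Polynomial.smult [:r:] Q) =
    Polynomial.smult [:r:] (poly_bracket j k P Q)"
  by (rule eval_Dq_eqI) (simp add: eval_Dq_poly_bracket field_simps)

lemma poly_bracket_qv_left: "poly_bracket j k (qv * P) Q = qv * poly_bracket j k P Q"
  by (rule eval_Dq_eqI) (simp add: eval_Dq_poly_bracket field_simps)

lemma poly_bracket_qv_right: "poly_bracket j k P (qv * Q) = qv * poly_bracket j k P Q"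
  by (rule eval_Dq_eqI) (simp add: eval_Dq_poly_bracket field_simps)

lemma poly_bracket_antisym: "poly_bracket k j Q P = - poly_bracket j k P Q"
  by (rule eval_Dq_eqI) (simp add: eval_Dq_poly_bracket field_simps)

text \<open>Let \<open>z\<^sup>j P\<close> act on polynomials by \<open>f(D) \<mapsto> P(D) f(D + j q)\<close>. The bracket then corresponds to
  \<open>-1/q\<close> times the commutator of operators, and this satisfies the Jacobi identity.\<close>

lemma poly_bracket_jacobi:
  "poly_bracket i (j + k) P (poly_bracket j k Q R) = poly_bracket (i + j) k (poly_bracket i j P Q) R +
      poly_bracket j (i + k) Q (poly_bracket i k P R)"
  by (rule eval_Dq_eqI) (simp add: eval_Dq_poly_bracket field_simps)

text \<open>The value for \<open>m = 0\<close> is zero due to the factor \<open>m\<close>, whatever the truncated exponent \<open>m - 1\<close>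
  is.\<close>

definition power_sum :: "nat \<Rightarrow> nat \<Rightarrow> rat poly poly" where
  "power_sum k m = of_nat m * (\<Sum>j<k. (Dv + of_nat j * qv) ^ (m - 1))"

lemma eval_Dq_power_sum [simp]: "eval_Dq x y (power_sum k m) = of_nat m * (\<Sum>j<k. (x + of_nat j * y) ^ (m - 1))"
  by (simp add: power_sum_def)

text \<open>Multiplying the part of degree \<open>k\<close> by the sum \<open>s\<^sub>k(D)\<close> of \<open>k\<close> consecutive shifts is a
  derivation, because \<open>s\<^sub>j\<^sub>+\<^sub>k(D) = s\<^sub>k(D) + s\<^sub>j(D + k q) = s\<^sub>j(D) + s\<^sub>k(D + j q)\<close>: the first splitting
  fits the first term of the bracket, the second splitting fits the second term.\<close>

lemma power_sum_poly_bracket: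
  "power_sum (j + k) m * poly_bracket j k P Q = poly_bracket j k (power_sum j m * P) Q +
      poly_bracket j k P (power_sum k m * Q)"
proof (rule eval_Dq_eqI)
  fix x y :: rat assume y: "y \<noteq> 0"
  define s where "s c l = of_nat m * (\<Sum>i<l. (x + of_nat c * y + of_nat i * y) ^ (m - 1))" for c l
  have split: "s 0 (c + l) = s 0 c + s c l" for c l
  proof -
    have "(\<Sum>i<c + l. (x + of_nat i * y) ^ (m - 1)) = (\<Sum>i<c. (x + of_nat i * y) ^ (m - 1)) +
        (\<Sum>i<l. (x + of_nat c * y + of_nat i * y) ^ (m - 1))"
      by (induction l) (simp_all add: algebra_simps)
    then show ?thesis by (simp add: s_def distrib_left)
  qed
  have e: "eval_Dq (x + of_nat c * y) y (power_sum l m) = s c l" "eval_Dq x y (power_sum l m) = s 0 l" for c l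
    by (simp_all add: s_def)
  show "eval_Dq x y (power_sum (j + k) m * poly_bracket j k P Q) =
      eval_Dq x y (poly_bracket j k (power_sum j m * P) Q + poly_bracket j k P (power_sum k m * Q))"
  proof -
    have "s 0 (j + k) * (a - b) = (s k j * a - s 0 j * b) + (s 0 k * a - s j k * b)" for a b
    proof -
      have 1: "s 0 (j + k) = s 0 k + s k j" and 2: "s 0 (j + k) = s 0 j + s j k"
        using split[of j k] split[of k j] by (simp_all add: add.commute)
      have "s 0 (j + k) * (a - b) = s 0 (j + k) * a - s 0 (j + k) * b"
        by (rule right_diff_distrib)
      also have "\<dots> = (s 0 k + s k j) * a - (s 0 j + s j k) * b"
        by (metis 1 2)
      finally show ?thesis by (simp add: algebra_simps)
    qed
    then have "s 0 (j + k) * ((a - b) / y) = (s k j * a - s 0 j * b) / y + (s 0 k * a - s j k * b) / y" for a b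
      by (metis add_divide_distrib times_divide_eq_right)
    from this[of "eval_Dq (x + of_nat k * y) y P * eval_Dq x y Q" "eval_Dq x y P * eval_Dq (x + of_nat j * y) y Q"]
    show ?thesis
      by (simp only: eval_Dq_simps eval_Dq_poly_bracket[OF y] e mult.assoc mult.left_commute)
  qed
qed

text \<open>The rules for \<open>qv\<close> and \<open>smult\<close> replace an induction over the coefficients: a property that
  is linear and compatible with multiplication by \<open>q\<close> only has to be checked for the powers of
  \<open>D\<close>.\<close>

lemma bivariate_poly_induct [case_names zero add qv smult Dv]:
  assumes "S 0" "\<And>P Q. S P \<Longrightarrow> S Q \<Longrightarrow> S (P + Q)"
      "\<And>P. S P \<Longrightarrow> S (qv * P)"
    "\<And>r P. S P \<Longrightarrow> S (Polynomial.smult [:r:] P)" "\<And>n. S (Dv ^ n)"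
  shows "S P"
proof (induction P)
  case 0
  show ?case by fact
next
  case (pCons a P)
  have Dn: "Dv ^ n = [:Polynomial.monom 1 n:]" for n
    by (induction n) (simp_all add: Dv_def one_pCons monom_altdef)
  have "S [:\<Sum>n\<le>N. Polynomial.monom (poly.coeff a n) n:]" for N
  proof (induction N)
    case 0
    have "[:Polynomial.monom (poly.coeff a 0) 0:] = Polynomial.smult [:poly.coeff a 0:] (Dv ^ 0)"
      by (simp add: Dn smult_monom monom_0)
    then show ?case using assms(4)[OF assms(5)[of 0], of "poly.coeff a 0"] by simp
  next
    case (Suc N)
    have "[:Polynomial.monom (poly.coeff a (Suc N)) (Suc N):] =
        Polynomial.smult [:poly.coeff a (Suc N):] (Dv ^ Suc N)"
      by (simp only: Dn) (simp add: smult_monom)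
    then have "S [:Polynomial.monom (poly.coeff a (Suc N)) (Suc N):]" using assms by metis
    from assms(2)[OF Suc this] show ?case by simp
  qed
  from this[of "Polynomial.degree a"] have "S [:a:]" by (simp add: poly_as_sum_of_monoms)
  from assms(2)[OF this assms(3)[OF pCons(2)]] show ?case by (simp add: qv_def)
qed

section \<open>Cup-1 products and graded commutativity of the cup product\<close>

text \<open>The affine map between standard simplices that sends the vertex \<open>j\<close> to the vertex \<open>f j\<close>.
  Front faces, back faces and the faces \<open>singular_face\<close> are all restrictions along such maps, so
  the face identities become equations between functions on vertices.\<close>

definition push :: "nat \<Rightarrow> (nat \<Rightarrow> nat) \<Rightarrow> (nat \<Rightarrow> real)
    \<Rightarrow> nat \<Rightarrow> real" where
  "push p f x = (\<lambda>i. \<Sum>j\<le>p. if f j = i then x j else 0)"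

definition face_along :: "nat \<Rightarrow> (nat \<Rightarrow> nat) \<Rightarrow> 'a sing_simplex \<Rightarrow>
    'a sing_simplex" where
  "face_along p f \<sigma> = restrict (\<sigma> \<circ> push p f) (standard_simplex p)"

definition skip :: "nat \<Rightarrow> nat \<Rightarrow> nat" where
  "skip k j = (if j < k then j else Suc j)"

lemma push_in_standard_simplex:
  assumes "x \<in> standard_simplex p" "\<And>j. j \<le> p \<Longrightarrow> f j \<le> n"
  shows "push p f x \<in> standard_simplex n"
proof -
  have x: "x j \<ge> 0" "(\<Sum>j\<le>p. x j) = 1" for j
    using assms(1) by (auto simp: standard_simplex_def)
  have "push p f x i \<le> (\<Sum>j\<le>p. x j)" for i
    unfolding push_def by (rule sum_mono) (use x in auto)
  moreover have "(\<Sum>i\<le>n. push p f x i) = (\<Sum>j\<le>p. \<Sum>i\<le>n. if f j = i then x j else 0)"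
    unfolding push_def by (rule sum.swap)
  moreover have "\<dots> = (\<Sum>j\<le>p. x j)"
    by (intro sum.cong refl) (use assms(2) in \<open>auto simp: sum.delta'\<close>)
  moreover have "push p f x i = 0" if "i > n" for i
    unfolding push_def by (rule sum.neutral) (use that assms(2) in fastforce)
  moreover have "push p f x i \<ge> 0" for i
    unfolding push_def by (rule sum_nonneg) (use x in auto)
  ultimately show ?thesis
    using x by (simp add: standard_simplex_def)
qed

lemma push_push:
  assumes "\<And>j. j \<le> p \<Longrightarrow> g j \<le> m"
  shows "push m f (push p g x) = push p (f \<circ> g) x"
proof
  fix i
  have "push m f (push p g x) i = (\<Sum>j\<le>m. \<Sum>l\<le>p. if f j = i \<and> g l = j then x l else 0)"
    unfolding push_def by (intro sum.cong) auto
  also have "\<dots> = (\<Sum>l\<le>p. \<Sum>j\<le>m. if j = g l then (if f (g l) = i then x l else 0) else 0)"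
    by (subst sum.swap) (intro sum.cong, auto)
  also have "\<dots> = push p (f \<circ> g) x i"
    unfolding push_def by (intro sum.cong) (use assms in \<open>auto simp: sum.delta\<close>)
  finally show "push m f (push p g x) i = push p (f \<circ> g) x i" .
qed

lemma push_inj:
  assumes "x \<in> standard_simplex p" "inj f"
  shows "push p f x (f l) = x l"
proof -
  have "push p f x (f l) = (\<Sum>j\<le>p. if j = l then x l else 0)"
    unfolding push_def by (intro sum.cong) (use assms(2) in \<open>auto simp: inj_eq\<close>)
  also have "\<dots> = x l"
    using assms(1) by (auto simp: sum.delta standard_simplex_def)
  finally show ?thesis .
qed

lemma push_not_range: "i \<notin> range f \<Longrightarrow> push p f x i = 0"
  unfolding push_def by (auto intro!: sum.neutral)

lemma push_skip:
  assumes "x \<in> standard_simplex p"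
  shows "push p (skip k) x = simplical_face k x"
proof
  fix i
  have inj: "inj (skip k)" by (auto simp: inj_def skip_def split: if_splits)
  consider "i < k" | "i = k" | "i > k" by linarith
  then show "push p (skip k) x i = simplical_face k x i"
  proof cases
    case 1
    then show ?thesis
      using push_inj[OF assms inj, of i] by (simp add: skip_def simplical_face_def)
  next
    case 2
    then have "i \<notin> range (skip k)" by (auto simp: skip_def split: if_splits)
    then show ?thesis using 2 by (simp add: push_not_range simplical_face_def)
  next
    case 3
    then have "skip k (i - 1) = i" by (simp add: skip_def)
    then show ?thesis
      using 3 push_inj[OF assms inj, of "i - 1"] by (simp add: simplical_face_def)
  qed
qed

lemma push_shift:
  assumes "x \<in> standard_simplex r"
  shows "push r (\<lambda>i. i + p) x = shift p x"
proof
  fix i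
  have inj: "inj (\<lambda>i::nat. i + p)" by (auto simp: inj_def)
  show "push r (\<lambda>i. i + p) x i = shift p x i"
  proof (cases "i < p")
    case True
    then show ?thesis by (subst push_not_range) (auto simp: shift_def)
  next
    case False
    then show ?thesis using push_inj[OF assms inj, of "i - p"] by (simp add: shift_def)
  qed
qed

lemma push_id: "x \<in> standard_simplex p \<Longrightarrow> push p (\<lambda>i. i) x = x"
  using push_shift[of x p 0] by (auto simp: shift_def)

lemma continuous_map_push:
  "continuous_map (powertop_real UNIV) (powertop_real UNIV) (push p f)"
  unfolding continuous_map_componentwise_UNIV push_def
  by (auto intro!: continuous_map_sum continuous_map_product_projection)

lemma singular_simplex_face_along:
  assumes "singular_simplex n X \<sigma>" "\<And>j. j \<le> p \<Longrightarrow> f j \<le> n"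
  shows "singular_simplex p X (face_along p f \<sigma>)"
  unfolding face_along_def singular_simplex_def
proof
  have "continuous_map (subtopology (powertop_real UNIV) (standard_simplex p))
     (subtopology (powertop_real UNIV) (standard_simplex n)) (push p f)"
    using push_in_standard_simplex[OF _ assms(2)] continuous_map_push
    by (auto simp: continuous_map_in_subtopology intro!: continuous_map_from_subtopology)
  then have "continuous_map (subtopology (powertop_real UNIV) (standard_simplex p)) X (\<sigma> \<circ> push p f)"
    using assms unfolding singular_simplex_def by (meson continuous_map_compose)
  then show "continuous_map (subtopology (powertop_real UNIV) (standard_simplex p)) X
      (restrict (\<sigma> \<circ> push p f) (standard_simplex p))"
    by (rule continuous_map_eq) auto
qed auto

lemma face_along_face_along:
  assumes "\<And>j. j \<le> p \<Longrightarrow> g j \<le> m"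
  shows "face_along p g (face_along m f \<sigma>) = face_along p (f \<circ> g) \<sigma>"
  using push_in_standard_simplex[OF _ assms, of _ p] push_push[OF assms, of p]
  by (intro ext) (auto simp: face_along_def restrict_def)

lemma face_along_cong:
  assumes "\<And>j. j \<le> p \<Longrightarrow> f j = g j"
  shows "face_along p f \<sigma> = face_along p g \<sigma>"
proof -
  have "push p f = push p g"
    unfolding push_def by (intro ext sum.cong) (use assms in auto)
  then show ?thesis by (simp add: face_along_def)
qed

lemma singular_face_eq_face_along:
  "singular_face (Suc p) k \<sigma> = face_along p (skip k) \<sigma>"
  using push_skip[of _ p k] by (intro ext) (auto simp: singular_face_def face_along_def restrict_def)

lemma front_face_eq_face_along: "front_face p \<sigma> = face_along p (\<lambda>i. i) \<sigma>"
  using push_id[of _ p] by (intro ext) (auto simp: front_face_def face_along_def restrict_def)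

lemma back_face_eq_face_along: "back_face p r \<sigma> = face_along r (\<lambda>i. i + p) \<sigma>"
  using push_shift[of _ r p] by (intro ext) (auto simp: back_face_def face_along_def restrict_def)

text \<open>The vertices \<open>0, \<dots>, s, s + r, s + r + 1, \<dots>\<close> of a simplex: the interval from \<open>s\<close> to \<open>s + r\<close>
  keeps only its end points.\<close>

definition gap :: "nat \<Rightarrow> nat \<Rightarrow> nat \<Rightarrow> nat" where
  "gap r s l = (if l \<le> s then l else l - 1 + r)"

text \<open>Steenrod's cup-1 product: \<open>b\<close> is evaluated on an interval of \<open>r + 1\<close> vertices and \<open>a\<close> on the
  remaining vertices together with the two ends of the interval. It is the cochain homotopy
  between the cup product and the cup product in the opposite order.\<close>

definition cup1 :: "nat \<Rightarrow> nat \<Rightarrow> ('a sing_simplex \<Rightarrow> rat) \<Rightarrow>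
    ('a sing_simplex \<Rightarrow> rat) \<Rightarrow>
    'a sing_simplex \<Rightarrow> rat" where
  "cup1 p r a b \<tau> = (\<Sum>j<p. (-1) ^ (j * (r + 1)) *
      (a (face_along p (gap r j) \<tau>) * b (face_along r (\<lambda>i. i + j) \<tau>)))"

text \<open>In the coboundary of a cup-1 product \<open>L\<close> and \<open>R\<close> are the parts of the cocycle equation for
  \<open>a\<close> to the left and to the right of the interval, \<open>x s\<close> is \<open>a\<close> on the complement of an interval
  of \<open>r\<close> vertices at \<open>s\<close>, and \<open>b s\<close> is \<open>b\<close> on the interval that begins at \<open>s\<close>. Moving the interval
  by one step, the terms cancel, and only the two extreme positions remain.\<close>

lemma cup1_telescope:
  fixes L R x b :: "nat \<Rightarrow> rat"
  assumes LR: "\<And>s. s \<le> p \<Longrightarrow> L s + R s = (-1) ^ s * (x (Suc s) - x s)"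
    and "L 0 = 0" "R p = 0"
  shows "(\<Sum>j<p. (-1) ^ (j * (r + 1)) * (L (Suc j) * b (Suc j) + (-1) ^ (r + 1) * (R j * b j) +
      (-1) ^ j * (x (Suc j) * (- b (Suc j) + (-1) ^ r * b j)))) =
      (-1) ^ (r + 1 + p * r) * (x (Suc p) * b p) - (-1) ^ (r + 1) * (x 0 * b 0)"
proof -
  define U where "U s = (-1) ^ (r + 1 + s * (r + 1)) * ((L s + (-1) ^ s * x s) * b s)" for s
  have two: "(-1) ^ n * ((-1) ^ n * z) = z" for n and z :: rat
    by (simp add: mult.assoc[symmetric] flip: power_add)
  have "(\<Sum>j<p. (-1) ^ (j * (r + 1)) * (L (Suc j) * b (Suc j) + (-1) ^ (r + 1) * (R j * b j) +
      (-1) ^ j * (x (Suc j) * (- b (Suc j) + (-1) ^ r * b j)))) = (\<Sum>j<p. U (Suc j) - U j)"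
  proof (rule sum.cong[OF refl])
    fix j assume "j \<in> {..<p}"
    then have R: "R j = (-1) ^ j * (x (Suc j) - x j) - L j" using LR[of j] by simp
    have U: "U (Suc j) = (-1) ^ (j * (r + 1)) * ((L (Suc j) - (-1) ^ j * x (Suc j)) * b (Suc j))"
      using two[of r] by (simp add: U_def power_add algebra_simps)
    have U': "U j = (-1) ^ (j * (r + 1)) * ((-1) ^ (r + 1) * ((L j + (-1) ^ j * x j) * b j))"
      by (simp add: U_def power_add)
    show "(-1) ^ (j * (r + 1)) * (L (Suc j) * b (Suc j) + (-1) ^ (r + 1) * (R j * b j) +
      (-1) ^ j * (x (Suc j) * (- b (Suc j) + (-1) ^ r * b j))) = U (Suc j) - U j"
      unfolding U U' R right_diff_distrib[symmetric]
      by (rule arg_cong[where f = "(*) _"]) (simp add: algebra_simps)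
  qed
  also have "\<dots> = U p - U 0" by (rule sum_lessThan_telescope)
  also have "L p + (-1) ^ p * x p = (-1) ^ p * x (Suc p)"
    using LR[of p] assms(3) by (simp add: algebra_simps)
  then have "U p = (-1) ^ (r + 1 + p * (r + 1)) * ((-1) ^ p * x (Suc p) * b p)"
    by (simp add: U_def)
  also have "\<dots> = (-1) ^ (r + 1 + p * r) * (x (Suc p) * b p)"
    using two[of p] by (simp add: power_add algebra_simps)
  also have "U 0 = (-1) ^ (r + 1) * (x 0 * b 0)"
    using assms(2) by (simp add: U_def)
  finally show ?thesis .
qed

text \<open>A face of the simplex leaves out one vertex, which lies to the left of the interval, in its
  interior, or to the right of it. The cocycle equation of \<open>a\<close> evaluates the two outer groups of
  terms (\<open>LR\<close>), that of \<open>b\<close> the middle group (\<open>M\<close>). At the extreme positions of the interval, \<open>a\<close>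
  and \<open>b\<close> are evaluated on complementary front and back faces.\<close>

lemma coboundary_cup1:
  fixes a b :: "'a::topological_space sing_simplex \<Rightarrow> rat"
  assumes a: "\<And>\<tau>. singular_simplex (Suc p) euclidean \<tau> \<Longrightarrow> coboundary p a \<tau> = 0"
    and b: "\<And>\<tau>. singular_simplex (Suc r) euclidean \<tau> \<Longrightarrow> coboundary r b \<tau> = 0"
    and \<sigma>: "singular_simplex (Suc m) euclidean \<sigma>" and m: "Suc m = p + r"
  shows "coboundary m (cup1 p r a b) \<sigma> =
     (-1) ^ (r + 1 + p * r) * (a (front_face p \<sigma>) * b (back_face p r \<sigma>)) -
     (-1) ^ (r + 1) * (b (front_face r \<sigma>) * a (back_face r p \<sigma>))"
proof -
  define A where "A w = a (face_along p w \<sigma>)" for w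
  define B where "B w = b (face_along r w \<sigma>)" for w
  have Acong: "A w = A w'" if "\<And>l. l \<le> p \<Longrightarrow> w l = w' l" for w w'
    unfolding A_def by (metis face_along_cong that)
  have Bcong: "B w = B w'" if "\<And>l. l \<le> r \<Longrightarrow> w l = w' l" for w w'
    unfolding B_def by (metis face_along_cong that)
  have skip_le: "skip k j \<le> Suc l" if "j \<le> l" for k j l
    using that by (simp add: skip_def)
  have dA: "(\<Sum>k\<le>Suc p. (-1) ^ k * A (w \<circ> skip k)) = 0" if
      "\<And>j. j \<le> Suc p \<Longrightarrow> w j \<le> Suc m" for w
    using a[OF singular_simplex_face_along[OF \<sigma> that, of "Suc p"]]
    by (simp add: coboundary_def singular_face_eq_face_along A_def face_along_face_along skip_le
        del: sum.atMost_Suc)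
  have dB: "(\<Sum>k\<le>Suc r. (-1) ^ k * B (w \<circ> skip k)) = 0" if
      "\<And>j. j \<le> Suc r \<Longrightarrow> w j \<le> Suc m" for w
    using b[OF singular_simplex_face_along[OF \<sigma> that, of "Suc r"]]
    by (simp add: coboundary_def singular_face_eq_face_along B_def face_along_face_along skip_le
        del: sum.atMost_Suc)
  define x where "x s = A (\<lambda>l. if l < s then l else l + r)" for s
  define \<beta> where "\<beta> s = B (\<lambda>i. i + s)" for s
  define L where "L s = (\<Sum>k<s. (-1) ^ k * A (gap r s \<circ> skip k))" for s
  define R where "R s = (\<Sum>k\<in>{s + 2..Suc p}. (-1) ^ k * A (gap r s \<circ> skip k))" for s
  \<comment> \<open>the cocycle equation of \<open>a\<close> on the vertices \<open>gap r s\<close>; leaving out \<open>s\<close> or the next vertex gives \<open>x\<close>\<close>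
  have LR: "L s + R s = (-1) ^ s * (x (Suc s) - x s)" if s: "s \<le> p" for s
  proof -
    have split: "{..Suc p} = {..<s} \<union> {s, Suc s} \<union> {s + 2..Suc p}" using s by auto
    have "gap r s j \<le> Suc m" if "j \<le> Suc p" for j
      using that m s by (auto simp: gap_def)
    then have "0 = (\<Sum>k\<le>Suc p. (-1) ^ k * A (gap r s \<circ> skip k))"
      using dA[of "gap r s"] by simp
    also have "\<dots> = L s + (\<Sum>k\<in>{s, Suc s}. (-1) ^ k * A (gap r s \<circ> skip k)) + R s"
      unfolding L_def R_def split
      by (subst sum.union_disjoint; (subst sum.union_disjoint)?; auto)
    finally have "0 = L s + (\<Sum>k\<in>{s, Suc s}. (-1) ^ k * A (gap r s \<circ> skip k)) + R s" .
    moreover have "A (gap r s \<circ> skip s) = x s" "A (gap r s \<circ> skip (Suc s)) = x (Suc s)"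
      unfolding x_def by (rule Acong; auto simp: gap_def skip_def)+
    ultimately show ?thesis by (simp add: algebra_simps)
  qed
  \<comment> \<open>the cocycle equation of \<open>b\<close> on the interval from \<open>s\<close> to \<open>s + r + 1\<close>\<close>
  have M: "(\<Sum>k\<in>{1..r}. (-1) ^ k * B ((\<lambda>i. i + s) \<circ> skip k)) = - \<beta> (Suc s) +
      (-1) ^ r * \<beta> s"
    if s: "s < p" for s
  proof -
    have "{..Suc r} = insert 0 (insert (Suc r) {1..r})" by auto
    then have "0 = B ((\<lambda>i. i + s) \<circ> skip 0) + ((-1) ^ Suc r * B ((\<lambda>i. i +
        s) \<circ> skip (Suc r)) +
        (\<Sum>k\<in>{1..r}. (-1) ^ k * B ((\<lambda>i. i + s) \<circ> skip k)))"
      using dB[of "\<lambda>i. i + s"] m s by simp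
    moreover have "B ((\<lambda>i. i + s) \<circ> skip 0) = \<beta> (Suc s)"
        "B ((\<lambda>i. i + s) \<circ> skip (Suc r)) = \<beta> s"
      unfolding \<beta>_def by (rule Bcong; auto simp: skip_def)+
    ultimately show ?thesis by (simp add: algebra_simps)
  qed
  \<comment> \<open>the omitted vertex \<open>i\<close> lies to the left of, inside, or to the right of the interval that starts at \<open>j\<close>\<close>
  have inner: "(\<Sum>i\<le>Suc m. (-1) ^ i * (A (skip i \<circ> gap r j) * B (skip i \<circ> (\<lambda>i. i + j)))) =
      L (Suc j) * \<beta> (Suc j) + (-1) ^ (r + 1) * (R j * \<beta> j) +
      (-1) ^ j * (x (Suc j) * (- \<beta> (Suc j) + (-1) ^ r * \<beta> j))" if j: "j < p" for j
  proof -
    let ?t = "\<lambda>i. (-1) ^ i * (A (skip i \<circ> gap r j) * B (skip i \<circ> (\<lambda>i. i + j)))"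
    have "{..Suc m} = {..<Suc j} \<union> {j + 1..j + r} \<union> {j + r + 1..Suc m}" using j m by auto
    then have "sum ?t {..Suc m} = sum ?t {..<Suc j} + sum ?t {j + 1..j + r} + sum ?t {j + r + 1..Suc m}"
      by (simp only:) (subst sum.union_disjoint; (subst sum.union_disjoint)?; auto)
    also have "sum ?t {..<Suc j} = L (Suc j) * \<beta> (Suc j)"
      unfolding L_def sum_distrib_right
    proof (intro sum.cong refl)
      fix i assume "i \<in> {..<Suc j}"
      then have "A (skip i \<circ> gap r j) = A (gap r (Suc j) \<circ> skip i)"
        "B (skip i \<circ> (\<lambda>i. i + j)) = \<beta> (Suc j)"
        unfolding \<beta>_def by (intro Acong Bcong; auto simp: skip_def gap_def)+
      then show "?t i = (-1) ^ i * A (gap r (Suc j) \<circ> skip i) * \<beta> (Suc j)" by simp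
    qed
    also have "sum ?t {j + r + 1..Suc m} = (\<Sum>k\<in>{j +
        2..Suc p}. (-1) ^ (r + 1) * ((-1) ^ k * A (gap r j \<circ> skip k) * \<beta> j))"
    proof (rule sum.reindex_bij_witness[of _ "\<lambda>k. k + r - 1" "\<lambda>i. i + 1 - r"])
      fix i assume i: "i \<in> {j + r + 1..Suc m}"
      then have "A (skip i \<circ> gap r j) = A (gap r j \<circ> skip (i + 1 - r))"
        "B (skip i \<circ> (\<lambda>i. i + j)) = \<beta> j"
        unfolding \<beta>_def by (intro Acong Bcong; auto simp: skip_def gap_def)+
      moreover have "(-1) ^ (r + 1) * (-1) ^ (i + 1 - r) = ((-1) ^ i :: rat)"
      proof -
        have "r + 1 + (i + 1 - r) = i + 2" using i by auto
        then show ?thesis by (metis power_add power2_minus power_one mult.right_neutral)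
      qed
      ultimately show "(-1) ^ (r + 1) * ((-1) ^ (i + 1 - r) * A (gap r j \<circ> skip (i + 1 - r)) * \<beta> j)
          = ?t i"
        by (metis mult.assoc)
    qed (use m in auto)
    also have "\<dots> = (-1) ^ (r + 1) * (R j * \<beta> j)"
      unfolding R_def by (simp only: sum_distrib_left sum_distrib_right)
    also have "sum ?t {j + 1..j + r} = (\<Sum>k\<in>{1..r}. (-1) ^ j *
        (x (Suc j) * ((-1) ^ k * B ((\<lambda>i. i + j) \<circ> skip k))))"
    proof (rule sum.reindex_bij_witness[of _ "\<lambda>k. k + j" "\<lambda>i. i - j"])
      fix i assume i: "i \<in> {j + 1..j + r}"
      then have "A (skip i \<circ> gap r j) = x (Suc j)"
        "B (skip i \<circ> (\<lambda>i. i + j)) = B ((\<lambda>i. i + j) \<circ> skip (i - j))"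
        unfolding x_def by (intro Acong Bcong; auto simp: skip_def gap_def)+
      moreover have "(-1) ^ j * (-1) ^ (i - j) = ((-1) ^ i :: rat)"
        using i by (simp flip: power_add)
      ultimately show "(-1) ^ j * (x (Suc j) * ((-1) ^ (i - j) * B ((\<lambda>i. i + j) \<circ> skip (i - j))))
          = ?t i"
        by (metis mult.assoc mult.left_commute)
    qed auto
    also have "\<dots> = (-1) ^ j * (x (Suc j) * (- \<beta> (Suc j) + (-1) ^ r * \<beta> j))"
      by (simp only: sum_distrib_left[symmetric] M[OF j])
    finally show ?thesis by (simp only: add.assoc add.commute add.left_commute)
  qed
  have gap_le: "gap r j l \<le> m" if "j < p" "l \<le> p" for j l
    using that m by (auto simp: gap_def)
  have "coboundary m (cup1 p r a b) \<sigma> = (\<Sum>i\<le>Suc m. \<Sum>j<p. (-1) ^ (j * (r + 1)) *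
      ((-1) ^ i * (A (skip i \<circ> gap r j) * B (skip i \<circ> (\<lambda>i. i + j)))))"
    unfolding coboundary_def cup1_def sum_distrib_left singular_face_eq_face_along
    by (intro sum.cong refl) (use m in \<open>auto simp: face_along_face_along gap_le A_def B_def\<close>)
  also have "\<dots> = (\<Sum>j<p. (-1) ^ (j * (r + 1)) *
      (\<Sum>i\<le>Suc m. (-1) ^ i * (A (skip i \<circ> gap r j) * B (skip i \<circ> (\<lambda>i. i + j)))))"
    by (subst sum.swap) (simp only: sum_distrib_left)
  also have "\<dots> = (\<Sum>j<p. (-1) ^ (j * (r + 1)) * (L (Suc j) * \<beta> (Suc j) +
      (-1) ^ (r + 1) * (R j * \<beta> j) +
      (-1) ^ j * (x (Suc j) * (- \<beta> (Suc j) + (-1) ^ r * \<beta> j))))"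
    by (intro sum.cong refl) (simp only: inner lessThan_iff)
  also have "\<dots> = (-1) ^ (r + 1 + p * r) * (x (Suc p) * \<beta> p) - (-1) ^ (r + 1) * (x 0 * \<beta> 0)"
    by (rule cup1_telescope) (use LR in \<open>auto simp: L_def R_def\<close>)
  also have "x (Suc p) = a (front_face p \<sigma>)"
    unfolding front_face_eq_face_along A_def[symmetric] x_def by (rule Acong) auto
  also have "\<beta> p = b (back_face p r \<sigma>)"
    by (simp add: back_face_eq_face_along \<beta>_def B_def)
  also have "x 0 = a (back_face r p \<sigma>)"
    by (simp add: back_face_eq_face_along x_def A_def)
  also have "\<beta> 0 = b (front_face r \<sigma>)"
    by (simp add: front_face_eq_face_along \<beta>_def B_def)
  finally show ?thesis by (simp add: mult.commute)
qed

abbreviation cocycle_degree :: "nat \<Rightarrow> ('a::topological_space sing_simplex \<Rightarrow> rat)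
    \<Rightarrow> bool" where
  "cocycle_degree p f \<equiv> delta (single_cochain p f) = (0 :: 'a cochain)"

lemma cochain_at_single:
  "cochain_at (single_cochain p f) n \<sigma> = (if n = p \<and> singular_simplex p euclidean \<sigma> then
      f \<sigma> else 0)"
  by (simp add: single_cochain.rep_eq)

lemma cochain_at_single_times_single:
  assumes "singular_simplex n euclidean \<sigma>"
  shows "cochain_at (single_cochain p f * single_cochain r g) n \<sigma> =
    (if n = p + r then f (front_face p \<sigma>) * g (back_face p r \<sigma>) else 0)"
proof -
  have "cochain_at (single_cochain p f * single_cochain r g) n \<sigma> =
      (\<Sum>k\<le>n. if k = p then if n = p + r then f (front_face p \<sigma>) * g (back_face p r \<sigma>)
          else 0 else 0)"
    unfolding cochain_at_times[OF assms]
    by (intro sum.cong)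
       (use assms in \<open>auto simp: cochain_at_single intro!: singular_simplex_front_face
          singular_simplex_back_face\<close>)
  then show ?thesis by (auto simp: sum.delta)
qed

lemma coboundary_cocycle:
  assumes "cocycle_degree p f" "singular_simplex (Suc p) euclidean \<tau>"
  shows "coboundary p f \<tau> = 0"
proof -
  have "coboundary p (cochain_at (single_cochain p f)  p) \<tau> = 0"
    using cochain_at_delta_Suc[OF assms(2), of "single_cochain p f"] assms(1)
    by (simp add: zero_cochain.rep_eq)
  moreover have "singular_simplex p euclidean (singular_face (Suc p) k \<tau>)" if "k \<le> Suc p" for k
    using singular_simplex_singular_face[of "Suc p" euclidean \<tau> k] assms(2) that by simp
  ultimately show ?thesis by (simp add: coboundary_def cochain_at_single)
qed

lemma cochain_scale_at: "cochain_at (cochain_scale r c) p \<sigma> = r * cochain_at c p \<sigma>"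
  by (simp add: cochain_scale.rep_eq)

text \<open>For \<open>p = r = 0\<close> the cup-1 product is zero, and the truncated degree \<open>p + r - 1\<close> does no
  harm.\<close>

lemma cup_supercommutes_up_to_coboundary:
  fixes f g :: "'a::topological_space sing_simplex \<Rightarrow> rat"
  assumes f: "cocycle_degree p f" and g: "cocycle_degree r g"
  shows "single_cochain p f * single_cochain r g -
    cochain_scale ((-1) ^ (p * r)) (single_cochain r g * single_cochain p f) \<in> range
        (delta :: 'a cochain \<Rightarrow> _)"
proof -
  define c :: "'a cochain" where
    "c = single_cochain (p + r - 1) (\<lambda>\<tau>. (-1) ^ (r + 1 + p * r) * cup1 p r f g \<tau>)"
  have sgn: "(-1) ^ (r + 1 + p * r) * ((-1) ^ (r + 1 + p * r) * x - (-1) ^ (r + 1) * y) =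
      x - (-1) ^ (p * r) * y" for x y :: rat
    by (cases "even (p * r)"; cases "even r") (simp_all add: power_add)
  have "single_cochain p f * single_cochain r g -
    cochain_scale ((-1) ^ (p * r)) (single_cochain r g * single_cochain p f) = delta c" (is "?l = _")
  proof (rule cochain_eqI)
    fix n and \<sigma> :: "'a sing_simplex" assume \<sigma>: "singular_simplex n euclidean \<sigma>"
    have l: "cochain_at ?l n \<sigma> = (if n = p + r then f (front_face p \<sigma>) * g (back_face p r \<sigma>) -
        (-1) ^ (p * r) * (g (front_face r \<sigma>) * f (back_face r p \<sigma>)) else 0)"
      by (simp add: minus_cochain_at cochain_scale_at cochain_at_single_times_single[OF \<sigma>])
    show "cochain_at ?l n \<sigma> = cochain_at (delta c) n \<sigma>"
    proof (cases n)
      case 0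
      then show ?thesis
        using \<sigma> unfolding l by (auto simp: cochain_at_delta_0 front_face_id back_face_id)
    next
      case (Suc m)
      have \<sigma>': "singular_simplex (Suc m) euclidean \<sigma>" using \<sigma> Suc by simp
      have face: "singular_simplex m euclidean (singular_face (Suc m) k \<sigma>)" if "k \<le> Suc m" for k
        using singular_simplex_singular_face[of "Suc m" euclidean \<sigma> k] \<sigma>' that by simp
      show ?thesis
      proof (cases "n = p + r")
        case True
        have "cochain_at (delta c) n \<sigma> = coboundary m (\<lambda>\<tau>. (-1) ^ (r + 1 +
          p * r) * cup1 p r f g \<tau>) \<sigma>"
        proof -
          have m: "p + r - 1 = m" using True Suc by simp
          show ?thesis
            unfolding Suc cochain_at_delta_Suc[OF \<sigma>'] coboundary_def c_def m
            by (intro sum.cong refl) (use face in \<open>auto simp: cochain_at_single\<close>)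
        qed
        also have "\<dots> = (-1) ^ (r + 1 + p * r) * coboundary m (cup1 p r f g) \<sigma>"
          by (simp add: coboundary_def sum_distrib_left mult.left_commute del: sum.atMost_Suc power_Suc)
        also have "\<dots> = f (front_face p \<sigma>) * g (back_face p r \<sigma>) -
            (-1) ^ (p * r) * (g (front_face r \<sigma>) * f (back_face r p \<sigma>))"
          using True Suc
          by (subst coboundary_cup1[OF coboundary_cocycle[OF f] coboundary_cocycle[OF g] \<sigma>'])
             (simp_all only: sgn)
        finally show ?thesis using True unfolding l by simp
      next
        case False
        then have "cochain_at c m (singular_face (Suc m) k \<sigma>) = 0 \<or> p = 0 \<and> r = 0" for k
          using Suc by (auto simp: c_def cochain_at_single)
        moreover have "c = 0" if "p = 0" "r = 0"
          by (rule cochain_eqI) (simp add: c_def that cochain_at_single cup1_def zero_cochain.rep_eq)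
        ultimately have "cochain_at c m (singular_face (Suc m) k \<sigma>) = 0" for k
          by (metis zero_cochain.rep_eq)
        then have "cochain_at (delta c) n \<sigma> = 0"
          unfolding Suc cochain_at_delta_Suc[OF \<sigma>'] coboundary_def by simp
        then show ?thesis using False unfolding l by simp
      qed
    qed
  qed
  then show ?thesis by simp
qed

lemma zero_in_range_delta: "0 \<in> range delta"
  by (auto intro: image_eqI[of _ _ 0])

lemma abs_cohomology_eqI:
  "delta a = 0 \<Longrightarrow> delta b = 0 \<Longrightarrow> a - b \<in> range delta \<Longrightarrow>
      abs_cohomology a = abs_cohomology b"
  by (rule Quotient3_rel_abs[OF Quotient3_cohomology]) simp

lemma abs_cohomology_add:
  "delta a = 0 \<Longrightarrow> delta b = 0 \<Longrightarrow> abs_cohomology (a + b) = abs_cohomology a +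
      abs_cohomology b"
  by (rule plus_cohomology.abs_eq[symmetric]) (simp_all add: zero_in_range_delta)

lemma abs_cohomology_times:
  "delta a = 0 \<Longrightarrow> delta b = 0 \<Longrightarrow> abs_cohomology (a * b) =
      abs_cohomology a * abs_cohomology b"
  by (rule times_cohomology.abs_eq[symmetric]) (simp_all add: zero_in_range_delta)

lemma abs_cohomology_scale:
  "delta a = 0 \<Longrightarrow> abs_cohomology (cochain_scale r a) = r *\<^sub>Q abs_cohomology a"
  by (rule scaleQ_cohomology.abs_eq[symmetric]) (simp_all add: zero_in_range_delta)

lemma cohomology_group_supercomm:
  assumes "\<alpha> \<in> cohomology_group p" "\<beta> \<in> cohomology_group r"
  shows "\<alpha> * \<beta> = (if odd p \<and> odd r then - (\<beta> * \<alpha>) else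
      \<beta> * (\<alpha> :: 'a::topological_space cohomology))"
proof -
  obtain f g where f: "\<alpha> = abs_cohomology (single_cochain p f)" "cocycle_degree p f"
    and g: "\<beta> = abs_cohomology (single_cochain r g)" "cocycle_degree r g"
    using assms by (auto simp: cohomology_group_def cohomology_class_def)
  let ?f = "single_cochain p f :: 'a cochain" and ?g = "single_cochain r g :: 'a cochain"
  have fg: "delta (?f * ?g) = 0" and gf: "delta (?g * ?f) = 0"
    using f(2) g(2) by (simp_all add: delta_times)
  have "\<alpha> * \<beta> = abs_cohomology (?f * ?g)"
    using f g by (simp add: abs_cohomology_times)
  also have "\<dots> = abs_cohomology (cochain_scale ((-1) ^ (p * r)) (?g * ?f))"
  proof (rule abs_cohomology_eqI)
    show "delta (cochain_scale ((-1) ^ (p * r)) (?g * ?f)) = 0"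
      unfolding delta_scale gf by (rule cochain_eqI) (simp add: cochain_scale_at zero_cochain.rep_eq)
  qed (use fg cup_supercommutes_up_to_coboundary[OF f(2) g(2)] in auto)
  also have "\<dots> = (-1) ^ (p * r) *\<^sub>Q (\<beta> * \<alpha>)"
    using f g gf by (simp add: abs_cohomology_times abs_cohomology_scale)
  finally have "\<alpha> * \<beta> = (-1) ^ (p * r) *\<^sub>Q (\<beta> * \<alpha>)" .
  then show ?thesis
    by (cases "even (p * r)") (auto simp: scaleQ_one scaleQ_neg1)
qed

section \<open>The parity involution on cohomology\<close>

lemma sign_inv_times: "sign_inv (a * b) = sign_inv a * sign_inv b"
proof (rule cochain_eqI)
  fix n and \<sigma> :: "'a sing_simplex" assume *: "singular_simplex n euclidean \<sigma>"
  have "(-1) ^ n * (x * y) = (-1) ^ p * x * ((-1) ^ (n - p) * y)" if "p \<le> n" for p and x y :: rat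
    using that by (simp add: mult.left_commute mult.assoc[symmetric] flip: power_add)
  then show "cochain_at (sign_inv (a * b)) n \<sigma> = cochain_at (sign_inv a * sign_inv b) n \<sigma>"
    unfolding sign_inv.rep_eq cochain_at_times[OF *] sum_distrib_left
    by (intro sum.cong) auto
qed

lemma sign_inv_add: "sign_inv (a + b) = sign_inv a + sign_inv b"
  by (rule cochain_eqI) (simp add: sign_inv.rep_eq plus_cochain.rep_eq algebra_simps)

lemma sign_inv_scale: "sign_inv (cochain_scale r a) = cochain_scale r (sign_inv a)"
  by (rule cochain_eqI) (simp add: sign_inv.rep_eq cochain_scale.rep_eq algebra_simps)

lemma sign_inv_diff: "sign_inv (a - b) = sign_inv a - sign_inv b"
  by (rule cochain_eqI) (simp add: sign_inv.rep_eq minus_cochain_at algebra_simps)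

lemma sign_inv_single: "sign_inv (single_cochain p f) = cochain_scale ((-1) ^ p) (single_cochain p f)"
  by (rule cochain_eqI) (simp add: sign_inv.rep_eq cochain_scale.rep_eq cochain_at_single)

lemma sign_inv_one: "sign_inv 1 = 1"
  by (rule cochain_eqI) (simp add: sign_inv.rep_eq one_cochain.rep_eq)

text \<open>The involution with eigenvalue \<open>1\<close> on the even and \<open>-1\<close> on the odd classes. It exists on all
  of cohomology before any decomposition is known, and it shows that the even and odd parts meet
  only in zero.\<close>

lift_definition parity_inv :: "'a::topological_space cohomology \<Rightarrow> 'a cohomology" is sign_inv
proof -
  fix a a' :: "'a cochain"
  assume *: "delta a = 0 \<and> delta a' = 0 \<and> a - a' \<in> range delta"
  then obtain c where "a - a' = delta c" by auto
  then have "sign_inv a - sign_inv a' = delta (- sign_inv c)"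
    by (simp add: delta_minus delta_sign_inv flip: sign_inv_diff)
  then show "delta (sign_inv a) = 0 \<and> delta (sign_inv a') = 0 \<and> sign_inv a - sign_inv a' \<in> range delta"
    using * by (simp add: delta_sign_inv)
qed

lemma parity_inv_simps:
  fixes x y :: "'a::topological_space cohomology"
  shows "parity_inv (x + y) = parity_inv x + parity_inv y"
  "parity_inv (r *\<^sub>Q x) = r *\<^sub>Q parity_inv x"
  "parity_inv (parity_inv x) = x"
  "parity_inv (x * y) = parity_inv x * parity_inv y"
  "parity_inv (1 :: 'a cohomology) = 1"
  by (transfer, simp add: zero_in_range_delta delta_add delta_scale delta_times delta_sign_inv
      sign_inv_times sign_inv_add sign_inv_scale sign_inv_sign_inv sign_inv_one delta_one)+

lemma parity_inv_cohomology_group: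
  assumes "x \<in> cohomology_group p"
  shows "parity_inv x = (if odd p then - x else (x :: 'a::topological_space cohomology))"
proof -
  obtain f where f: "x = abs_cohomology (single_cochain p f)" "cocycle_degree p f"
    using assms by (auto simp: cohomology_group_def cohomology_class_def)
  have "parity_inv x = abs_cohomology (sign_inv (single_cochain p f))"
    unfolding f(1) by (rule parity_inv.abs_eq) (simp add: f(2) zero_in_range_delta)
  also have "\<dots> = (-1) ^ p *\<^sub>Q x"
    by (simp add: sign_inv_single abs_cohomology_scale f)
  finally have "parity_inv x = (-1) ^ p *\<^sub>Q x" .
  then show ?thesis by (auto simp: scaleQ_one scaleQ_neg1)
qed

text \<open>A cochain is a finite sum of homogeneous ones, and \<open>\<delta>\<close> maps different degrees to different
  degrees, so the components of a cocycle are cocycles.\<close>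

lemma cohomology_decomposition:
  fixes x :: "'a::topological_space cohomology"
  obtains N f where "x = (\<Sum>d\<le>N. f d)" "\<And>d. f d \<in> cohomology_group d"
proof -
  obtain c :: "'a cochain" where c: "x = abs_cohomology c" "delta c = 0"
    using Quotient3_abs_rep[OF Quotient3_cohomology, of x] Quotient3_rep_reflp[OF Quotient3_cohomology, of x]
    by metis
  define s where "s d = (single_cochain d (cochain_at c d) :: 'a cochain)" for d
  have at_s: "cochain_at (s d) n \<sigma> = (if n = d then cochain_at c d \<sigma> else 0)" for d n \<sigma>
    by (auto simp: s_def cochain_at_single cochain_at_outside)
  have s: "delta (s d) = 0" for d
  proof (rule cochain_eqI)
    fix n and \<sigma> :: "'a sing_simplex" assume *: "singular_simplex n euclidean \<sigma>"
    have "cochain_at (delta (s d)) n \<sigma> = (if n = Suc d then cochain_at (delta c) n \<sigma> else 0)"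
      by (cases n) (use * in \<open>auto simp: cochain_at_delta_0 cochain_at_delta_Suc coboundary_def at_s\<close>)
    then show "cochain_at (delta (s d)) n \<sigma> = cochain_at 0 n \<sigma>"
      using c by (simp add: zero_cochain.rep_eq)
  qed
  have "finite {p. \<exists>\<sigma>. cochain_at c p \<sigma> \<noteq> 0}"
    using cochain_at[of c] by simp
  then obtain N where N: "\<And>p \<sigma>. cochain_at c p \<sigma> \<noteq> 0 \<Longrightarrow> p \<le> N"
    by (metis (mono_tags, lifting) finite_nat_set_iff_bounded_le mem_Collect_eq)
  have sum_at: "cochain_at (\<Sum>d\<in>D. h d) n \<sigma> = (\<Sum>d\<in>D. cochain_at (h d) n \<sigma>)"
    if "finite D" for D and h :: "nat \<Rightarrow> 'a cochain" and n \<sigma>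
    using that by (induction D) (auto simp: zero_cochain.rep_eq plus_cochain.rep_eq)
  have "c = (\<Sum>d\<le>N. s d)"
    by (rule cochain_eqI) (use N in \<open>auto simp: sum_at at_s sum.delta\<close>)
  moreover have "abs_cohomology (\<Sum>d\<le>N. s d) = (\<Sum>d\<le>N. abs_cohomology (s d)) \<and> delta
      (\<Sum>d\<le>N. s d) = 0" for N
    by (induction N) (simp_all add: s delta_add abs_cohomology_add)
  ultimately have "x = (\<Sum>d\<le>N. abs_cohomology (s d))" using c by simp
  moreover have "abs_cohomology (s d) \<in> cohomology_group d" for d
    using s by (auto simp: cohomology_group_def cohomology_class_def s_def)
  ultimately show ?thesis using that by blast
qed

section \<open>Coefficients and the bracket of \<open>w\<^sup>+\<close>\<close>

text \<open>The grading is encoded by its parity involution, from which linear projections to the even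
  and the odd part are obtained.\<close>

locale super_coefficients =
  fixes H :: "bool \<Rightarrow> 'h::rat_algebra set" and par :: "'h \<Rightarrow> 'h" and q :: 'h
  assumes par_add: "par (x + y) = par x + par y"
    and par_scaleQ: "par (r *\<^sub>Q x) = r *\<^sub>Q par x"
    and par_par: "par (par x) = x"
    and H_iff: "x \<in> H e \<longleftrightarrow> par x = (if e then - x else x)"
    and one_H: "1 \<in> H False"
    and mult_H: "x \<in> H e \<Longrightarrow> y \<in> H f \<Longrightarrow> x * y \<in> H (e \<noteq> f)"
    and supercomm: "x \<in> H e \<Longrightarrow> y \<in> H f \<Longrightarrow> x * y =
        (if e \<and> f then - (y * x) else y * x)"
    and q_H: "q \<in> H False"
begin

lemma qlinear_par: "qlinear par"
  by (rule qlinearI) (simp_all add: par_add par_scaleQ)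

lemma H_zero: "0 \<in> H e"
  by (simp add: H_iff qlinear_0[OF qlinear_par])

lemma H_add: "x \<in> H e \<Longrightarrow> y \<in> H e \<Longrightarrow> x + y \<in> H e"
  by (simp add: H_iff par_add)

lemma H_scaleQ: "x \<in> H e \<Longrightarrow> r *\<^sub>Q x \<in> H e"
  by (simp add: H_iff par_scaleQ scaleQ_minus_right)

definition hpart :: "bool \<Rightarrow> 'h \<Rightarrow> 'h" where
  "hpart e x = (1/2) *\<^sub>Q (if e then x - par x else x + par x)"

lemma hpart_H: "hpart e x \<in> H e"
  by (simp add: H_iff hpart_def par_scaleQ par_add par_par qlinear_diff[OF qlinear_par]
      add.commute flip: scaleQ_minus_right)

lemma hpart_sum: "hpart False x + hpart True x = x"
proof -
  have "hpart False x + hpart True x = (1/2) *\<^sub>Q (x + x)"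
    by (simp add: hpart_def flip: scaleQ_add_right)
  then show ?thesis by (simp add: scaleQ_add_right scaleQ_half)
qed

lemma hpart_eq: "x \<in> H f \<Longrightarrow> hpart e x = (if e = f then x else 0)"
  by (auto simp: hpart_def H_iff scaleQ_add_right scaleQ_half)

lemma qlinear_hpart: "qlinear (hpart e)"
  by (rule qlinearI) (auto simp: hpart_def par_add par_scaleQ scaleQ_add_right scaleQ_diff_right
      scaleQ_scaleQ algebra_simps)

lemma q_comm: "q * x = x * q"
proof -
  have "q * hpart e x = hpart e x * q" for e
    using supercomm[OF q_H hpart_H, of e] by simp
  then show ?thesis
    by (metis hpart_sum distrib_left distrib_right)
qed

lemma q_power_comm: "q ^ i * x = x * q ^ i"
  by (induction i) (simp_all add: mult.assoc q_comm, simp add: q_comm flip: mult.assoc)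

lemma q_power_H: "q ^ i \<in> H False"
  by (induction i) (use one_H mult_H[OF q_H] in auto)

text \<open>The element \<open>z\<^sup>k P(D, q) \<xi>\<close> of \<open>w\<^sup>+\<close>, where powers of \<open>q\<close> are absorbed into the coefficient.
  With all brackets in this form, identities in \<open>w\<^sup>+\<close> follow from identities between polynomials.\<close>

definition zP :: "nat \<Rightarrow> rat poly poly \<Rightarrow> 'h \<Rightarrow> 'h w_plus" where
  "zP k P \<xi> = (\<Sum>i\<le>Polynomial.degree P. \<Sum>b\<le>Polynomial.degree (poly.coeff P i).
         zD k b (poly.coeff (poly.coeff P i) b *\<^sub>Q (q ^ i * \<xi>)))"

lemma basis_bracket_zP:
  "basis_bracket q m n \<xi> m' n' \<mu> = zP (m + m') (poly_bracket m m' (Dv ^ n) (Dv ^ n')) (\<xi> * \<mu>)"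
  by (simp add: basis_bracket_def zP_def bracket_poly_eq Let_def)

lemma lookup_zP:
  assumes "Polynomial.degree P \<le> N"
  shows "Poly_Mapping.lookup (zP k P \<xi>) (k', b) =
     (if k' = k - 1 then \<Sum>i\<le>N. poly.coeff (poly.coeff P i) b *\<^sub>Q (q ^ i * \<xi>) else 0)"
proof -
  have "Poly_Mapping.lookup (zP k P \<xi>) (k', b) =
     (\<Sum>i\<le>Polynomial.degree P. if k' = k - 1 then poly.coeff (poly.coeff P i) b *\<^sub>Q
         (q ^ i * \<xi>) else 0)"
    unfolding zP_def lookup_sum
  proof (rule sum.cong[OF refl])
    fix i
    have "(\<Sum>b'\<le>Polynomial.degree (poly.coeff P i). Poly_Mapping.lookup
        (zD k b' (poly.coeff (poly.coeff P i) b' *\<^sub>Q (q ^ i * \<xi>))) (k', b)) =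
      (\<Sum>b'\<le>Polynomial.degree (poly.coeff P i). if b' = b then
         if k' = k - 1 then poly.coeff (poly.coeff P i) b' *\<^sub>Q (q ^ i * \<xi>) else 0 else 0)"
      by (intro sum.cong) (auto simp: zD_def lookup_single when_def)
    also have "\<dots> = (if k' = k - 1 then poly.coeff (poly.coeff P i) b *\<^sub>Q (q ^ i * \<xi>) else 0)"
      by (auto simp: sum.delta coeff_eq_0)
    finally show "(\<Sum>b'\<le>Polynomial.degree (poly.coeff P i). Poly_Mapping.lookup
        (zD k b' (poly.coeff (poly.coeff P i) b' *\<^sub>Q (q ^ i * \<xi>))) (k', b)) = \<dots>" .
  qed
  also have "\<dots> = (if k' = k - 1 then \<Sum>i\<le>Polynomial.degree P.
       poly.coeff (poly.coeff P i) b *\<^sub>Q (q ^ i * \<xi>) else 0)"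
    by simp
  also have "(\<Sum>i\<le>Polynomial.degree P. poly.coeff (poly.coeff P i) b *\<^sub>Q (q ^ i * \<xi>)) =
       (\<Sum>i\<le>N. poly.coeff (poly.coeff P i) b *\<^sub>Q (q ^ i * \<xi>))"
    by (rule sum.mono_neutral_left) (use assms in \<open>auto simp: coeff_eq_0\<close>)
  finally show ?thesis .
qed

lemma zP_add_left: "zP k (P + Q) \<xi> = zP k P \<xi> + zP k Q \<xi>"
proof (rule poly_mapping_eqI)
  fix x :: "nat \<times> nat"
  obtain k' b where x: "x = (k', b)" by force
  let ?N = "max (Polynomial.degree P) (Polynomial.degree Q)"
  show "Poly_Mapping.lookup (zP k (P + Q) \<xi>) x = Poly_Mapping.lookup (zP k P \<xi> + zP k Q \<xi>) x"
    using degree_add_le_max[of P Q]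
    by (simp add: x lookup_add lookup_zP[of _ ?N] scaleQ_add_left sum.distrib)
qed

lemma zP_smult: "zP k (Polynomial.smult [:r:] P) \<xi> = r *\<^sub>Q zP k P \<xi>"
proof (rule poly_mapping_eqI)
  fix x :: "nat \<times> nat"
  obtain k' b where x: "x = (k', b)" by force
  show "Poly_Mapping.lookup (zP k (Polynomial.smult [:r:] P) \<xi>) x =
      Poly_Mapping.lookup (r *\<^sub>Q zP k P \<xi>) x"
    using degree_smult_le[of "[:r:]" P]
    by (simp add: x lookup_scaleQ lookup_zP[of _ "Polynomial.degree P"] scaleQ_scaleQ scaleQ_sum_right)
qed

lemma qlinear_zP: "qlinear (zP k P)"
proof (rule qlinearI)
  fix \<xi> \<mu> :: 'h and r :: rat
  show "zP k P (\<xi> + \<mu>) = zP k P \<xi> + zP k P \<mu>"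
    by (simp add: zP_def zD_def scaleQ_add_right distrib_left single_add sum.distrib)
  show "zP k P (r *\<^sub>Q \<xi>) = r *\<^sub>Q zP k P \<xi>"
    by (simp add: zP_def zD_def scaleQ_sum_right scaleQ_single mult_scaleQ_right scaleQ_scaleQ mult.commute)
qed

text \<open>Formal multiplication by the variable \<open>q\<close> is multiplication of the coefficient by the class
  \<open>q\<close>; together with linearity and \<open>zP_Dv\<close> this determines \<open>zP\<close>.\<close>

lemma zP_qv: "zP k (qv * P) \<xi> = zP k P (q * \<xi>)"
proof (rule poly_mapping_eqI)
  fix x :: "nat \<times> nat"
  obtain k' b where x: "x = (k', b)" by force
  let ?N = "Polynomial.degree P"
  have "Polynomial.degree (qv * P) \<le> Suc ?N"
    by (simp add: qv_def)
  then show "Poly_Mapping.lookup (zP k (qv * P) \<xi>) x = Poly_Mapping.lookup (zP k P (q * \<xi>)) x"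
    by (simp add: x lookup_zP[of "qv * P" "Suc ?N"] lookup_zP[of _ ?N] del: sum.atMost_Suc)
       (simp add: sum.atMost_Suc_shift qv_def mult.assoc power_Suc2 del: sum.atMost_Suc power_Suc)
qed

lemma zP_Dv: "zP k (Dv ^ n) \<xi> = zD k n \<xi>"
proof -
  have "Dv ^ n = [:Polynomial.monom 1 n:]"
    by (induction n) (simp_all add: Dv_def one_pCons monom_altdef)
  have "Poly_Mapping.lookup (zP k (Dv ^ n) \<xi>) (a, b) = Poly_Mapping.lookup (zD k n \<xi>) (a, b)" for a b
    unfolding \<open>Dv ^ n = _\<close>
    by (simp add: lookup_zP[of _ 0] zD_def lookup_single when_def scaleQ_one)
  then show ?thesis by (intro poly_mapping_eqI) auto
qed

lemma zD_zero [simp]: "zD m n 0 = 0"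
  by (simp add: zD_def)

lemma zD_add: "zD m n (\<xi> + \<mu>) = zD m n \<xi> + zD m n \<mu>"
  by (simp add: zD_def single_add)

lemma zD_scaleQ: "zD m n (r *\<^sub>Q \<xi>) = r *\<^sub>Q zD m n \<xi>"
  by (simp add: zD_def scaleQ_single)

lemma w_bracket_linear_extension:
  "w_bracket q x y = linear_extension (\<lambda>(k, n) \<xi>. linear_extension (\<lambda>(k', n') \<mu>.
      basis_bracket q (k + 1) n \<xi> (k' + 1) n' \<mu>) y) x"
  by (simp add: w_bracket_def linear_extension_def case_prod_beta)

lemma qlinear_basis_bracket:
  "qlinear (basis_bracket q m n \<xi> m' n')" "qlinear (\<lambda>\<xi>. basis_bracket q m n \<xi> m' n' \<mu>)"
  by (rule qlinearI; simp add: basis_bracket_zP distrib_left distrib_right mult_scaleQ_left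
      mult_scaleQ_right qlinear_add[OF qlinear_zP] qlinear_scaleQ[OF qlinear_zP])+

lemma qlinear_w_bracket_right: "qlinear (w_bracket q x)"
proof -
  have "qlinear (\<lambda>y. linear_extension (\<lambda>(k', n') \<mu>. basis_bracket q (k + 1) n \<xi> (k' +
      1) n' \<mu>) y)" for k n \<xi>
    by (rule qlinear_linear_extension) (auto simp: case_prod_beta qlinear_basis_bracket)
  then show ?thesis
    unfolding w_bracket_linear_extension[abs_def] 
    by (intro qlinearI)
      (auto simp: linear_extension_def case_prod_beta qlinear_def sum.distrib scaleQ_sum_right)
qed

lemma qlinear_w_bracket_left: "qlinear (\<lambda>x. w_bracket q x y)"
  unfolding w_bracket_linear_extension
  by (rule qlinear_linear_extension)
     (auto intro!: qlinearI simp: linear_extension_def case_prod_beta sum.distrib scaleQ_sum_right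
       qlinear_add[OF qlinear_basis_bracket(2)] qlinear_scaleQ[OF qlinear_basis_bracket(2)])

lemmas w_br_add = qlinear_add[OF qlinear_w_bracket_left] qlinear_add[OF qlinear_w_bracket_right]
lemmas w_br_minus = qlinear_minus[OF qlinear_w_bracket_left] qlinear_minus[OF qlinear_w_bracket_right]
lemmas w_br_scaleQ = qlinear_scaleQ[OF qlinear_w_bracket_left] qlinear_scaleQ[OF qlinear_w_bracket_right]
lemmas w_br_zero = qlinear_0[OF qlinear_w_bracket_left] qlinear_0[OF qlinear_w_bracket_right]

lemma w_bracket_zD:
  assumes "m \<ge> 1" "m' \<ge> 1"
  shows "w_bracket q (zD m n \<xi>) (zD m' n' \<mu>) = basis_bracket q m n \<xi> m' n' \<mu>"
proof -
  have "basis_bracket q m n 0 m' n' \<mu> = 0" "basis_bracket q m n \<xi> m' n' 0 = 0" for m n m' n' \<xi> \<mu>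
    using qlinear_0[OF qlinear_basis_bracket(1)] qlinear_0[OF qlinear_basis_bracket(2)] by auto
  then show ?thesis
    using assms by (simp add: w_bracket_linear_extension zD_def)
qed

lemma w_bracket_zP:
  assumes "m \<ge> 1" "m' \<ge> 1"
  shows "w_bracket q (zP m P \<xi>) (zP m' Q \<mu>) = zP (m + m') (poly_bracket m m' P Q) (\<xi> * \<mu>)"
proof (induction P arbitrary: \<xi> rule: bivariate_poly_induct)
  have z: "zP k 0 \<xi> = 0" for k \<xi> using zP_smult[of k 0 0 \<xi>] by simp
  {
    case zero
    have "poly_bracket m m' 0 Q = 0" by (rule eval_Dq_eqI) (simp add: eval_Dq_poly_bracket)
    then show ?case by (simp add: z w_br_zero)
  next
    case (Dv n)
    show ?case
    proof (induction Q arbitrary: \<mu> rule: bivariate_poly_induct)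
      case zero
      have "poly_bracket m m' (Dv ^ n) 0 = 0" by (rule eval_Dq_eqI) (simp add: eval_Dq_poly_bracket)
      then show ?case by (simp add: z w_br_zero)
    next
      case (qv P)
      have "q * (\<xi> * \<mu>) = \<xi> * (q * \<mu>)" by (metis q_comm mult.assoc)
      with qv show ?case by (simp add: zP_qv poly_bracket_qv_right)
    next
      case (Dv n')
      show ?case using assms by (simp add: zP_Dv w_bracket_zD basis_bracket_zP)
    qed (simp_all add: zP_add_left w_br_add poly_bracket_add_right zP_smult w_br_scaleQ poly_bracket_smult_right)
  }
qed (simp_all add: zP_add_left w_br_add poly_bracket_add_left zP_smult w_br_scaleQ poly_bracket_smult_left
    zP_qv poly_bracket_qv_left mult.assoc)

end

section \<open>Commutators, third differences and the operator \<open>ad z\<close>\<close>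

definition commutator :: "'a::ring \<Rightarrow> 'a \<Rightarrow> 'a" where
  "commutator a b = a * b - b * a"

lemma commutator_jacobi: "commutator a (commutator b c) = commutator (commutator a b) c +
    commutator b (commutator a c)"
  by (simp add: commutator_def algebra_simps)

lemma commutator_antisym: "commutator b a = - commutator a b"
  by (simp add: commutator_def)

lemma qlinear_commutator: "qlinear (commutator a)" "qlinear (\<lambda>a. commutator a b)"
  by (rule qlinearI; simp add: commutator_def algebra_simps mult_scaleQ_left mult_scaleQ_right scaleQ_diff_right)+

lemma commutator_lin:
  fixes a :: "'a::rat_algebra"
  shows "commutator a (x + y) = commutator a x + commutator a y"
      "commutator a (r *\<^sub>Q x) = r *\<^sub>Q commutator a x" "commutator a (- x) = - commutator a x"
    "commutator a (x - y) = commutator a x - commutator a y" "commutator a 0 = 0"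
    "commutator (x + y) a = commutator x a + commutator y a"
        "commutator (r *\<^sub>Q x) a = r *\<^sub>Q commutator x a" "commutator (- x) a = - commutator x a"
    "commutator (x - y) a = commutator x a - commutator y a" "commutator 0 a = 0"
  by (simp_all add: commutator_def algebra_simps mult_scaleQ_left mult_scaleQ_right scaleQ_diff_right)

text \<open>The difference of both sides is \<open>[[a, [a, b]], v]\<close>.\<close>

lemma commutator_serre:
  fixes a b v :: "'a::ring_1"
  assumes "commutator a (commutator a b) = 0"
  shows "commutator b (commutator a (commutator a v)) = 2 * commutator a (commutator b (commutator a v)) -
      commutator a (commutator a (commutator b v))"
proof -
  have "commutator b (commutator a (commutator a v)) - (2 * commutator a (commutator b (commutator a v)) -
      commutator a (commutator a (commutator b v))) = commutator (commutator a (commutator a b)) v"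
    by (simp add: commutator_def algebra_simps mult_2 mult_2_right)
  also have "\<dots> = 0" unfolding assms by (simp add: commutator_def)
  finally show ?thesis by simp
qed

lemma twice_eq_0: "x + x = 0 \<Longrightarrow> x = (0 :: 'a::rat_algebra)"
  using scaleQ_half[of x] by (simp flip: scaleQ_add_right)

lemma less_3_cases: "m < 3 \<Longrightarrow> m = 0 \<or> m = 1 \<or> m = (2 :: nat)"
  by auto

text \<open>By the vanishing third differences, \<open>c\<close> is a polynomial of degree at most two on \<open>{0..N}\<close>. A
  quadratic polynomial that is antisymmetric about \<open>N/2\<close> is a multiple of \<open>m - N/2\<close>, and the value
  at \<open>0\<close> makes it zero.\<close>

lemma third_difference_vanishing:
  fixes c :: "nat \<Rightarrow> 'a::rat_algebra"
  assumes diff: "\<And>m. m + 3 \<le> N \<Longrightarrow> c m - 3 * c (m + 1) + 3 * c (m + 2) - c (m + 3) = 0"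
    and anti: "\<And>m. m \<le> N \<Longrightarrow> c (N - m) = - c m"
    and c0: "c 0 = 0" and m: "m \<le> N"
  shows "c m = 0"
proof -
  define \<beta> where "\<beta> = c 2 - 2 * c 1"
  \<comment> \<open>Newton's interpolation formula for \<open>c\<close> with \<open>c 0 = 0\<close>\<close>
  have quad: "c m = of_nat m * c 1 + of_nat (m choose 2) * \<beta>" if "m \<le> N" for m
    using that
  proof (induction m rule: less_induct)
    case (less m)
    consider "m = 0" | "m = 1" | "m = 2" | k where "m = k + 3"
      by (metis nat_le_iff_add add.commute less_3_cases linorder_not_le)
    then show ?case
    proof cases
      case (4 k)
      have "c (k + 3) = c k - 3 * c (k + 1) + 3 * c (k + 2)"
        using diff[of k] less.prems 4 by simp
      moreover have "c k = of_nat k * c 1 + of_nat (k choose 2) * \<beta>"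
        "c (k + 1) = of_nat (k + 1) * c 1 + of_nat ((k + 1) choose 2) * \<beta>"
        "c (k + 2) = of_nat (k + 2) * c 1 + of_nat ((k + 2) choose 2) * \<beta>"
        by (rule less.IH; use less.prems 4 in simp)+
      moreover have nat: "(k + 1) choose 2 = (k choose 2) + k"
        "(k + 2) choose 2 = (k choose 2) + (k + k + 1)"
        "(k + 3) choose 2 = (k choose 2) + (k + k + k + 1 + 1 + 1)"
        by (simp_all add: numeral_2_eq_2 numeral_3_eq_3)
      moreover have "3 * x = x + x + x" for x :: 'a
      proof -
        have "(1 + 1 + 1) * x = x + x + x" by (simp only: distrib_right mult_1)
        then show ?thesis by simp
      qed
      moreover have nat': "k + 2 = k + 1 + 1" "k + 3 = k + 1 + 1 + 1" by simp_all
      ultimately have "c (k + 3) = of_nat (k + 1 + 1 + 1) * c 1 + of_nat ((k + 3) choose 2) * \<beta>"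
        unfolding nat by (simp only: nat' of_nat_add of_nat_1 distrib_right mult_1) (simp add: algebra_simps)
      then show ?thesis unfolding 4 nat'(2) by simp
    qed (auto simp: c0 \<beta>_def numeral_2_eq_2)
  qed
  have cN: "c N = 0" using anti[of 0] c0 by simp
  consider "N = 0" | "N = 1" | n where "N = n + 2"
    by (metis nat_le_iff_add add.commute less_2_cases linorder_not_le One_nat_def)
  then show ?thesis
  proof cases
    case (3 n)
    have "c 1 + c (n + 1) = 0" using anti[of 1] 3 by simp
    then have 1: "(of_nat (n + 2) :: 'a) * c 1 + of_nat ((n + 1) choose 2) * \<beta> = 0"
      using quad[of "n + 1"] 3 by (simp add: algebra_simps)
    have 2: "(of_nat (n + 2) :: 'a) * c 1 + of_nat ((n + 2) choose 2) * \<beta> = 0"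
      using quad[of N] 3 cN by simp
    have "(n + 2) choose 2 = ((n + 1) choose 2) + (n + 1)"
      by (simp add: numeral_2_eq_2)
    with 1 2 have "of_nat (n + 1) * \<beta> = 0"
      by (simp only: of_nat_add distrib_right) (metis add.assoc add.left_neutral)
    then have "of_nat (n + 1) *\<^sub>Q \<beta> = 0" by (simp only: scaleQ_of_nat)
    then have b: "\<beta> = 0" by (subst (asm) scaleQ_eq_0) auto
    with 2 have "of_nat (n + 2) *\<^sub>Q c 1 = 0" by (simp only: scaleQ_of_nat) simp
    then have "c 1 = 0" by (subst (asm) scaleQ_eq_0) auto
    with b show ?thesis using quad[OF m] by simp
  next
    case 1
    then show ?thesis using m c0 by simp
  next
    case 2
    then show ?thesis using m c0 cN by (cases m) auto
  qed
qed

text \<open>The binomial expansion of \<open>- ((D + q)\<^sup>n\<^sup>+\<^sup>1 - D\<^sup>n\<^sup>+\<^sup>1) / q\<close>, with the leading term in \<open>D\<close> split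
  off.\<close>

lemma poly_bracket_one_Dv_power: "poly_bracket 1 k 1 (Dv ^ Suc n) =
   - (Polynomial.smult [:of_nat (Suc n):] (Dv ^ n) +
      (\<Sum>j<n. Polynomial.smult [:of_nat (Suc n choose j):] (qv ^ (n - j) * Dv ^ j)))"
proof (rule eval_Dq_eqI)
  fix x y :: rat assume y: "y \<noteq> 0"
  have "(x + y) ^ Suc n = (\<Sum>j\<le>Suc n. of_nat (Suc n choose j) * x ^ j * y ^ (Suc n - j))"
    by (rule binomial_ring)
  also have "\<dots> = (\<Sum>j<n. of_nat (Suc n choose j) * x ^ j * y ^ (Suc n - j)) +
      of_nat (Suc n) * x ^ n * y + x ^ Suc n"
  proof -
    have "{..Suc n} = insert (Suc n) (insert n {..<n})" by auto
    then show ?thesis by (simp del: power_Suc binomial_Suc_Suc)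
  qed
  also have "(\<Sum>j<n. of_nat (Suc n choose j) * x ^ j * y ^ (Suc n - j)) =
      y * (\<Sum>j<n. of_nat (Suc n choose j) * (y ^ (n - j) * x ^ j))"
    unfolding sum_distrib_left
    by (intro sum.cong) (auto simp: Suc_diff_le)
  finally show "eval_Dq x y (poly_bracket 1 k 1 (Dv ^ Suc n)) =
      eval_Dq x y (- (Polynomial.smult [:of_nat (Suc n):] (Dv ^ n) +
      (\<Sum>j<n. Polynomial.smult [:of_nat (Suc n choose j):] (qv ^ (n - j) * Dv ^ j))))"
    using y by (simp add: eval_Dq_poly_bracket field_simps del: power_Suc binomial_Suc_Suc of_nat_Suc One_nat_def)
qed

lemma poly_bracket_one_one: "poly_bracket 1 k 1 1 = 0"
  by (rule eval_Dq_eqI) (simp add: eval_Dq_poly_bracket)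

lemma poly_bracket_zero_right: "poly_bracket j k P 0 = 0"
  by (rule eval_Dq_eqI) (simp add: eval_Dq_poly_bracket)

text \<open>The difference operator lowers the degree in \<open>D\<close> by exactly one: its leading coefficient on
  \<open>D\<^sup>n\<^sup>+\<^sup>1\<close> is \<open>-(n + 1)\<close>, which is invertible over the rational numbers.\<close>

lemma poly_bracket_one_surj: "\<exists>P. poly_bracket 1 k 1 P = Q"
proof (induction Q rule: bivariate_poly_induct)
  case zero
  show ?case by (metis poly_bracket_zero_right)
next
  case (add P Q)
  then show ?case by (metis poly_bracket_add_right)
next
  case (qv P)
  then show ?case by (metis poly_bracket_qv_right)
next
  case (smult r P)
  then show ?case by (metis poly_bracket_smult_right)
next
  case (Dv n)
  show ?case
  proof (induction n rule: less_induct)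
    case (less n)
    have qv_power: "\<exists>P. poly_bracket 1 k 1 P = qv ^ i * Q" if "\<exists>P. poly_bracket 1 k 1 P = Q" for i Q
    proof (induction i)
      case (Suc i)
      then obtain P where "poly_bracket 1 k 1 P = qv ^ i * Q" by blast
      then have "poly_bracket 1 k 1 (qv * P) = qv ^ Suc i * Q" by (simp only: poly_bracket_qv_right power_Suc
          mult.assoc)
      then show ?case by blast
    qed (use that in simp)
    have "\<exists>P. poly_bracket 1 k 1 P = (\<Sum>j<n'. Polynomial.smult [:of_nat (Suc n choose j):]
        (qv ^ (n - j) * Dv ^ j))"
      if "n' \<le> n" for n'
      using that
    proof (induction n')
      case 0
      show ?case by (rule exI[of _ 0]) (simp only: poly_bracket_zero_right lessThan_0 sum.empty)
    next
      case (Suc n')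
      then obtain P where P: "poly_bracket 1 k 1 P = (\<Sum>j<n'. Polynomial.smult [:of_nat (Suc n choose j):]
          (qv ^ (n - j) * Dv ^ j))"
        by auto
      obtain P' where "poly_bracket 1 k 1 P' = qv ^ (n - n') * Dv ^ n'"
        using qv_power less.IH[of n'] Suc.prems by (meson Suc_le_eq)
      with P show ?case
        by (intro exI[of _ "P + Polynomial.smult [:of_nat (Suc n choose n'):] P'"])
          (simp add: poly_bracket_add_right poly_bracket_smult_right)
    qed
    then obtain P where P: "poly_bracket 1 k 1 P = (\<Sum>j<n. Polynomial.smult [:of_nat (Suc n choose j):]
        (qv ^ (n - j) * Dv ^ j))"
      by blast
    have "poly_bracket 1 k 1 (Polynomial.smult [:- 1 / of_nat (Suc n):] (Dv ^ Suc n + P)) = Dv ^ n"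
      unfolding poly_bracket_smult_right poly_bracket_add_right poly_bracket_one_Dv_power P
      by (rule eval_Dq_eqI) (simp add: field_simps del: of_nat_Suc)
    then show ?case by blast
  qed
qed

section \<open>Relations and generators of \<open>w\<^sup>+\<close>\<close>

context super_coefficients
begin

abbreviation w_br where "w_br \<equiv> w_bracket q"

definition z0 :: "'h w_plus" where "z0 = zD 1 0 1"
definition z1 :: "'h w_plus" where "z1 = zD 1 1 1"

lemma zP_zero_left: "zP k 0 \<xi> = 0"
  using zP_smult[of k 0 0 \<xi>] by simp

lemma zP_minus_left: "zP k (- P) \<xi> = - zP k P \<xi>"
  using zP_add_left[of k P "- P" \<xi>] by (simp add: zP_zero_left eq_neg_iff_add_eq_0 add.commute)

lemma zP_diff_left: "zP k (P - Q) \<xi> = zP k P \<xi> - zP k Q \<xi>"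
  using zP_add_left[of k P "- Q" \<xi>] by (simp add: zP_minus_left)

lemma zP_sum_left: "zP k (\<Sum>i\<in>A. F i) \<xi> = (\<Sum>i\<in>A. zP k (F i) \<xi>)"
  by (induction A rule: infinite_finite_induct) (auto simp: zP_zero_left zP_add_left)

lemma zP_qv_power: "zP k (qv ^ i * P) \<xi> = zP k P (q ^ i * \<xi>)"
proof (induction i arbitrary: \<xi>)
  case (Suc i)
  have "q ^ i * (q * \<xi>) = q * (q ^ i * \<xi>)" by (simp add: power_commutes flip: mult.assoc)
  with Suc show ?case by (simp add: mult.assoc zP_qv)
qed simp

lemma zP_of_nat: "zP k (of_nat n * P) \<xi> = of_nat n *\<^sub>Q zP k P \<xi>"
  using zP_smult[of k "of_nat n" P \<xi>] by (simp add: of_nat_poly)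

lemma w_br_z0_zP: "w_br z0 (zP (Suc k) P \<xi>) = zP (Suc (Suc k)) (poly_bracket 1 (Suc k) 1 P) \<xi>"
  using w_bracket_zP[of 1 "Suc k" "Dv ^ 0" 1 P \<xi>] by (simp add: z0_def flip: zP_Dv)

lemma w_br_z1_zP: "w_br z1 (zP (Suc k) P \<xi>) = zP (Suc (Suc k)) (poly_bracket 1 (Suc k) Dv P) \<xi>"
  using w_bracket_zP[of 1 "Suc k" "Dv ^ 1" 1 P \<xi>] by (simp add: z1_def flip: zP_Dv)

lemma w_br_z0_zD_0: "w_br z0 (zD (Suc k) 0 \<xi>) = 0"
  using w_br_z0_zP[of k "Dv ^ 0" \<xi>] poly_bracket_one_one[of "Suc k"] by (simp add: zP_zero_left flip: zP_Dv)

lemma w_br_z0_zD_Suc: "w_br z0 (zD (Suc k) (Suc n) \<xi>) =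
   - (of_nat (Suc n) *\<^sub>Q zD (Suc (Suc k)) n \<xi> +
      (\<Sum>j<n. of_nat (Suc n choose j) *\<^sub>Q zD (Suc (Suc k)) j (q ^ (n - j) * \<xi>)))"
  using w_br_z0_zP[of k "Dv ^ Suc n" \<xi>] unfolding poly_bracket_one_Dv_power
  by (simp only: zP_Dv zP_minus_left zP_add_left zP_smult zP_sum_left zP_qv_power)

text \<open>A property of \<open>z\<^sup>k D\<^sup>n \<xi>\<close> passes to \<open>z\<^sup>k P(D, q) \<xi>\<close>, provided the coefficients admit
  multiplication by \<open>q\<close>.\<close>

lemma zP_induct:
  assumes "0 \<in> V" "\<And>\<xi>. \<xi> \<in> V \<Longrightarrow> q * \<xi> \<in> V" "\<xi> \<in> V"
    and "S 0" "\<And>x y. S x \<Longrightarrow> S y \<Longrightarrow> S (x + y)"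
        "\<And>r x. S x \<Longrightarrow> S (r *\<^sub>Q x)"
    and "\<And>n \<xi>. \<xi> \<in> V \<Longrightarrow> S (zD k n \<xi>)"
  shows "S (zP k P \<xi>)"
  using assms(3)
  by (induction P arbitrary: \<xi> rule: bivariate_poly_induct)
     (use assms in \<open>auto simp: zP_zero_left zP_add_left zP_qv zP_smult zP_Dv\<close>)

definition w_over :: "'h set \<Rightarrow> 'h w_plus set" where
  "w_over V = {x. \<forall>k. Poly_Mapping.lookup x k \<in> V}"

lemma w_plus_zD_induct:
  assumes "x \<in> w_over V" "S 0" "\<And>x y. S x \<Longrightarrow> S y \<Longrightarrow> S (x + y)"
    and "\<And>k n \<xi>. \<xi> \<in> V \<Longrightarrow> S (zD (Suc k) n \<xi>)"
  shows "S x"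
proof -
  have "S (\<Sum>k\<in>A. Poly_Mapping.single k (Poly_Mapping.lookup x k))" if "finite A" for A
    using that
  proof (induction A)
    case (insert k A)
    obtain k' n where k: "k = (k', n)" by force
    have "S (Poly_Mapping.single k (Poly_Mapping.lookup x k))"
      using assms(4)[of "Poly_Mapping.lookup x k" k' n] assms(1) by (simp add: k zD_def w_over_def)
    then show ?case using insert assms by simp
  qed (use assms in simp)
  moreover have "(\<Sum>k\<in>Poly_Mapping.keys x. Poly_Mapping.single k (Poly_Mapping.lookup x k)) = x"
    by (rule poly_mapping_eqI)
       (simp add: lookup_sum lookup_single when_def in_keys_iff)
  ultimately show ?thesis by (metis finite_keys)
qed

lemma w_plus_induct [case_names zero add zD]:
  fixes x :: "'h w_plus"
  assumes "S 0" "\<And>x y. S x \<Longrightarrow> S y \<Longrightarrow> S (x + y)"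
      "\<And>k n \<xi>. S (zD (Suc k) n \<xi>)"
  shows "S x"
  by (rule w_plus_zD_induct[of x UNIV]) (use assms in \<open>auto simp: w_over_def\<close>)

definition q_subspace :: "'h set \<Rightarrow> bool" where
  "q_subspace V \<longleftrightarrow> 0 \<in> V \<and> (\<forall>\<xi>\<in>V. \<forall>\<mu>\<in>V. \<xi> +
      \<mu> \<in> V) \<and> (\<forall>r. \<forall>\<xi>\<in>V. r *\<^sub>Q \<xi> \<in> V) \<and>
          (\<forall>\<xi>\<in>V. q * \<xi> \<in> V)"

lemma q_subspace_UNIV: "q_subspace UNIV" and q_subspace_H: "q_subspace (H e)"
  using mult_H[OF q_H, of _ e] by (auto simp: q_subspace_def H_zero H_add H_scaleQ)

lemma w_over_closed:
  assumes "q_subspace V"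
  shows "0 \<in> w_over V" "x \<in> w_over V \<Longrightarrow> y \<in> w_over V \<Longrightarrow> x +
      y \<in> w_over V" "x \<in> w_over V \<Longrightarrow> r *\<^sub>Q x \<in> w_over V"
    "\<xi> \<in> V \<Longrightarrow> zD k n \<xi> \<in> w_over V"
  using assms by (auto simp: w_over_def q_subspace_def lookup_add lookup_scaleQ zD_def lookup_single when_def)

lemma zP_w_over: "q_subspace V \<Longrightarrow> \<xi> \<in> V \<Longrightarrow> zP k P \<xi> \<in> w_over V"
  by (rule zP_induct[where V = V]) (auto simp: w_over_closed q_subspace_def)

lemma w_br_parity:
  assumes "x \<in> w_over (H e)" "y \<in> w_over (H f)"
  shows "w_br x y \<in> w_over (H (e \<noteq> f))"
  using assms(1)
proof (rule w_plus_zD_induct)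
  fix k n \<xi> assume \<xi>: "\<xi> \<in> H e"
  show "w_br (zD (Suc k) n \<xi>) y \<in> w_over (H (e \<noteq> f))"
    using assms(2)
  proof (rule w_plus_zD_induct)
    fix k' n' \<mu> assume \<mu>: "\<mu> \<in> H f"
    show "w_br (zD (Suc k) n \<xi>) (zD (Suc k') n' \<mu>) \<in> w_over (H (e \<noteq> f))"
      using mult_H[OF \<xi> \<mu>] by (simp add: w_bracket_zD basis_bracket_zP zP_w_over q_subspace_H)
  qed (auto simp: w_br_zero w_br_add w_over_closed q_subspace_H)
qed (auto simp: w_br_zero w_br_add w_over_closed q_subspace_H)

lemma z0_H: "z0 \<in> w_over (H False)" and z1_H: "z1 \<in> w_over (H False)"
  by (simp_all add: z0_def z1_def w_over_closed q_subspace_H one_H)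

lemma w_br_z0_w_over:
  assumes "q_subspace V" "x \<in> w_over V"
  shows "w_br z0 x \<in> w_over V"
  using assms(2)
proof (rule w_plus_zD_induct)
  fix k n \<xi> assume "\<xi> \<in> V"
  then show "w_br z0 (zD (Suc k) n \<xi>) \<in> w_over V"
    using w_br_z0_zP[of k "Dv ^ n" \<xi>] assms(1) by (simp add: zP_Dv zP_w_over)
qed (simp_all add: w_br_zero w_br_add w_over_closed assms(1))

text \<open>\<open>w\<^sup>+\<close> is generated from degree one by \<open>ad z\<close> alone, by \<open>poly_bracket_one_surj\<close>. The set \<open>V\<close>
  allows inductions within the even or within the odd part.\<close>

lemma w_plus_generated [consumes 2, case_names zero add scaleQ degree_one ad_z]:
  assumes "q_subspace V" "x \<in> w_over V" "S 0" "\<And>x y. S x \<Longrightarrow> S y \<Longrightarrow>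
      S (x + y)" "\<And>r x. S x \<Longrightarrow> S (r *\<^sub>Q x)"
    and "\<And>n \<xi>. \<xi> \<in> V \<Longrightarrow> S (zD 1 n \<xi>)" and
        "\<And>x. x \<in> w_over V \<Longrightarrow> S x \<Longrightarrow> S (w_br z0 x)"
  shows "S x"
proof -
  have "S (zP (Suc k) P \<xi>)" if "\<xi> \<in> V" for k P \<xi>
    using that
  proof (induction k arbitrary: P)
    case 0
    have "S (zP 1 P \<xi>)"
      by (rule zP_induct[where V = V, OF _ _ 0 assms(3-6)])
         (use assms(1) in \<open>simp_all add: q_subspace_def\<close>)
    then show ?case by simp
  next
    case (Suc k)
    obtain P' where "poly_bracket 1 (Suc k) 1 P' = P" using poly_bracket_one_surj by blast
    then have "zP (Suc (Suc k)) P \<xi> = w_br z0 (zP (Suc k) P' \<xi>)" by (simp add: w_br_z0_zP)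
    then show ?case using assms(7)[OF zP_w_over[OF assms(1) Suc.prems] Suc.IH[OF Suc.prems]] by simp
  qed
  then have gen: "S (zD (Suc k) n \<xi>)" if "\<xi> \<in> V" for k n \<xi>
    using that by (metis zP_Dv)
  show ?thesis
    by (rule w_plus_zD_induct[OF assms(2-4) gen])
qed

text \<open>For a first argument with coefficient \<open>1\<close> the Jacobi identity has no signs. This case
  suffices below, since \<open>w\<^sup>+\<close> is generated by \<open>ad z\<close>.\<close>

lemma w_br_jacobi_unit:
  assumes "j \<ge> 1"
  shows "w_br (zD j n 1) (w_br x y) = w_br (w_br (zD j n 1) x) y + w_br x (w_br (zD j n 1) y)"
proof (induction x rule: w_plus_induct)
  case (zD k m \<xi>)
  show ?case
  proof (induction y rule: w_plus_induct)
    case (zD k' m' \<mu>)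
    show ?case
      using assms poly_bracket_jacobi[of j "Suc k" "Suc k'" "Dv ^ n" "Dv ^ m" "Dv ^ m'"]
      by (simp add: w_bracket_zP add.assoc flip: zP_Dv) (simp add: zP_add_left add.left_commute)
  qed (simp_all add: w_br_zero w_br_add)
qed (simp_all add: w_br_zero w_br_add)

text \<open>The consequence of \<open>[z, [z, zD]] = 0\<close> in the form of \<open>commutator_serre\<close>. The relation
  between commutators in \<open>commutes_step\<close> has the same shape, and the two are compared term by
  term.\<close>

lemma w_br_serre:
  "w_br z1 (w_br z0 (w_br z0 (zP (Suc k) P \<xi>))) =
     2 *\<^sub>Q w_br z0 (w_br z1 (w_br z0 (zP (Suc k) P \<xi>))) - w_br z0 (w_br z0 (w_br z1 (zP (Suc k) P \<xi>)))"
proof -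
  let ?k = "Suc k"
  have "poly_bracket 1 (Suc (Suc ?k)) Dv (poly_bracket 1 (Suc ?k) 1 (poly_bracket 1 ?k 1 P)) =
      Polynomial.smult [:2:] (poly_bracket 1 (Suc (Suc ?k)) 1 (poly_bracket 1 (Suc ?k) Dv (poly_bracket 1 ?k 1 P))) -
      poly_bracket 1 (Suc (Suc ?k)) 1 (poly_bracket 1 (Suc ?k) 1 (poly_bracket 1 ?k Dv P))"
    by (rule eval_Dq_eqI) (simp add: eval_Dq_poly_bracket field_simps)
  then show ?thesis
    by (simp add: w_br_z0_zP w_br_z1_zP zP_diff_left zP_smult)
qed

lemma w_br_cubic:
  "w_br z1 (w_br z0 (zD 1 a \<xi>)) = 2 *\<^sub>Q w_br z0 (w_br z1 (zD 1 a \<xi>)) -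
      w_br z0 (w_br z0 (zD 1 (Suc a) \<xi>))"
proof -
  have "poly_bracket 1 (Suc 1) Dv (poly_bracket 1 1 1 P) = Polynomial.smult [:2:]
      (poly_bracket 1 (Suc 1) 1 (poly_bracket 1 1 Dv P)) -
      poly_bracket 1 (Suc 1) 1 (poly_bracket 1 1 1 (Dv * P))" for P
    by (rule eval_Dq_eqI) (simp add: eval_Dq_poly_bracket field_simps)
  from this[of "Dv ^ a"] show ?thesis
    using w_br_z0_zP[of 0] w_br_z1_zP[of 0] w_br_z0_zP[of 1] w_br_z1_zP[of 1]
    by (simp add: zP_diff_left zP_smult flip: zP_Dv)
qed

text \<open>The Serre relation will be applied to \<open>z\<^sup>k\<^sup>+\<^sup>1 D \<xi>\<close>: \<open>(ad z)\<^sup>2\<close> annihilates it, and the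
  remaining combination is a nonzero multiple of \<open>z\<^sup>k\<^sup>+\<^sup>3 \<xi>\<close>, the element whose image has to be shown
  to commute with \<open>T\<^sub>0(1)\<close>.\<close>

lemma w_br_lowest:
  "w_br z0 (w_br z0 (zD (Suc k) 1 \<xi>)) = 0"
  "2 *\<^sub>Q w_br z1 (w_br z0 (zD (Suc k) 1 \<xi>)) - w_br z0 (w_br z1 (zD (Suc k) 1 \<xi>)) =
     (- of_nat (k + 4)) *\<^sub>Q zD (Suc (Suc (Suc k))) 0 \<xi>"
proof -
  have "poly_bracket 1 (Suc (Suc k)) 1 (poly_bracket 1 (Suc k) 1 (Dv ^ 1)) = 0"
    "Polynomial.smult [:2:] (poly_bracket 1 (Suc (Suc k)) Dv (poly_bracket 1 (Suc k) 1 (Dv ^ 1))) -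
      poly_bracket 1 (Suc (Suc k)) 1 (poly_bracket 1 (Suc k) Dv (Dv ^ 1)) =
          Polynomial.smult [:- of_nat (k + 4):] (Dv ^ 0)"
    by (rule eval_Dq_eqI; simp add: eval_Dq_poly_bracket field_simps)+
  then show "w_br z0 (w_br z0 (zD (Suc k) 1 \<xi>)) = 0"
    "2 *\<^sub>Q w_br z1 (w_br z0 (zD (Suc k) 1 \<xi>)) - w_br z0 (w_br z1 (zD (Suc k) 1 \<xi>)) =
     (- of_nat (k + 4)) *\<^sub>Q zD (Suc (Suc (Suc k))) 0 \<xi>"
    by (simp_all only: w_br_z0_zP w_br_z1_zP zP_zero_left flip: zP_Dv zP_smult zP_diff_left)
qed

lemma w_br_degree_one: "w_br (zD 1 m \<xi>) (zD 1 n \<mu>) =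
    zP 2 (poly_bracket 1 1 (Dv ^ m) (Dv ^ n)) (\<xi> * \<mu>)"
  using w_bracket_zP[of 1 1 "Dv ^ m" \<xi> "Dv ^ n" \<mu>] by (simp add: zP_Dv numeral_2_eq_2)

lemma w_br_degree_one_antisym: "w_br (zD 1 n 1) (zD 1 m \<xi>) = - w_br (zD 1 m 1) (zD 1 n \<xi>)"
  unfolding w_br_degree_one mult_1 mult_1_right poly_bracket_antisym[of 1 1 "Dv ^ n" "Dv ^ m"] zP_minus_left ..

text \<open>The quadratic relation of \<open>W\<^sup>\<ge>\<close> for \<open>c\<^sub>1 = 0\<close>, \<open>s\<^sub>2 = q\<^sup>2\<close>. The first term of the bracket is
  \<open>D\<^sub>1\<^sup>m D\<^sub>2\<^sup>n\<close> with \<open>D\<^sub>1 = D + q\<close>, \<open>D\<^sub>2 = D\<close>, the second one with \<open>D\<^sub>1 = D\<close>, \<open>D\<^sub>2 = D + q\<close>, and in both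
  cases \<open>(D\<^sub>2 - D\<^sub>1)\<^sup>3 = q\<^sup>2 (D\<^sub>2 - D\<^sub>1)\<close>.\<close>

lemma w_br_quadratic:
  "w_br (zD 1 m \<xi>) (zD 1 (n + 3) \<mu>) - 3 *\<^sub>Q w_br (zD 1 (m + 1) \<xi>) (zD 1 (n + 2) \<mu>)
     + 3 *\<^sub>Q w_br (zD 1 (m + 2) \<xi>) (zD 1 (n + 1) \<mu>) - w_br (zD 1 (m + 3) \<xi>) (zD 1 n \<mu>) =
   w_br (zD 1 m \<xi>) (zD 1 (n + 1) (q ^ 2 * \<mu>)) - w_br (zD 1 (m + 1) \<xi>) (zD 1 n (q ^ 2 * \<mu>))"
proof -
  have *: "poly_bracket 1 1 (Dv ^ m) (Dv ^ (n + 3)) - Polynomial.smult [:3:] (poly_bracket 1 1 (Dv ^ (m +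
      1)) (Dv ^ (n + 2)))
     + Polynomial.smult [:3:] (poly_bracket 1 1 (Dv ^ (m + 2)) (Dv ^ (n + 1))) -
         poly_bracket 1 1 (Dv ^ (m + 3)) (Dv ^ n) =
     qv ^ 2 * (poly_bracket 1 1 (Dv ^ m) (Dv ^ (n + 1)) - poly_bracket 1 1 (Dv ^ (m + 1)) (Dv ^ n))"
    by (rule eval_Dq_eqI) (simp add: eval_Dq_poly_bracket power_add power2_eq_square power3_eq_cube, simp add:
        field_simps)
  have "\<xi> * (q ^ 2 * \<mu>) = q ^ 2 * (\<xi> * \<mu>)"
    by (metis q_power_comm mult.assoc)
  then show ?thesis
    using arg_cong[OF *, of "\<lambda>P. zP 2 P (\<xi> * \<mu>)"]
    by (simp only: w_br_degree_one zP_qv_power) (simp only: zP_diff_left zP_add_left zP_smult)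
qed

end

section \<open>Superderivations of \<open>w\<^sup>+\<close> given by power sums\<close>

lemma qlinear_comp: "qlinear f \<Longrightarrow> qlinear g \<Longrightarrow> qlinear (\<lambda>x. f (g x))"
  and qlinear_plus: "qlinear f \<Longrightarrow> qlinear h \<Longrightarrow> qlinear (\<lambda>x. f x + h x)"
  and qlinear_scaleQ_comp: "qlinear f \<Longrightarrow> qlinear (\<lambda>x. r *\<^sub>Q f x)"
  by (simp_all add: qlinear_def scaleQ_add_right scaleQ_scaleQ algebra_simps)

lemma qlinear_times: "qlinear (\<lambda>x. a * x)"
  by (simp add: qlinear_def distrib_left mult_scaleQ_right)

lemma qlinear_sum_fun:
  "(\<And>i. i \<in> A \<Longrightarrow> qlinear (f i)) \<Longrightarrow> qlinear (\<lambda>x. \<Sum>i\<in>A. f i x)"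
  by (simp add: qlinear_def sum.distrib scaleQ_sum_right)

lemma scomm_if: "scomm e f x y = (if even (e * f) then x * y - y * x else x * y + y * (x :: 'a::ring_1))"
  by (simp add: scomm_def minus_one_power_iff)

lemma scomm_commutator:
  fixes a x y :: "'a::ring_1"
  shows "scomm e f (commutator a x) y = commutator a (scomm e f x y) - scomm e f x (commutator a y)"
    and "scomm e f x (commutator a y) = commutator a (scomm e f x y) - scomm e f (commutator a x) y"
  unfolding scomm_if by (simp_all add: commutator_def algebra_simps)

lemma scomm_lin:
  fixes x y z :: "'a::rat_algebra"
  shows "scomm e f 0 y = 0" "scomm e f (x + z) y = scomm e f x y + scomm e f z y"
    "scomm e f (r *\<^sub>Q x) y = r *\<^sub>Q scomm e f x y" "scomm e f x 0 = 0"
    "scomm e f x (y + z) = scomm e f x y + scomm e f x z" "scomm e f x (r *\<^sub>Q y) = r *\<^sub>Q scomm e f x y"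
  unfolding scomm_if by (simp_all add: algebra_simps mult_scaleQ_left mult_scaleQ_right
      scaleQ_diff_right scaleQ_add_right)

context super_coefficients
begin

text \<open>The superderivation by which \<open>\<psi>\<^sub>m(\<xi>)\<close> acts. Formally it is the adjoint action of
  \<open>q\<^sup>m B\<^sub>m(D/q) \<xi>\<close>, an element of \<open>z\<close>-degree zero.\<close>

definition power_sum_der :: "nat \<Rightarrow> 'h \<Rightarrow> 'h w_plus \<Rightarrow> 'h w_plus" where
  "power_sum_der m \<xi> = linear_extension (\<lambda>(k, n) \<mu>. zP (Suc k) (power_sum (Suc k) m * Dv ^ n)
      (\<xi> * \<mu>))"

lemma qlinear_power_sum_der: "qlinear (power_sum_der m \<xi>)"
  unfolding power_sum_der_def
  by (rule qlinear_linear_extension)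
     (auto intro!: qlinearI simp: distrib_left mult_scaleQ_right qlinear_add[OF qlinear_zP]
       qlinear_scaleQ[OF qlinear_zP])

lemmas power_sum_der_lin = qlinear_rules[OF qlinear_power_sum_der]

lemma power_sum_der_zD: "power_sum_der m \<xi> (zD (Suc k) n \<mu>) =
    zP (Suc k) (power_sum (Suc k) m * Dv ^ n) (\<xi> * \<mu>)"
  by (simp add: power_sum_der_def zD_def qlinear_0[OF qlinear_zP])

lemma power_sum_der_zP: "power_sum_der m \<xi> (zP (Suc k) P \<mu>) =
    zP (Suc k) (power_sum (Suc k) m * P) (\<xi> * \<mu>)"
proof (induction P arbitrary: \<mu> rule: bivariate_poly_induct)
  case (qv P)
  have "\<xi> * (q * \<mu>) = q * (\<xi> * \<mu>)" by (metis q_comm mult.assoc)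
  then show ?case
    using qv zP_qv[of "Suc k" "power_sum (Suc k) m * P"] by (simp add: zP_qv mult.left_commute)
qed (simp_all add: zP_zero_left qlinear_0[OF qlinear_power_sum_der] zP_add_left qlinear_add[OF qlinear_power_sum_der]
     distrib_left zP_smult qlinear_scaleQ[OF qlinear_power_sum_der] zP_Dv power_sum_der_zD)

lemma power_sum_der_degree_one: "power_sum_der m \<xi> (zD 1 n \<mu>) =
    of_nat m *\<^sub>Q zD 1 (m + n - 1) (\<xi> * \<mu>)"
proof (cases m)
  case 0
  then show ?thesis using power_sum_der_zD[of m \<xi> 0 n \<mu>] by (simp add: power_sum_def zP_zero_left)
next
  case (Suc m')
  have "power_sum 1 m * Dv ^ n = of_nat m * Dv ^ (m + n - 1)"
    by (simp add: power_sum_def Suc power_add mult.assoc)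
  then show ?thesis using power_sum_der_zD[of m \<xi> 0 n \<mu>] by (simp only: One_nat_def zP_of_nat zP_Dv)
qed

lemma power_sum_der_add: "power_sum_der m (\<xi> + \<xi>') x = power_sum_der m \<xi> x + power_sum_der m \<xi>' x"
  and power_sum_der_scaleQ: "power_sum_der m (r *\<^sub>Q \<xi>) x = r *\<^sub>Q power_sum_der m \<xi> x"
  by (induction x rule: w_plus_induct)
     (simp_all add: power_sum_der_lin power_sum_der_zD distrib_right
       qlinear_add[OF qlinear_zP] mult_scaleQ_left qlinear_scaleQ[OF qlinear_zP] scaleQ_add_right)

lemma power_sum_der_zero: "power_sum_der m 0 x = 0"
  using power_sum_der_scaleQ[of m 0 0 x] by simp

lemma power_sum_der_parity:
  assumes "\<xi> \<in> H e" "x \<in> w_over (H f)"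
  shows "power_sum_der m \<xi> x \<in> w_over (H (e \<noteq> f))"
  using assms(2)
proof (rule w_plus_zD_induct)
  fix k n \<mu> assume "\<mu> \<in> H f"
  then show "power_sum_der m \<xi> (zD (Suc k) n \<mu>) \<in> w_over (H (e \<noteq> f))"
    unfolding power_sum_der_zD by (intro zP_w_over q_subspace_H mult_H assms(1))
qed (simp_all add: power_sum_der_lin w_over_closed[OF q_subspace_H])

text \<open>The sign that a superderivation of parity \<open>e\<close> produces when it passes an element.\<close>

definition wpar :: "bool \<Rightarrow> 'h w_plus \<Rightarrow> 'h w_plus" where
  "wpar e = linear_extension (\<lambda>k \<mu>. Poly_Mapping.single k (if e then par \<mu> else \<mu>))"

lemma qlinear_wpar: "qlinear (wpar e)"
  unfolding wpar_def
  by (rule qlinear_linear_extension)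
     (auto intro!: qlinearI simp: par_add par_scaleQ single_add scaleQ_single)

lemmas wpar_lin = qlinear_rules[OF qlinear_wpar]

lemma wpar_zD: "wpar e (zD k n \<mu>) = zD k n (if e then par \<mu> else \<mu>)"
  by (simp add: wpar_def zD_def qlinear_0[OF qlinear_par])

lemma par_q_mult: "par (q * \<mu>) = q * par \<mu>"
proof -
  have "par (q * hpart e \<mu>) = q * par (hpart e \<mu>)" for e
    using mult_H[OF q_H hpart_H, of e \<mu>] hpart_H[of e \<mu>] by (cases e) (simp_all add: H_iff)
  then show ?thesis
    by (metis hpart_sum par_add distrib_left)
qed

lemma wpar_zP: "wpar e (zP k P \<mu>) = zP k P (if e then par \<mu> else \<mu>)"
  by (induction P arbitrary: \<mu> rule: bivariate_poly_induct)
     (auto simp: zP_zero_left qlinear_0[OF qlinear_wpar] zP_add_left qlinear_add[OF qlinear_wpar]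
       zP_qv par_q_mult zP_smult qlinear_scaleQ[OF qlinear_wpar] zP_Dv wpar_zD)

lemma wpar_homogeneous:
  assumes "x \<in> w_over (H f)"
  shows "wpar e x = (if e \<and> f then - x else x)"
  using assms
proof (rule w_plus_zD_induct)
  fix k n \<mu> assume "\<mu> \<in> H f"
  then show "wpar e (zD (Suc k) n \<mu>) = (if e \<and> f then - zD (Suc k) n \<mu> else zD (Suc k) n \<mu>)"
    unfolding wpar_zD by (auto simp: H_iff zD_def single_uminus)
qed (auto simp: wpar_lin)

lemma H_mult_swap:
  assumes "\<xi> \<in> H e"
  shows "\<xi> * \<mu> = (if e then par \<mu> else \<mu>) * \<xi>"
proof -
  have "\<xi> * hpart f \<mu> = (if e then par (hpart f \<mu>) else hpart f \<mu>) * \<xi>" for f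
    using supercomm[OF assms hpart_H[of f \<mu>]] hpart_H[of f \<mu>] by (auto simp: H_iff)
  then have "\<xi> * (hpart False \<mu> + hpart True \<mu>) =
      ((if e then par (hpart False \<mu>) else hpart False \<mu>) +
       (if e then par (hpart True \<mu>) else hpart True \<mu>)) * \<xi>"
    by (simp only: distrib_left distrib_right)
  then show ?thesis
    by (cases e) (simp_all only: if_True if_False par_add[symmetric] hpart_sum)
qed

lemma power_sum_der_derivation:
  assumes "\<xi> \<in> H e"
  shows "power_sum_der m \<xi> (w_br x y) = w_br (power_sum_der m \<xi> x) y +
      w_br (wpar e x) (power_sum_der m \<xi> y)"
proof (induction x rule: w_plus_induct)
  case (zD k n \<mu>)
  show ?case
  proof (induction y rule: w_plus_induct)
    case (zD k' n' \<nu>)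
    have "\<xi> * (\<mu> * \<nu>) = (if e then par \<mu> else \<mu>) * (\<xi> * \<nu>)"
      using H_mult_swap[OF assms, of \<mu>] by (metis mult.assoc)
    then show ?case
      using power_sum_poly_bracket[of "Suc k" "Suc k'" m "Dv ^ n" "Dv ^ n'"] power_sum_der_zP[of m \<xi> "k + Suc k'"]
        w_bracket_zP[of "Suc k" "Suc k'"]
      by (simp add: wpar_zP power_sum_der_zP mult.assoc flip: zP_Dv) (simp add: zP_add_left)
  qed (simp_all add: w_br_zero w_br_add power_sum_der_lin)
qed (simp_all add: w_br_zero w_br_add power_sum_der_lin
      wpar_lin)

lemma wpar_False: "wpar False x = x"
  by (induction x rule: w_plus_induct)
     (simp_all add: wpar_lin wpar_zD)

end

section \<open>From relations between generators to a representation of \<open>w\<^sup>+\<close>\<close>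

text \<open>The relations of \<open>W\<^sup>\<ge>\<close> that the construction of the homomorphism uses, in an algebra in which
  they hold exactly. They are special cases with most coefficients equal to \<open>1\<close>: \<open>T_shift\<close> and
  \<open>T_move\<close> come from moving a coefficient from one factor to the other, \<open>T_cubic\<close> is half of the
  symmetrized cubic relation for the indices \<open>0, 0, a\<close>, and \<open>psi2\<close> stands for \<open>\<psi>\<^sub>2(1)\<close>.\<close>

locale yangian_generators = super_coefficients H par q
  for H :: "bool \<Rightarrow> 'h::rat_algebra set" and par q +
  fixes T :: "nat \<Rightarrow> 'h \<Rightarrow> 'b::rat_algebra" and psi2 :: 'b
  assumes T_linear: "qlinear (T n)"
    and T_shift: "\<xi> \<in> H e \<Longrightarrow> \<mu> \<in> H f \<Longrightarrow>
        scomm (of_bool e) (of_bool f) (T 0 \<xi>) (T n \<mu>) = commutator (T 0 1) (T n (\<xi> * \<mu>))"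
    and T_move: "commutator (T m \<xi>) (T n 1) = commutator (T m 1) (T n \<xi>)"
    and T_quadratic: "commutator (T m 1) (T (n + 3) \<xi>) - 3 * commutator (T (m + 1) 1) (T (n + 2) \<xi>)
        + 3 * commutator (T (m + 2) 1) (T (n + 1) \<xi>) - commutator (T (m + 3) 1) (T n \<xi>) =
        commutator (T m 1) (T (n + 1) (q ^ 2 * \<xi>)) - commutator (T (m + 1) 1) (T n (q ^ 2 * \<xi>))"
    and T_cubic: "commutator (T 0 1) (commutator (T 0 1) (T (Suc a) \<xi>)) +
        commutator (T 0 1) (commutator (T a \<xi>) (T 1 1))
        + commutator (T a \<xi>) (commutator (T 0 1) (T 1 1)) = 0"
    and psi2_T: "commutator psi2 (T n \<xi>) = 2 *\<^sub>Q T (Suc n) \<xi>"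
begin

text \<open>The image of \<open>z\<^sup>k\<^sup>+\<^sup>1 D\<^sup>n \<xi>\<close>. The recursion solves \<open>[T\<^sub>0(1), image of x] = image of [z, x]\<close> for
  \<open>x = z\<^sup>k\<^sup>+\<^sup>1 D\<^sup>n\<^sup>+\<^sup>1 \<xi>\<close>, where \<open>[z, x]\<close> is given by \<open>w_br_z0_zD_Suc\<close>: the image of its leading term is
  expressed by the images of the others.\<close>

fun lie_map_coeff :: "nat \<Rightarrow> nat \<Rightarrow> 'h \<Rightarrow> 'b" where
  "lie_map_coeff 0 n \<xi> = T n \<xi>"
| "lie_map_coeff (Suc k) n \<xi> = (- 1 / of_nat (Suc n)) *\<^sub>Q
    (commutator (T 0 1) (lie_map_coeff k (Suc n) \<xi>) +
      (\<Sum>j<n. of_nat (Suc n choose j) *\<^sub>Q lie_map_coeff (Suc k) j (q ^ (n - j) * \<xi>)))"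

declare lie_map_coeff.simps(2) [simp del]

lemma qlinear_lie_map_coeff: "qlinear (lie_map_coeff k n)"
proof (induction k arbitrary: n)
  case 0
  show ?case using T_linear[of n] by (simp add: qlinear_def)
next
  case (Suc k)
  show ?case
  proof (induction n rule: less_induct)
    case (less n)
    have "qlinear (\<lambda>\<xi>. (- 1 / of_nat (Suc n)) *\<^sub>Q
        (commutator (T 0 1) (lie_map_coeff k (Suc n) \<xi>) +
        (\<Sum>j<n. of_nat (Suc n choose j) *\<^sub>Q lie_map_coeff (Suc k) j (q ^ (n - j) * \<xi>))))"
      by (intro qlinear_scaleQ_comp qlinear_plus qlinear_sum_fun qlinear_comp[OF qlinear_commutator(1) Suc.IH]
          qlinear_comp[OF less.IH qlinear_times]) simp
    also have "(\<lambda>\<xi>. (- 1 / of_nat (Suc n)) *\<^sub>Q (commutator (T 0 1) (lie_map_coeff k (Suc n) \<xi>) +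
        (\<Sum>j<n. of_nat (Suc n choose j) *\<^sub>Q lie_map_coeff (Suc k) j (q ^ (n - j) * \<xi>)))) =
          lie_map_coeff (Suc k) n"
      by (rule ext, rule lie_map_coeff.simps(2)[symmetric])
    finally show ?case .
  qed
qed

definition lie_map :: "'h w_plus \<Rightarrow> 'b" where
  "lie_map = linear_extension (\<lambda>(k, n). lie_map_coeff k n)"

lemma qlinear_lie_map: "qlinear lie_map"
  unfolding lie_map_def by (rule qlinear_linear_extension) (auto simp: qlinear_lie_map_coeff)

lemmas lie_map_lin = qlinear_rules[OF qlinear_lie_map]

lemma lie_map_zD: "lie_map (zD (Suc k) n \<xi>) = lie_map_coeff k n \<xi>"
  by (simp add: lie_map_def zD_def qlinear_0[OF qlinear_lie_map_coeff])

lemma lie_map_zD_1: "lie_map (zD 1 n \<xi>) = T n \<xi>"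
  using lie_map_zD[of 0 n \<xi>] by simp

definition commutes_z0 :: "nat \<Rightarrow> bool" where
  "commutes_z0 k \<longleftrightarrow> (\<forall>P \<xi>. commutator (T 0 1) (lie_map (zP (Suc k) P \<xi>)) =
      lie_map (w_br z0 (zP (Suc k) P \<xi>)))"

definition commutes_z1 :: "nat \<Rightarrow> bool" where
  "commutes_z1 k \<longleftrightarrow> (\<forall>P \<xi>. commutator (T 1 1) (lie_map (zP (Suc k) P \<xi>)) =
      lie_map (w_br z1 (zP (Suc k) P \<xi>)))"

lemma commutes_from_zD:
  assumes "\<And>n \<xi>. commutator a (lie_map_coeff k n \<xi>) = lie_map (w_br z (zD (Suc k) n \<xi>))"
  shows "commutator a (lie_map (zP (Suc k) P \<xi>)) = lie_map (w_br z (zP (Suc k) P \<xi>))"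
  by (rule zP_induct[where V = UNIV])
     (simp_all add: lie_map_lin w_br_zero w_br_add w_br_scaleQ commutator_lin lie_map_zD assms)

text \<open>The recursion for \<open>lie_map_coeff\<close> already ensures compatibility with \<open>ad z\<close> on \<open>z\<^sup>k\<^sup>+\<^sup>1 D\<^sup>n \<xi>\<close>
  for \<open>n > 0\<close>; only the elements \<open>z\<^sup>k\<^sup>+\<^sup>1 \<xi>\<close> with \<open>[z, z\<^sup>k\<^sup>+\<^sup>1 \<xi>] = 0\<close> remain.\<close>

lemma commutes_z0I:
  assumes "\<And>\<xi>. commutator (T 0 1) (lie_map_coeff k 0 \<xi>) = 0"
  shows "commutes_z0 k"
  unfolding commutes_z0_def
proof (intro allI commutes_from_zD)
  fix n \<xi>
  show "commutator (T 0 1) (lie_map_coeff k n \<xi>) = lie_map (w_br z0 (zD (Suc k) n \<xi>))"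
  proof (cases n)
    case 0
    then show ?thesis by (simp add: assms w_br_z0_zD_0 lie_map_lin)
  next
    case (Suc n)
    define S where "S = (\<Sum>j<n. of_nat (Suc n choose j) *\<^sub>Q lie_map_coeff (Suc k) j (q ^ (n - j) * \<xi>))"
    have "of_nat (Suc n) *\<^sub>Q lie_map_coeff (Suc k) n \<xi> = -
        (commutator (T 0 1) (lie_map_coeff k (Suc n) \<xi>) + S)"
      unfolding lie_map_coeff.simps(2)[of k n \<xi>] S_def[symmetric] scaleQ_scaleQ by
          (simp add: scaleQ_neg1 del: of_nat_Suc)
    then show ?thesis
      unfolding Suc w_br_z0_zD_Suc by (simp add: lie_map_lin lie_map_zD S_def del: of_nat_Suc binomial_Suc_Suc)
  qed
qed

lemma T0_T0: "commutator (T 0 1) (T 0 \<xi>) = 0"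
proof (rule twice_eq_0)
  have "commutator (T 0 1) (T 0 \<xi>) = - commutator (T 0 1) (T 0 \<xi>)"
    using T_move[of 0 \<xi> 0] commutator_antisym[of "T 0 1" "T 0 \<xi>"] by simp
  then show "commutator (T 0 1) (T 0 \<xi>) + commutator (T 0 1) (T 0 \<xi>) = 0"
    by (simp only: eq_neg_iff_add_eq_0)
qed

lemma commutes_z0_0: "commutes_z0 0"
  by (rule commutes_z0I) (simp add: T0_T0)

lemma commutes_z0_D: "commutes_z0 k \<Longrightarrow> commutator (T 0 1) (lie_map (zP (Suc k) P \<xi>)) =
    lie_map (w_br z0 (zP (Suc k) P \<xi>))"
  by (simp add: commutes_z0_def)

lemma commutes_z1_D: "commutes_z1 k \<Longrightarrow> commutator (T 1 1) (lie_map (zP (Suc k) P \<xi>)) =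
    lie_map (w_br z1 (zP (Suc k) P \<xi>))"
  by (simp add: commutes_z1_def)

lemma T0_T: "commutator (T 0 1) (T n \<xi>) = lie_map (w_br (zD 1 0 1) (zD 1 n \<xi>))"
  using commutes_z0_D[OF commutes_z0_0, of "Dv ^ n" \<xi>] lie_map_zD_1[of n \<xi>] by (simp add: zP_Dv z0_def)

text \<open>Let \<open>d\<close> be the difference of both sides as a function of \<open>m\<close> for fixed \<open>m + n\<close>. The
  quadratic relation holds on both sides, so by induction on \<open>m + n\<close> its right-hand side
  contributes nothing and the third differences of \<open>d\<close> vanish. Moreover \<open>d\<close> is antisymmetric by
  \<open>T_move\<close> and vanishes for \<open>m = 0\<close> by the construction of the map, hence
  \<open>third_difference_vanishing\<close> applies.\<close>

lemma T_T: "commutator (T m 1) (T n \<xi>) = lie_map (w_br (zD 1 m 1) (zD 1 n \<xi>))"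
proof (induction "m + n" arbitrary: m n \<xi> rule: less_induct)
  case less
  define d where "d i j \<mu> = commutator (T i 1) (T j \<mu>) - lie_map (w_br (zD 1 i 1) (zD 1 j \<mu>))" for
      i j \<mu>
  define N where "N = m + n"
  have d_less: "d i j \<mu> = 0" if "i + j < N" for i j \<mu>
    using less that by (simp add: d_def N_def)
  have d_quad: "d i (j + 3) \<mu> - 3 * d (i + 1) (j + 2) \<mu> + 3 * d (i + 2) (j + 1) \<mu> - d (i + 3) j \<mu> =
      d i (j + 1) (q ^ 2 * \<mu>) - d (i + 1) j (q ^ 2 * \<mu>)" for i j \<mu>
    using T_quadratic[of i j \<mu>] arg_cong[OF w_br_quadratic[of i 1 j \<mu>], of lie_map, unfolded lie_map_lin]
    by (simp add: d_def scaleQ_numeral algebra_simps)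
  have "d m (N - m) \<xi> = 0"
  proof (rule third_difference_vanishing[where c = "\<lambda>i. d i (N - i) \<xi>"])
    fix i assume i: "i + 3 \<le> N"
    obtain j where N: "N = i + 3 + j" using i le_Suc_ex by blast
    have sub: "N - i = j + 3" "N - (i + 1) = j + 2" "N - (i + 2) = j + 1" "N - (i + 3) = j"
      by (simp_all add: N)
    have "d i (j + 1) (q ^ 2 * \<xi>) = 0" "d (i + 1) j (q ^ 2 * \<xi>) = 0"
      by (rule d_less; simp only: N; simp)+
    with d_quad[of i j \<xi>]
    show "d i (N - i) \<xi> - 3 * d (i + 1) (N - (i + 1)) \<xi> + 3 * d (i + 2) (N - (i + 2)) \<xi> -
        d (i + 3) (N - (i + 3)) \<xi> = 0"
      by (simp only: sub diff_self)
  next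
    fix i assume "i \<le> N"
    then have "N - (N - i) = i" by simp
    moreover have "d (N - i) i \<xi> = - d i (N - i) \<xi>"
      unfolding d_def w_br_degree_one_antisym[of "N - i" i] lie_map_lin
      using T_move[of i \<xi> "N - i"] commutator_antisym[of "T (N - i) 1" "T i \<xi>"] by simp
    ultimately show "d (N - i) (N - (N - i)) \<xi> = - d i (N - i) \<xi>" by simp
  next
    show "d 0 (N - 0) \<xi> = 0" by (simp add: d_def T0_T)
  qed (simp add: N_def)
  then show ?case by (simp add: d_def N_def)
qed

lemma commutes_z1_0: "commutes_z1 0"
  unfolding commutes_z1_def
  by (intro allI commutes_from_zD) (use T_T[of 1] in \<open>simp add: z1_def\<close>)

lemma T_cubic_nested: "commutator (T 1 1) (commutator (T 0 1) (T a \<xi>)) =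
    2 *\<^sub>Q commutator (T 0 1) (commutator (T 1 1) (T a \<xi>)) -
        commutator (T 0 1) (commutator (T 0 1) (T (Suc a) \<xi>))"
proof -
  let ?X = "commutator (T 0 1) (commutator (T 1 1) (T a \<xi>))" and ?Y =
      "commutator (T 1 1) (commutator (T 0 1) (T a \<xi>))"
  have "commutator (T a \<xi>) (commutator (T 0 1) (T 1 1)) = ?Y - ?X"
      "commutator (T 0 1) (commutator (T a \<xi>) (T 1 1)) = - ?X"
    by (simp_all add: commutator_def algebra_simps)
  then have "commutator (T 0 1) (commutator (T 0 1) (T (Suc a) \<xi>)) + - ?X + (?Y - ?X) = 0"
    using T_cubic[of a \<xi>] by simp
  then show ?thesis by (simp add: scaleQ_numeral algebra_simps mult_2)
qed

text \<open>The cubic relation for \<open>a = 0\<close> says three times this, by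
  \<open>[T\<^sub>1(1), T\<^sub>0(\<xi>)] = - [T\<^sub>0(1), T\<^sub>1(\<xi>)]\<close>. For \<open>\<xi> = 1\<close> it is the Serre relation.\<close>

lemma T0_T0_T1: "commutator (T 0 1) (commutator (T 0 1) (T 1 \<xi>)) = 0"
proof -
  let ?X = "commutator (T 0 1) (commutator (T 0 1) (T 1 \<xi>))"
  have "commutator (T 1 1) (T 0 \<xi>) = - commutator (T 0 1) (T 1 \<xi>)"
    using T_move[of 0 \<xi> 1] commutator_antisym[of "T 1 1" "T 0 \<xi>"] by simp
  then have "0 = 2 * - ?X - ?X"
    using T_cubic_nested[of 0 \<xi>] T0_T0[of \<xi>] by (simp add: commutator_lin scaleQ_numeral)
  moreover have "3 *\<^sub>Q ?X = (1 + 1 + 1) *\<^sub>Q ?X" by simp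
  ultimately have "3 *\<^sub>Q ?X = 0"
    by (simp only: scaleQ_add_left scaleQ_one) (simp add: algebra_simps mult_2)
  then show ?thesis by (subst (asm) scaleQ_eq_0) auto
qed

lemma commutes_z0_1: "commutes_z0 (Suc 0)"
  by (rule commutes_z0I) (simp add: lie_map_coeff.simps(2)[of 0 0] commutator_lin T0_T0_T1[simplified])

text \<open>Degree two is the image of degree one under \<open>ad z\<close>, and there the cubic relation expresses
  \<open>ad (zD) \<circ> ad z\<close> by operations that are already known to be compatible.\<close>

lemma commutes_z1_1: "commutes_z1 (Suc 0)"
  unfolding commutes_z1_def
proof (intro allI)
  fix Q \<xi>
  have E0: "lie_map (w_br z0 (zD 1 n \<xi>)) = commutator (T 0 1) (T n \<xi>)"
      "lie_map (w_br z1 (zD 1 n \<xi>)) = commutator (T 1 1) (T n \<xi>)" for n \<xi>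
    using T_T[of 0 n \<xi>] T_T[of 1 n \<xi>] by (simp_all add: z0_def z1_def)
  have two: "w_br z (zD 1 n \<xi>) = zP (Suc (Suc 0)) (poly_bracket 1 1 P (Dv ^ n)) \<xi>" if
      "z = zP 1 P 1" for z P n \<xi>
    using w_bracket_zP[of 1 1 P 1 "Dv ^ n" \<xi>] that by (simp add: zP_Dv)
  have z: "z0 = zP 1 (Dv ^ 0) 1" "z1 = zP 1 (Dv ^ 1) 1" by (simp_all only: z0_def z1_def zP_Dv)
  have E1: "lie_map (w_br z0 (w_br z0 (zD 1 n \<xi>))) = commutator (T 0 1) (lie_map (w_br z0 (zD 1 n \<xi>)))"
    "lie_map (w_br z0 (w_br z1 (zD 1 n \<xi>))) = commutator (T 0 1) (lie_map (w_br z1 (zD 1 n \<xi>)))" for n \<xi>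
    unfolding two[OF z(1)] two[OF z(2)] commutes_z0_D[OF commutes_z0_1] by (rule refl)+
  have base: "commutator (T 1 1) (commutator (T 0 1) (T n \<xi>)) = lie_map (w_br z1 (w_br z0 (zD 1 n \<xi>)))"
      for n \<xi>
    unfolding w_br_cubic lie_map_lin E1 E0 T_cubic_nested ..
  have *: "commutator (T 1 1) (commutator (T 0 1) (lie_map (zP (Suc 0) P \<xi>))) =
      lie_map (w_br z1 (w_br z0 (zP (Suc 0) P \<xi>)))" for P
    by (rule zP_induct[where V = UNIV])
       (simp_all add: lie_map_lin w_br_zero w_br_add w_br_scaleQ commutator_lin base[simplified]
           lie_map_zD_1[simplified])
  obtain P where P: "poly_bracket 1 (Suc 0) 1 P = Q" using poly_bracket_one_surj by blast
  have w: "w_br z0 (zP (Suc 0) P \<xi>) = zP (Suc (Suc 0)) Q \<xi>"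
    unfolding w_br_z0_zP P ..
  show "commutator (T 1 1) (lie_map (zP (Suc (Suc 0)) Q \<xi>)) = lie_map (w_br z1 (zP (Suc (Suc 0)) Q \<xi>))"
    by (rule *[of P, unfolded commutes_z0_D[OF commutes_z0_0] w])
qed

text \<open>The Serre relation writes \<open>ad (zD) (ad z)\<^sup>2\<close> with \<open>ad z\<close> on the left. For \<open>ad zD\<close> in the new
  degree it suffices that this degree is the image of \<open>(ad z)\<^sup>2\<close>. For \<open>ad z\<close> the Serre relation is
  applied to \<open>z\<^sup>k\<^sup>+\<^sup>1 D \<xi>\<close>, on which \<open>(ad z)\<^sup>2\<close> vanishes: what is left is the commutator of \<open>T\<^sub>0(1)\<close>
  with a nonzero multiple of the image of \<open>z\<^sup>k\<^sup>+\<^sup>3 \<xi>\<close>, by \<open>w_br_lowest\<close>.\<close>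

lemma commutes_step:
  assumes "commutes_z0 k" "commutes_z1 k" "commutes_z0 (Suc k)" "commutes_z1 (Suc k)"
  shows "commutes_z0 (Suc (Suc k))" "commutes_z1 (Suc (Suc k))"
proof -
  have serre: "commutator (T 1 1) (commutator (T 0 1) (commutator (T 0 1) v)) =
      2 *\<^sub>Q commutator (T 0 1) (commutator (T 1 1) (commutator (T 0 1) v)) -
          commutator (T 0 1) (commutator (T 0 1) (commutator (T 1 1) v))" for v
    unfolding scaleQ_numeral by (rule commutator_serre[OF T0_T0_T1])
  note simps = commutes_z0_D[OF assms(1)] commutes_z1_D[OF assms(2)] commutes_z0_D[OF assms(3)]
    commutes_z1_D[OF assms(4)] w_br_z0_zP w_br_z1_zP
  show z0: "commutes_z0 (Suc (Suc k))"
  proof (rule commutes_z0I)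
    fix \<xi>
    let ?v = "zP (Suc k) (Dv ^ 1) \<xi>"
    have v: "?v = zD (Suc k) 1 \<xi>" by (rule zP_Dv)
    have "commutator (T 1 1) (lie_map (w_br z0 (w_br z0 ?v))) =
        2 *\<^sub>Q commutator (T 0 1) (lie_map (w_br z1 (w_br z0 ?v))) -
          commutator (T 0 1) (lie_map (w_br z0 (w_br z1 ?v)))"
      using serre[of "lie_map ?v"] by (simp only: simps)
    then have "0 = 2 *\<^sub>Q commutator (T 0 1) (lie_map (w_br z1 (w_br z0 ?v))) -
        commutator (T 0 1) (lie_map (w_br z0 (w_br z1 ?v)))"
      unfolding v w_br_lowest(1) lie_map_lin commutator_lin .
    also have "\<dots> = commutator (T 0 1) (lie_map (2 *\<^sub>Q w_br z1 (w_br z0 ?v) - w_br z0 (w_br z1 ?v)))"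
      by (simp only: lie_map_lin commutator_lin)
    also have "\<dots> = (- of_nat (k + 4)) *\<^sub>Q commutator (T 0 1) (lie_map_coeff (Suc (Suc k)) 0 \<xi>)"
      unfolding v w_br_lowest(2) lie_map_lin lie_map_zD commutator_lin ..
    finally have "(- of_nat (k + 4)) *\<^sub>Q commutator (T 0 1) (lie_map_coeff (Suc (Suc k)) 0 \<xi>) = 0" by simp
    moreover have "- of_nat (k + 4) \<noteq> (0 :: rat)"
      by (simp only: neg_equal_0_iff_equal of_nat_eq_0_iff)
    ultimately show "commutator (T 0 1) (lie_map_coeff (Suc (Suc k)) 0 \<xi>) = 0"
      using scaleQ_eq_0 by blast
  qed
  show "commutes_z1 (Suc (Suc k))"
    unfolding commutes_z1_def
  proof (intro allI)
    fix Q \<xi>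
    \<comment> \<open>the whole new degree is the image of \<open>(ad z)\<^sup>2\<close>\<close>
    obtain P where P: "poly_bracket 1 (Suc (Suc k)) 1 (poly_bracket 1 (Suc k) 1 P) =
        Q" using poly_bracket_one_surj by metis
    let ?v = "zP (Suc k) P \<xi>"
    have Q: "zP (Suc (Suc (Suc k))) Q \<xi> = w_br z0 (w_br z0 ?v)" unfolding w_br_z0_zP P ..
    have "lie_map (w_br z1 (w_br z0 (w_br z0 ?v))) = 2 *\<^sub>Q lie_map (w_br z0 (w_br z1 (w_br z0 ?v))) -
        lie_map (w_br z0 (w_br z0 (w_br z1 ?v)))"
      by (simp only: w_br_serre lie_map_lin)
    also have "\<dots> = 2 *\<^sub>Q commutator (T 0 1) (commutator (T 1 1) (commutator (T 0 1) (lie_map ?v))) -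
        commutator (T 0 1) (commutator (T 0 1) (commutator (T 1 1) (lie_map ?v)))"
      by (simp only: commutes_z0_D[OF z0] simps)
    also have "\<dots> = commutator (T 1 1) (commutator (T 0 1) (commutator (T 0 1) (lie_map ?v)))"
      by (rule serre[symmetric])
    also have "\<dots> = commutator (T 1 1) (lie_map (w_br z0 (w_br z0 ?v)))"
      by (simp only: simps)
    finally show "commutator (T 1 1) (lie_map (zP (Suc (Suc (Suc k))) Q \<xi>)) =
        lie_map (w_br z1 (zP (Suc (Suc (Suc k))) Q \<xi>))"
      unfolding Q by simp
  qed
qed

lemma commutes_z0_z1: "commutes_z0 k \<and> commutes_z1 k \<and> commutes_z0 (Suc k) \<and> commutes_z1 (Suc k)"
  by (induction k) (auto intro: commutes_step commutes_z0_0 commutes_z1_0 commutes_z0_1 commutes_z1_1)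

lemma lie_map_z0: "lie_map (w_br z0 x) = commutator (T 0 1) (lie_map x)"
  and lie_map_z1: "lie_map (w_br z1 x) = commutator (T 1 1) (lie_map x)"
proof -
  have "lie_map (w_br z0 (zD (Suc k) n \<xi>)) = commutator (T 0 1) (lie_map (zD (Suc k) n \<xi>))"
    "lie_map (w_br z1 (zD (Suc k) n \<xi>)) = commutator (T 1 1) (lie_map (zD (Suc k) n \<xi>))" for k n \<xi>
    using commutes_z0_D[of k "Dv ^ n" \<xi>] commutes_z1_D[of k "Dv ^ n" \<xi>] commutes_z0_z1[of k]
    by (simp_all add: zP_Dv)
  then show "lie_map (w_br z0 x) = commutator (T 0 1) (lie_map x)"
      "lie_map (w_br z1 x) = commutator (T 1 1) (lie_map x)"
    by (induction x rule: w_plus_induct) (simp_all add: lie_map_lin w_br_zero w_br_add commutator_lin)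
qed

text \<open>The derivation sends \<open>z\<close> to \<open>2 zD\<close>, and \<open>ad \<psi>\<^sub>2(1)\<close> sends \<open>T\<^sub>0(1)\<close> to \<open>2 T\<^sub>1(1)\<close>; so the
  compatibility with \<open>ad z\<close> and \<open>ad zD\<close> is just what the induction over degrees needs.\<close>

lemma lie_map_power_sum_der: "lie_map (power_sum_der 2 1 x) = commutator psi2 (lie_map x)"
proof (rule w_plus_generated[OF q_subspace_UNIV])
  show "x \<in> w_over UNIV" by (simp add: w_over_def)
  fix n \<xi>
  have "power_sum_der 2 1 (zD 1 n \<xi>) = 2 *\<^sub>Q zD 1 (Suc n) \<xi>"
    using power_sum_der_degree_one[of 2 1 n \<xi>] by simp
  then show "lie_map (power_sum_der 2 1 (zD 1 n \<xi>)) = commutator psi2 (lie_map (zD 1 n \<xi>))"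
    by (simp only: lie_map_lin lie_map_zD_1 psi2_T)
next
  fix x assume IH: "lie_map (power_sum_der 2 1 x) = commutator psi2 (lie_map x)"
  have z: "power_sum_der 2 1 z0 = 2 *\<^sub>Q z1"
    unfolding z0_def z1_def using power_sum_der_degree_one[of 2 1 0 1] by simp
  have "lie_map (power_sum_der 2 1 (w_br z0 x)) = 2 *\<^sub>Q commutator (T 1 1) (lie_map x) +
      commutator (T 0 1) (commutator psi2 (lie_map x))"
    unfolding power_sum_der_derivation[OF one_H] wpar_False z w_br_scaleQ lie_map_lin lie_map_z0 lie_map_z1 IH ..
  also have "\<dots> = commutator (commutator psi2 (T 0 1)) (lie_map x) +
      commutator (T 0 1) (commutator psi2 (lie_map x))"
    unfolding psi2_T commutator_lin by simp
  also have "\<dots> = commutator psi2 (lie_map (w_br z0 x))"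
    unfolding lie_map_z0 by (rule commutator_jacobi[symmetric])
  finally show "lie_map (power_sum_der 2 1 (w_br z0 x)) = commutator psi2 (lie_map (w_br z0 x))" .
qed (simp_all add: lie_map_lin power_sum_der_lin commutator_lin)

text \<open>For \<open>T\<^sub>0(\<xi>)\<close> the second argument is generated by \<open>ad z\<close>, with which \<open>z \<xi>\<close> and \<open>T\<^sub>0(\<xi>)\<close>
  commute. Then \<open>\<psi>\<^sub>2(1)\<close> raises the index, since \<open>2 T\<^sub>a\<^sub>+\<^sub>1(\<xi>) = [\<psi>\<^sub>2(1), T\<^sub>a(\<xi>)]\<close>.\<close>

lemma lie_map_bracket_degree_one:
  assumes \<xi>: "\<xi> \<in> H e" and y: "y \<in> w_over (H f)"
  shows "scomm (of_bool e) (of_bool f) (T a \<xi>) (lie_map y) = lie_map (w_br (zD 1 a \<xi>) y)"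
  using y
proof (induction a arbitrary: y)
  case 0
  note q_subspace_H[of f] 0
  then show ?case
  proof (induction y rule: w_plus_generated)
    case (degree_one n \<mu>)
    have "w_br (zD 1 0 \<xi>) (zD 1 n \<mu>) = w_br (zD 1 0 1) (zD 1 n (\<xi> * \<mu>))"
      by (simp only: w_br_degree_one mult_1)
    then show ?case by (simp only: lie_map_zD_1 T_shift[OF \<xi> degree_one] T0_T)
  next
    case (ad_z y)
    have "w_br z0 (zD 1 0 \<xi>) = 0" using w_br_z0_zD_0[of 0 \<xi>] by simp
    then have "w_br (zD 1 0 \<xi>) (w_br z0 y) = w_br z0 (w_br (zD 1 0 \<xi>) y)"
      using w_br_jacobi_unit[of 1 0 "zD 1 0 \<xi>" y] by (simp add: z0_def w_br_zero)
    then show ?case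
      by (simp only: lie_map_z0 scomm_commutator(2) T0_T0 scomm_lin diff_zero ad_z)
  qed (simp_all add: lie_map_lin w_br_zero w_br_add w_br_scaleQ scomm_lin)
next
  case (Suc a)
  have d: "power_sum_der 2 1 y \<in> w_over (H f)" using power_sum_der_parity[OF one_H Suc.prems, of 2] by simp
  have s: "power_sum_der 2 1 (zD 1 a \<xi>) = 2 *\<^sub>Q zD 1 (Suc a) \<xi>"
    using power_sum_der_degree_one[of 2 1 a \<xi>] by simp
  have "2 *\<^sub>Q scomm (of_bool e) (of_bool f) (T (Suc a) \<xi>) (lie_map y) =
      commutator psi2 (scomm (of_bool e) (of_bool f) (T a \<xi>) (lie_map y)) -
          scomm (of_bool e) (of_bool f) (T a \<xi>) (lie_map (power_sum_der 2 1 y))"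
    unfolding scomm_lin[symmetric] psi2_T[symmetric] scomm_commutator(1) lie_map_power_sum_der ..
  also have "\<dots> = lie_map (power_sum_der 2 1 (w_br (zD 1 a \<xi>) y) -
      w_br (zD 1 a \<xi>) (power_sum_der 2 1 y))"
    unfolding lie_map_lin lie_map_power_sum_der[of "w_br (zD 1 a \<xi>) y"] Suc.IH[OF Suc.prems] Suc.IH[OF d] ..
  also have "power_sum_der 2 1 (w_br (zD 1 a \<xi>) y) - w_br (zD 1 a \<xi>) (power_sum_der 2 1 y) =
      2 *\<^sub>Q w_br (zD 1 (Suc a) \<xi>) y"
    unfolding power_sum_der_derivation[OF one_H] wpar_False s w_br_scaleQ by simp
  finally show ?case
    by (simp add: lie_map_lin scaleQ_cancel)
qed

text \<open>Induction on the first argument: the bracket with \<open>[z, x]\<close> is determined by those with \<open>x\<close>,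
  by the Jacobi identity.\<close>

theorem lie_map_bracket:
  assumes x: "x \<in> w_over (H e)" and y: "y \<in> w_over (H f)"
  shows "scomm (of_bool e) (of_bool f) (lie_map x) (lie_map y) = lie_map (w_br x y)"
  using q_subspace_H[of e] x y
proof (induction x arbitrary: y rule: w_plus_generated)
  case (degree_one n \<xi>)
  then show ?case by (simp only: lie_map_zD_1 lie_map_bracket_degree_one)
next
  case (ad_z x)
  have 1: "w_br (w_br z0 x) y = w_br z0 (w_br x y) - w_br x (w_br z0 y)"
    using w_br_jacobi_unit[of 1 0 x y] by (simp add: z0_def)
  have 2: "scomm (of_bool e) (of_bool f) (lie_map (w_br z0 x)) (lie_map y) =
      commutator (T 0 1) (scomm (of_bool e) (of_bool f) (lie_map x) (lie_map y)) -
      scomm (of_bool e) (of_bool f) (lie_map x) (lie_map (w_br z0 y))"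
    unfolding lie_map_z0 by (rule scomm_commutator(1))
  show ?case
    unfolding 2 ad_z.IH[OF ad_z.prems] ad_z.IH[OF w_br_z0_w_over[OF q_subspace_H ad_z.prems]] 1 lie_map_lin
      lie_map_z0[of "w_br x y"] ..
qed (simp_all add: lie_map_lin w_br_zero w_br_add w_br_scaleQ scomm_lin)

end

section \<open>Free algebras, ideals and quotients\<close>

definition monomial :: "'g list \<Rightarrow> 'g free_algebra" where
  "monomial gs = Poly_Mapping.single (Word gs) 1"

lemma monomial_Nil [simp]: "monomial [] = 1"
  by (simp add: monomial_def flip: zero_word_def)

lemma gen_times_single: "gen g * Poly_Mapping.single w r = Poly_Mapping.single (Word (g # letters w)) r"
  by (simp add: gen_def mult_single plus_word_def)

lemma monomial_Cons: "monomial (g # gs) = gen g * monomial gs"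
  by (simp add: monomial_def gen_times_single)

lemma single_eq_monomial: "Poly_Mapping.single w r = r *\<^sub>Q monomial (letters w)"
  by (simp add: monomial_def scaleQ_single scaleQ_rat_def)

lemma free_algebra_induct [case_names zero add scaleQ one gen]:
  assumes "S 0" "\<And>x y. S x \<Longrightarrow> S y \<Longrightarrow> S (x + y)"
      "\<And>r x. S x \<Longrightarrow> S (r *\<^sub>Q x)"
    "S 1" "\<And>g x. S x \<Longrightarrow> S (gen g * x)"
  shows "S (x :: 'g free_algebra)"
proof (induction x rule: finite_support_induct)
  case (single w r)
  have "S (monomial gs)" for gs by (induction gs) (simp_all add: monomial_Cons assms(4,5))
  then show ?case by (simp add: single_eq_monomial assms(3))
qed (use assms in auto)

definition word_linear :: "('g list \<Rightarrow> 'b::rat_algebra) \<Rightarrow> 'g free_algebra \<Rightarrow>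
    'b" where
  "word_linear \<phi> = linear_extension (\<lambda>w r. r *\<^sub>Q \<phi> (letters w))"

lemma qlinear_word_linear: "qlinear (word_linear \<phi>)"
  unfolding word_linear_def
  by (rule qlinear_linear_extension)
     (auto intro!: qlinearI simp: scaleQ_add_left scaleQ_scaleQ scaleQ_rat_def)

lemma word_linear_monomial: "word_linear \<phi> (monomial gs) = \<phi> gs"
  by (simp add: word_linear_def monomial_def scaleQ_one)

lemma word_linear_one: "word_linear \<phi> 1 = \<phi> []"
  using word_linear_monomial[of \<phi> "[]"] by simp

text \<open>A function on words that is defined by recursion on the first letter extends to a linear map
  with the same recursion. Substitutions, superderivations and actions are all obtained in this
  way.\<close>

lemma word_linear_gen_times:
  assumes "\<And>gs. \<phi> (g # gs) = \<psi> (\<phi> gs)" "qlinear \<psi>"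
  shows "word_linear \<phi> (gen g * x) = \<psi> (word_linear \<phi> x)"
proof (induction x rule: finite_support_induct)
  case (single w r)
  then show ?case
    by (simp add: single_eq_monomial mult_scaleQ_right qlinear_scaleQ[OF qlinear_word_linear]
        word_linear_monomial assms
        qlinear_scaleQ[OF assms(2)] flip: monomial_Cons)
qed (simp_all add: qlinear_0[OF qlinear_word_linear] qlinear_0[OF assms(2)] distrib_left
    qlinear_add[OF qlinear_word_linear] qlinear_add[OF assms(2)])

definition subst :: "('g \<Rightarrow> 'b::rat_algebra) \<Rightarrow> 'g free_algebra \<Rightarrow> 'b" where
  "subst f = word_linear (\<lambda>gs. prod_list (map f gs))"

lemma qlinear_subst: "qlinear (subst f)"
  by (simp add: subst_def qlinear_word_linear)

lemma subst_one [simp]: "subst f 1 = 1"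
  by (simp add: subst_def word_linear_one)

lemma subst_gen_times: "subst f (gen g * x) = f g * subst f x"
  unfolding subst_def by (rule word_linear_gen_times) (simp_all add: qlinear_times)

lemma subst_gen [simp]: "subst f (gen g) = f g"
  using subst_gen_times[of f g 1] by simp

lemma subst_mult: "subst f (x * y) = subst f x * subst f y"
  by (induction x rule: free_algebra_induct)
     (simp_all add: qlinear_0[OF qlinear_subst] qlinear_add[OF qlinear_subst] distrib_right
       qlinear_scaleQ[OF qlinear_subst] mult_scaleQ_left subst_gen_times mult.assoc)

lemmas subst_lin = qlinear_rules[OF qlinear_subst]

definition two_sided_ideal :: "'a::ring_1 set \<Rightarrow> bool" where
  "two_sided_ideal I \<longleftrightarrow> 0 \<in> I \<and> (\<forall>x\<in>I. \<forall>y\<in>I. x +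
      y \<in> I) \<and> (\<forall>x\<in>I. \<forall>a. a * x \<in> I \<and> x * a \<in> I)"

lemma two_sided_ideal_closed:
  assumes "two_sided_ideal I"
  shows "0 \<in> I" "x \<in> I \<Longrightarrow> y \<in> I \<Longrightarrow> x + y \<in> I"
      "x \<in> I \<Longrightarrow> a * x \<in> I" "x \<in> I \<Longrightarrow> x * a \<in> I"
  using assms by (auto simp: two_sided_ideal_def)

lemma two_sided_ideal_minus: "two_sided_ideal I \<Longrightarrow> x \<in> I \<Longrightarrow> - x \<in> I"
  using two_sided_ideal_closed(3)[of I x "-1"] by simp

lemma two_sided_ideal_diff: "two_sided_ideal I \<Longrightarrow> x \<in> I \<Longrightarrow>
    y \<in> I \<Longrightarrow> x - y \<in> I"
  using two_sided_ideal_closed(2)[of I x "- y"] two_sided_ideal_minus[of I y] by simp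

lemmas two_sided_idealD = two_sided_ideal_closed two_sided_ideal_minus two_sided_ideal_diff

lemma two_sided_ideal_scaleQ: "two_sided_ideal I \<Longrightarrow> x \<in> I \<Longrightarrow> r *\<^sub>Q x \<in> I"
  using two_sided_idealD(3)[of I x "r *\<^sub>Q 1"] by (simp add: mult_scaleQ_left)

lemma ring_free_ring: "ring (free_ring :: 'g free_algebra ring)"
proof (rule ringI)
  let ?R = "free_ring :: 'g free_algebra ring"
  show "abelian_group ?R"
  proof (rule abelian_groupI)
    fix x assume "x \<in> carrier ?R"
    show "\<exists>y\<in>carrier ?R. y \<oplus>\<^bsub>?R\<^esub> x = \<zero>\<^bsub>?R\<^esub>"
      by (rule bexI[of _ "- x"]) (simp_all add: free_ring_def)
  qed (simp_all add: free_ring_def algebra_simps)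
  show "Group.monoid ?R"
    by (rule monoidI) (simp_all add: free_ring_def mult.assoc)
qed (simp_all add: free_ring_def algebra_simps)

lemma carrier_free_ring [simp]: "carrier free_ring = UNIV"
  by (simp add: free_ring_def)

lemma a_inv_free_ring: "a_inv free_ring x = - x"
proof -
  interpret ring free_ring by (rule ring_free_ring)
  have "- x \<oplus>\<^bsub>free_ring\<^esub> x = \<zero>\<^bsub>free_ring\<^esub>" by (simp add: free_ring_def)
  then show ?thesis by (intro minus_equality) auto
qed

lemma ideal_free_ring_iff: "ideal I free_ring \<longleftrightarrow> two_sided_ideal I"
proof
  assume "ideal I free_ring"
  then interpret ideal I free_ring .
  show "two_sided_ideal I"
    using additive_subgroup.zero_closed[OF is_additive_subgroup]
      additive_subgroup.a_closed[OF is_additive_subgroup] I_l_closed I_r_closed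
    by (auto simp: two_sided_ideal_def free_ring_def)
next
  assume I: "two_sided_ideal I"
  show "ideal I free_ring"
  proof (rule idealI[OF ring_free_ring])
    show "subgroup I (add_monoid free_ring)"
    proof (rule group.subgroupI)
      show "group (add_monoid (free_ring :: 'a free_algebra ring))"
        by (rule abelian_group.a_group[OF ring.axioms(1)[OF ring_free_ring]])
      fix a assume "a \<in> I"
      then show "inv\<^bsub>add_monoid free_ring\<^esub> a \<in> I"
        using two_sided_idealD(5)[OF I] a_inv_free_ring[of a] by (simp add: a_inv_def)
    qed (use two_sided_idealD[OF I] in \<open>auto simp: free_ring_def\<close>)
  qed (use two_sided_idealD[OF I] in \<open>auto simp: free_ring_def\<close>)
qed

abbreviation ideal_of :: "'g free_algebra set \<Rightarrow> 'g free_algebra set" where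
  "ideal_of R \<equiv> genideal free_ring R"

lemma two_sided_ideal_of: "two_sided_ideal (ideal_of R)"
  using ring.genideal_ideal[OF ring_free_ring, of R] by (simp add: ideal_free_ring_iff)

lemma relator_in_ideal: "x \<in> R \<Longrightarrow> x \<in> ideal_of R"
  using ring.genideal_self[OF ring_free_ring, of R] by auto

lemma ideal_of_least: "two_sided_ideal K \<Longrightarrow> R \<subseteq> K \<Longrightarrow> ideal_of R \<subseteq> K"
  using ring.genideal_minimal[OF ring_free_ring, of K R] by (simp add: ideal_free_ring_iff)

abbreviation coset :: "'g free_algebra set \<Rightarrow> 'g free_algebra \<Rightarrow> 'g free_algebra set" where
  "coset I x \<equiv> a_r_coset free_ring I x"

lemma coset_eq: "coset I x = {y. y - x \<in> I}"
  by (auto simp: a_r_coset_def r_coset_def free_ring_def image_iff)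

lemma coset_eq_iff:
  assumes "two_sided_ideal I"
  shows "coset I x = coset I y \<longleftrightarrow> x - y \<in> I"
proof
  assume "coset I x = coset I y"
  moreover have "x \<in> coset I x" using two_sided_idealD(1)[OF assms] by (simp add: coset_eq)
  ultimately show "x - y \<in> I" by (simp add: coset_eq)
next
  assume *: "x - y \<in> I"
  have "z - x \<in> I \<longleftrightarrow> z - y \<in> I" for z
    using two_sided_idealD(2)[OF assms _ *, of "z - x"] two_sided_idealD(6)[OF assms _ *, of "z - y"]
    by auto
  then show "coset I x = coset I y" by (simp add: coset_eq)
qed

text \<open>The algebra of linear endomorphisms as an instance of \<open>rat_algebra\<close>, so that results on type
  class algebras apply to quotients of free algebras, whatever the ideal.\<close>

typedef (overloaded) 'v endo = "{f :: 'v::rat_algebra \<Rightarrow> 'v. qlinear f}"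
  morphisms apply_endo Abs_endo
  by (rule exI[of _ "\<lambda>x. x"]) (simp add: qlinear_def)

setup_lifting type_definition_endo

instantiation endo :: (rat_algebra) rat_algebra
begin

lift_definition zero_endo :: "'a endo" is "\<lambda>_. 0" by (simp add: qlinear_def)
lift_definition one_endo :: "'a endo" is "\<lambda>x. x" by (simp add: qlinear_def)
lift_definition plus_endo :: "'a endo \<Rightarrow> 'a endo \<Rightarrow> 'a endo" is "\<lambda>f g x. f x + g x"
  by (rule qlinear_plus)
lift_definition uminus_endo :: "'a endo \<Rightarrow> 'a endo" is "\<lambda>f x. - f x"
  by (simp add: qlinear_def scaleQ_minus_right)
lift_definition minus_endo :: "'a endo \<Rightarrow> 'a endo \<Rightarrow> 'a endo" is "\<lambda>f g x. f x - g x"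
  by (simp add: qlinear_def scaleQ_diff_right)
lift_definition times_endo :: "'a endo \<Rightarrow> 'a endo \<Rightarrow> 'a endo" is "\<lambda>f g x. f (g x)"
  by (rule qlinear_comp)
lift_definition scaleQ_endo :: "rat \<Rightarrow> 'a endo \<Rightarrow> 'a endo" is "\<lambda>r f x. r *\<^sub>Q f x"
  by (rule qlinear_scaleQ_comp)

instance
proof
  fix a b c :: "'a endo" and r s :: rat
  show "a + b + c = a + (b + c)" "a + b = b + a" "0 + a = a" "- a + a = 0" "a - b = a + - b"
    "a * b * c = a * (b * c)" "1 * a = a" "a * 1 = a" "(a + b) * c = a * c + b * c"
    "r *\<^sub>Q (a + b) = r *\<^sub>Q a + r *\<^sub>Q b" "(r + s) *\<^sub>Q a = r *\<^sub>Q a + s *\<^sub>Q a"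
    "r *\<^sub>Q s *\<^sub>Q a = (r * s) *\<^sub>Q a" "1 *\<^sub>Q a = a" "(r *\<^sub>Q a) * b = r *\<^sub>Q (a * b)"
    by (transfer; simp add: algebra_simps scaleQ_add_right scaleQ_add_left scaleQ_scaleQ scaleQ_one)+
  show "a * (b + c) = a * b + a * c"
    by transfer (simp add: qlinear_add)
  show "a * (r *\<^sub>Q b) = r *\<^sub>Q (a * b)"
    by transfer (simp add: qlinear_scaleQ)
  show "(0 :: 'a endo) \<noteq> 1"
    by transfer (metis zero_neq_one)
qed

end

text \<open>The projection onto a complement of \<open>I\<close>, from a basis of \<open>I\<close> that is extended to the whole
  space.\<close>

lemma complement_projection:
  fixes I :: "'a::rat_algebra set"
  assumes "two_sided_ideal I"
  obtains \<pi> :: "'a \<Rightarrow> 'a" where "qlinear \<pi>" "\<And>x. \<pi> x - x \<in> I"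
      "\<And>x. x \<in> I \<Longrightarrow> \<pi> x = 0"
proof -
  interpret V: vector_space "scaleQ :: rat \<Rightarrow> 'a \<Rightarrow> 'a"
    by unfold_locales (simp_all add: scaleQ_add_right scaleQ_add_left scaleQ_scaleQ scaleQ_one)
  interpret VV: vector_space_pair "scaleQ :: rat \<Rightarrow> 'a \<Rightarrow> 'a"
      "scaleQ :: rat \<Rightarrow> 'a \<Rightarrow> 'a"
    by unfold_locales
  have sub: "V.subspace I"
    using two_sided_idealD[OF assms] two_sided_ideal_scaleQ[OF assms] by (auto simp: V.subspace_def)
  obtain B where B: "B \<subseteq> I" "V.independent B" "I \<subseteq> V.span B"
    using V.maximal_independent_subset[of I] by blast
  obtain \<pi> where \<pi>: "Vector_Spaces.linear scaleQ scaleQ \<pi>"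
    "\<And>x. x \<in> V.extend_basis B \<Longrightarrow> \<pi> x = (if x \<in> B then 0 else x)"
    using VV.linear_independent_extend[OF V.independent_extend_basis[OF B(2)],
        of "\<lambda>x. if x \<in> B then 0 else x"] by blast
  have q: "qlinear \<pi>"
    by (rule qlinearI) (simp_all add: VV.linear_add[OF \<pi>(1)] VV.linear_scale[OF \<pi>(1)])
  show ?thesis
  proof (rule that[OF q])
    fix x
    have "x \<in> V.span (V.extend_basis B)" using V.span_extend_basis[OF B(2)] by auto
    then show "\<pi> x - x \<in> I"
    proof (induction x rule: V.span_induct_alt)
      case base
      show ?case using two_sided_idealD(1)[OF assms] by (simp add: qlinear_0[OF q])
    next
      case (step c x y)
      have "\<pi> x - x \<in> I"
        using \<pi>(2)[OF step(1)] B(1) two_sided_idealD[OF assms] by (cases "x \<in> B") auto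
      then have "c *\<^sub>Q (\<pi> x - x) + (\<pi> y - y) \<in> I"
        using two_sided_idealD(2)[OF assms] two_sided_ideal_scaleQ[OF assms] step by blast
      then show ?case
        by (simp add: qlinear_add[OF q] qlinear_scaleQ[OF q] scaleQ_diff_right algebra_simps)
    qed
  next
    fix x assume "x \<in> I"
    then have "x \<in> V.span B" using B by blast
    then show "\<pi> x = 0"
    proof (induction x rule: V.span_induct_alt)
      case (step c x y)
      have "x \<in> V.extend_basis B" using V.extend_basis_superset[OF B(2)] step by blast
      then show ?case using step \<pi>(2)[of x] by (simp add: qlinear_add[OF q] qlinear_scaleQ[OF q])
    qed (simp add: qlinear_0[OF q])
  qed
qed

text \<open>\<open>R x\<close> is the left multiplication by \<open>x\<close> in the quotient, transported to a complement of \<open>I\<close>.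
  It is faithful on the quotient because \<open>R x 1\<close> represents \<open>x\<close>; note that \<open>R 1\<close> is the projection
  and not the identity.\<close>

lemma quotient_representation:
  fixes I :: "'a::rat_algebra set"
  assumes "two_sided_ideal I"
  obtains R :: "'a \<Rightarrow> 'a endo" where "qlinear R" "\<And>x y. R (x * y) = R x * R y"
      "\<And>x. R x = 0 \<longleftrightarrow> x \<in> I"
proof -
  obtain \<pi> :: "'a \<Rightarrow> 'a" where \<pi>: "qlinear \<pi>" "\<And>x. \<pi> x - x \<in> I"
      "\<And>x. x \<in> I \<Longrightarrow> \<pi> x = 0"
    using complement_projection[OF assms] by blast
  define R where "R x = Abs_endo (\<lambda>u. \<pi> (x * u))" for x
  have R: "apply_endo (R x) u = \<pi> (x * u)" for x u
    unfolding R_def by (subst Abs_endo_inverse) (simp_all add: qlinear_comp[OF \<pi>(1) qlinear_times])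
  have eqI: "(\<And>u. apply_endo f u = apply_endo g u) \<Longrightarrow> f = g" for f g :: "'a endo"
    by (metis apply_endo_inject ext)
  show ?thesis
  proof (rule that)
    show "qlinear R"
      by (rule qlinearI; rule eqI; simp add: R plus_endo.rep_eq scaleQ_endo.rep_eq distrib_right
          mult_scaleQ_left qlinear_add[OF \<pi>(1)] qlinear_scaleQ[OF \<pi>(1)])
    show "R (x * y) = R x * R y" for x y
    proof (rule eqI)
      fix u
      have "x * (\<pi> (y * u) - y * u) \<in> I" using \<pi>(2) two_sided_idealD(3)[OF assms] by blast
      then have "\<pi> (x * \<pi> (y * u)) - \<pi> (x * (y * u)) = 0"
        using \<pi>(3) by (simp add: right_diff_distrib flip: qlinear_diff[OF \<pi>(1)])
      then show "apply_endo (R (x * y)) u = apply_endo (R x * R y) u"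
        by (simp add: R times_endo.rep_eq mult.assoc)
    qed
    show "R x = 0 \<longleftrightarrow> x \<in> I" for x
    proof
      assume "R x = 0"
      then have "\<pi> (x * 1) = 0" using R[of x 1] by (simp add: zero_endo.rep_eq)
      then show "x \<in> I" using \<pi>(2)[of x] two_sided_idealD(5)[OF assms, of "- x"] by simp
    next
      assume "x \<in> I"
      then show "R x = 0"
        by (intro eqI) (simp add: R zero_endo.rep_eq \<pi>(3) two_sided_idealD(4)[OF assms])
    qed
  qed
qed


definition quotient_rep :: "'a::rat_algebra set \<Rightarrow> 'a \<Rightarrow> 'a endo" where
  "quotient_rep I = (SOME R. qlinear R \<and> (\<forall>x y. R (x * y) = R x * R y) \<and> (\<forall>x. R x =
      0 \<longleftrightarrow> x \<in> I))"

lemma quotient_rep: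
  assumes "two_sided_ideal I"
  shows "qlinear (quotient_rep I)" "quotient_rep I (x * y) = quotient_rep I x * quotient_rep I y"
    "quotient_rep I x = 0 \<longleftrightarrow> x \<in> I"
proof -
  have "\<exists>R :: 'a \<Rightarrow> 'a endo. qlinear R \<and> (\<forall>x y. R (x * y) =
      R x * R y) \<and> (\<forall>x. R x = 0 \<longleftrightarrow> x \<in> I)"
    using quotient_representation[OF assms] by metis
  from someI_ex[OF this] show "qlinear (quotient_rep I)"
    "quotient_rep I (x * y) = quotient_rep I x * quotient_rep I y"
        "quotient_rep I x = 0 \<longleftrightarrow> x \<in> I"
    unfolding quotient_rep_def by blast+
qed

section \<open>Words in the generators \<open>T\<close>\<close>

lemma parity_part_induct [consumes 1, case_names zero add G]:
  assumes "x \<in> parity_part G e" "S 0" "\<And>x y. S x \<Longrightarrow> S y \<Longrightarrow> S (x + y)"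
      "\<And>p x. x \<in> G p \<Longrightarrow> odd p = e \<Longrightarrow> S x"
  shows "S x"
proof -
  obtain f N where f: "x = (\<Sum>d\<le>N. f d)" "\<And>d. d \<le> N \<Longrightarrow> f d \<in> G d"
      "\<And>d. d \<le> N \<Longrightarrow> odd d \<noteq> e \<Longrightarrow> f d = 0"
    using assms(1) by (auto simp: parity_part_def)
  have "S (f d)" if "d \<le> N" for d
    using f(2,3)[OF that] assms(2,4) by (cases "odd d = e") auto
  then have "S (\<Sum>d\<le>n. f d)" if "n \<le> N" for n
    using that by (induction n) (auto intro: assms(3))
  then show ?thesis using f(1) by simp
qed

lemma hom_scomm:
  assumes "qlinear F" "\<And>x y. F (x * y) = F x * F y"
  shows "F (scomm p r x y) = scomm p r (F x) (F y)"
  by (simp add: scomm_if assms qlinear_add[OF assms(1)] qlinear_diff[OF assms(1)])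

lemma scomm_parity: "scomm p r = scomm (of_bool (odd p)) (of_bool (odd r))"
  by (intro ext) (simp add: scomm_if)

text \<open>Expands the cubic relation, which is a sum over the symmetric group.\<close>

lemma sum_permutations_3:
  "(\<Sum>w | w permutes {1..3::nat}. F (w 1) (w 2) (w 3)) =
     F 1 2 3 + F 1 3 2 + F 2 1 3 + F 2 3 1 + F 3 1 2 + (F 3 2 1 :: 'a::comm_monoid_add)"
proof -
  have "{1..3::nat} = {1, 2, 3}" by auto
  then show ?thesis
    by (simp add: sum_over_permutations_insert permutes_sing transpose_def ac_simps)
qed

definition inversion_degree :: "(nat \<Rightarrow> nat) \<Rightarrow> nat \<Rightarrow> nat \<Rightarrow> nat" where
  "inversion_degree d i j = (if j < i then d i * d j else 0)"

text \<open>In this form the sign can be evaluated for each term of \<open>sum_permutations_3\<close>.\<close>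

lemma koszul_sign_eq:
  "koszul_sign d w = (-1) ^ (inversion_degree d (w 1) (w 2) + inversion_degree d (w 1) (w 3) +
     inversion_degree d (w 2) (w 3))"
proof -
  let ?A = "{(i, j). i \<in> {1..3::nat} \<and> j \<in> {1..3} \<and> i < j \<and> w j < w i}"
  let ?B = "{(1, 2), (1, 3), (2, 3)} :: (nat \<times> nat) set"
  have "x \<in> ?A \<longleftrightarrow> x \<in> {x \<in> ?B. w (snd x) < w (fst x)}" for x
  proof -
    obtain i j where x: "x = (i, j)" by force
    have "i \<in> {1..3} \<and> j \<in> {1..3} \<and> i < j \<longleftrightarrow>
        (i = 1 \<and> j = 2) \<or> (i = 1 \<and> j = 3) \<or> (i = 2 \<and> j = 3)"
      by (simp only: atLeastAtMost_iff) presburger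
    then show ?thesis by (auto simp: x)
  qed
  then have "?A = {x \<in> ?B. w (snd x) < w (fst x)}" by blast
  then have "(\<Sum>(i, j)\<in>?A. d (w i) * d (w j)) =
      (\<Sum>x\<in>?B. if w (snd x) < w (fst x) then d (w (fst x)) * d (w (snd x)) else 0)"
    by (simp only: case_prod_beta sum.inter_filter finite.intros)
  also have "\<dots> = inversion_degree d (w 1) (w 2) + inversion_degree d (w 1) (w 3) +
     inversion_degree d (w 2) (w 3)" by (simp add: inversion_degree_def)
  finally show ?thesis by (simp only: koszul_sign_def)
qed

text \<open>This subalgebra of the free algebra maps onto \<open>W\<^sup>+\<close>, so that \<open>W\<^sup>+\<close> is its quotient by the
  relations of \<open>W\<^sup>\<ge>\<close> that happen to lie in it.\<close>

inductive_set T_alg :: "'h W_gen free_algebra set" where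
  T_alg_one: "1 \<in> T_alg"
| T_alg_gen: "t n \<xi> \<in> T_alg"
| T_alg_scaleQ: "x \<in> T_alg \<Longrightarrow> r *\<^sub>Q x \<in> T_alg"
| T_alg_add: "x \<in> T_alg \<Longrightarrow> y \<in> T_alg \<Longrightarrow> x + y \<in> T_alg"
| T_alg_mult: "x \<in> T_alg \<Longrightarrow> y \<in> T_alg \<Longrightarrow> x * y \<in> T_alg"

lemma T_alg_zero: "0 \<in> T_alg"
  using T_alg_scaleQ[OF T_alg_one, of 0] by simp

lemma T_alg_minus: "x \<in> T_alg \<Longrightarrow> - x \<in> T_alg"
  using T_alg_scaleQ[of x "-1"] by (simp add: scaleQ_neg1)

lemma T_alg_diff: "x \<in> T_alg \<Longrightarrow> y \<in> T_alg \<Longrightarrow> x - y \<in> T_alg"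
  using T_alg_add[of x "- y"] T_alg_minus[of y] by simp

lemma T_alg_const: "const r \<in> T_alg"
  using T_alg_scaleQ[OF T_alg_one, of r] const_mult[of r "1 :: 'a W_gen free_algebra"] by simp

lemma T_alg_numeral: "numeral n \<in> T_alg"
  using T_alg_scaleQ[OF T_alg_one, of "numeral n"] by (simp add: scaleQ_numeral)

lemma T_alg_power: "x \<in> T_alg \<Longrightarrow> x ^ n \<in> T_alg"
  by (induction n) (auto intro: T_alg.intros)

lemma T_alg_scomm: "x \<in> T_alg \<Longrightarrow> y \<in> T_alg \<Longrightarrow> scomm p r x y \<in> T_alg"
  and T_alg_santicomm: "x \<in> T_alg \<Longrightarrow> y \<in> T_alg \<Longrightarrow> santicomm p r x y \<in> T_alg"
  unfolding scomm_def santicomm_def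
  by (intro T_alg_diff T_alg_add T_alg_mult T_alg_power T_alg_minus T_alg_one; assumption)+

lemma T_alg_sum: "(\<And>i. i \<in> A \<Longrightarrow> f i \<in> T_alg) \<Longrightarrow> sum f A \<in> T_alg"
  by (induction A rule: infinite_finite_induct) (auto intro: T_alg_zero T_alg_add)

lemma T_alg_sum_list: "(\<And>x. x \<in> set xs \<Longrightarrow> f x \<in> T_alg) \<Longrightarrow>
    sum_list (map f xs) \<in> T_alg"
  by (induction xs) (auto intro: T_alg_zero T_alg_add)

lemmas T_alg_intros = T_alg_diff T_alg_scomm T_alg_santicomm T_alg_sum T_alg_sum_list T_alg_const
  T_alg_numeral T_alg_power T_alg_minus T_alg_one T_alg_gen T_alg_scaleQ T_alg_add T_alg_mult T_alg_zero

lemma koszul_sign_in_T_alg: "koszul_sign d w \<in> T_alg"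
  unfolding koszul_sign_def by (intro T_alg_intros)

section \<open>Images in the enveloping algebra\<close>

text \<open>The relators are stated for elements of the graded pieces \<open>G d\<close>, while the Lie superalgebra
  and its superderivations only see the parity parts.\<close>

locale graded_coefficients = super_coefficients "parity_part G" par q
  for G :: "nat \<Rightarrow> 'h::rat_algebra set" and par q +
  fixes \<Delta> :: "'h tensor"
  assumes zero_G: "0 \<in> G d" and one_G: "1 \<in> G 0"
begin

abbreviation "H \<equiv> parity_part G"
abbreviation "UR \<equiv> U_relators w_scale w_br (w_parity G)"
abbreviation "WR \<equiv> W_relators G 0 (q ^ 2) \<Delta>"
abbreviation "IU \<equiv> ideal_of UR"
abbreviation "IW \<equiv> ideal_of WR"

lemma G_H: "x \<in> G p \<Longrightarrow> x \<in> H (odd p)"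
  unfolding parity_part_def
  by (rule CollectI, rule exI[of _ "\<lambda>d. if d = p then x else 0"], rule exI[of _ p])
     (auto simp: zero_G)

lemma w_parity_eq: "w_parity G e = w_over (H e)"
  by (simp add: w_parity_def w_over_def)

text \<open>Stands for the class of an element of the free algebra in \<open>U(w\<^sup>+)\<close>; likewise \<open>RW\<close> below for
  \<open>W\<^sup>\<ge>\<close>.\<close>

definition RU :: "'h w_plus free_algebra \<Rightarrow> 'h w_plus free_algebra endo" where
  "RU = quotient_rep IU"

lemma qlinear_RU: "qlinear RU" and RU_mult: "RU (x * y) = RU x * RU y" and RU_zero_iff:
    "RU x = 0 \<longleftrightarrow> x \<in> IU"
  unfolding RU_def by (rule quotient_rep[OF two_sided_ideal_of])+

lemmas RU_lin = qlinear_rules[OF qlinear_RU]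

lemmas IU_ideal = two_sided_idealD[OF two_sided_ideal_of[of UR]]

lemma IU_scaleQ: "x \<in> IU \<Longrightarrow> r *\<^sub>Q x \<in> IU"
  by (rule two_sided_ideal_scaleQ[OF two_sided_ideal_of])

definition \<gamma> :: "'h w_plus \<Rightarrow> 'h w_plus free_algebra endo" where
  "\<gamma> x = RU (gen x)"

lemma qlinear_\<gamma>: "qlinear \<gamma>"
proof (rule qlinearI)
  fix x y r
  have "RU (gen (x + y) - gen x - gen y) = 0"
    unfolding RU_zero_iff by (rule relator_in_ideal) (rule U_relators.add)
  then show "\<gamma> (x + y) = \<gamma> x + \<gamma> y" by (simp add: \<gamma>_def RU_lin algebra_simps)
  have "RU (gen (w_scale r x) - const r * gen x) = 0"
    unfolding RU_zero_iff by (rule relator_in_ideal) (rule U_relators.scale)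
  then show "\<gamma> (r *\<^sub>Q x) = r *\<^sub>Q \<gamma> x" by (simp add: \<gamma>_def RU_lin w_scale_eq
      const_mult)
qed

lemmas \<gamma>_lin = qlinear_rules[OF qlinear_\<gamma>]

lemma RU_scomm: "RU (scomm p r x y) = scomm p r (RU x) (RU y)"
  by (rule hom_scomm[OF qlinear_RU RU_mult])

lemma \<gamma>_bracket:
  assumes "x \<in> w_over (H e)" "y \<in> w_over (H f)"
  shows "scomm (of_bool e) (of_bool f) (\<gamma> x) (\<gamma> y) = \<gamma> (w_br x y)"
proof -
  have "RU (scomm (of_bool e) (of_bool f) (gen x) (gen y) - gen (w_br x y)) = 0"
    unfolding RU_zero_iff
    by (rule relator_in_ideal, rule U_relators.bracket) (use assms in \<open>simp_all add: w_parity_eq\<close>)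
  then show ?thesis by (simp add: RU_lin RU_scomm \<gamma>_def)
qed

section \<open>Superderivations of the enveloping algebra\<close>

primrec der_word :: "bool \<Rightarrow> ('h w_plus \<Rightarrow> 'h w_plus) \<Rightarrow> 'h w_plus list
    \<Rightarrow> 'h w_plus free_algebra" where
  "der_word e d [] = 0"
| "der_word e d (x # xs) = gen (d x) * monomial xs + gen (wpar e x) * der_word e d xs"

text \<open>The extension of \<open>d\<close> to a superderivation of parity \<open>e\<close> of the free algebra on \<open>w\<^sup>+\<close>. Passing
  a letter is expressed by \<open>wpar e\<close> instead of a sign, so that letters of mixed parity are
  covered.\<close>

definition der :: "bool \<Rightarrow> ('h w_plus \<Rightarrow> 'h w_plus) \<Rightarrow> 'h w_plus free_algebra
    \<Rightarrow> 'h w_plus free_algebra" where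
  "der e d = word_linear (der_word e d)"

lemma qlinear_der: "qlinear (der e d)"
  by (simp add: der_def qlinear_word_linear)

lemmas der_lin = qlinear_rules[OF qlinear_der]

lemma der_one [simp]: "der e d 1 = 0"
  by (simp add: der_def word_linear_one)

lemma der_gen_times: "der e d (gen x * u) = gen (d x) * u + gen (wpar e x) * der e d u"
proof (induction u rule: finite_support_induct)
  case (single w r)
  have "der e d (gen x * monomial (letters w)) = der_word e d (x # letters w)"
    by (simp add: der_def word_linear_monomial del: der_word.simps flip: monomial_Cons)
  moreover have "der e d (monomial (letters w)) = der_word e d (letters w)"
    by (simp add: der_def word_linear_monomial)
  ultimately show ?case
    by (simp add: single_eq_monomial der_lin scaleQ_add_right mult_scaleQ_right)
qed (simp_all add: der_lin distrib_left)

lemma der_gen: "der e d (gen x) = gen (d x)"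
  using der_gen_times[of e d x 1] by simp

definition parity_hom :: "bool \<Rightarrow> 'h w_plus free_algebra \<Rightarrow> 'h w_plus free_algebra" where
  "parity_hom e = subst (\<lambda>x. gen (wpar e x))"

lemma der_mult: "der e d (u * v) = der e d u * v + parity_hom e u * der e d v"
  by (induction u rule: free_algebra_induct)
     (simp_all add: der_lin parity_hom_def subst_lin distrib_right mult_scaleQ_left scaleQ_add_right
       der_gen_times subst_gen_times mult.assoc distrib_left)

definition superderivation :: "bool \<Rightarrow> ('h w_plus \<Rightarrow> 'h w_plus) \<Rightarrow> bool" where
  "superderivation e d \<longleftrightarrow> qlinear d \<and> (\<forall>x y. d (w_br x y) = w_br (d x) y +
      w_br (wpar e x) (d y)) \<and>
     (\<forall>f. \<forall>x\<in>w_over (H f). d x \<in> w_over (H (e \<noteq> f)))"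

lemma superderivation_power_sum_der: "\<xi> \<in> H e \<Longrightarrow> superderivation e (power_sum_der m \<xi>)"
  unfolding superderivation_def using power_sum_der_parity power_sum_der_derivation qlinear_power_sum_der by blast

lemma parity_hom_relator:
  assumes "x \<in> UR"
  shows "parity_hom e x \<in> IU"
proof -
  have hom: "parity_hom e (scomm p r x y) = scomm p r (parity_hom e x) (parity_hom e y)" for p r x y
    unfolding parity_hom_def by (rule hom_scomm[OF qlinear_subst subst_mult])
  have "RU (parity_hom e x) = 0"
    using assms
  proof cases
    case (bracket x a y b)
    have xy: "x \<in> w_over (H a)" "y \<in> w_over (H b)" using bracket by (simp_all add: w_parity_eq)
    have "RU (parity_hom e (scomm (of_bool a) (of_bool b) (gen x) (gen y) - gen (w_br x y))) =
        scomm (of_bool a) (of_bool b) (\<gamma> (wpar e x)) (\<gamma> (wpar e y)) - \<gamma> (wpar e (w_br x y))"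
      unfolding parity_hom_def subst_lin RU_lin
      unfolding parity_hom_def[symmetric] hom RU_scomm by (simp add: parity_hom_def \<gamma>_def)
    also have "\<dots> = 0"
      using \<gamma>_bracket[OF xy] w_br_parity[OF xy] xy
      by (cases e; cases a; cases b) (simp_all add: wpar_homogeneous \<gamma>_lin scomm_if algebra_simps)
    finally show ?thesis using bracket by simp
  qed (simp_all add: parity_hom_def subst_lin const_mult w_scale_eq RU_lin qlinear_add[OF qlinear_wpar]
      qlinear_scaleQ[OF qlinear_wpar] \<gamma>_lin flip: \<gamma>_def)
  then show ?thesis by (simp add: RU_zero_iff)
qed

text \<open>The relator of a bracket is mapped to the sum of the relators of \<open>[d x, y]\<close> and \<open>\<plusminus>[x, d y]\<close>,
  since \<open>d\<close> is a superderivation of \<open>w\<^sup>+\<close>.\<close>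

lemma der_relator:
  assumes "superderivation e d" "x \<in> UR"
  shows "der e d x \<in> IU"
proof -
  have lind: "qlinear d" and deriv: "d (w_br x y) = w_br (d x) y + w_br (wpar e x) (d y)"
    and par: "x \<in> w_over (H f) \<Longrightarrow> d x \<in> w_over (H (e \<noteq> f))" for x y f
    using assms(1) by (auto simp: superderivation_def)
  have "RU (der e d x) = 0"
    using assms(2)
  proof cases
    case (bracket x a y b)
    have xy: "x \<in> w_over (H a)" "y \<in> w_over (H b)" using bracket by (simp_all add: w_parity_eq)
    have s: "RU (der e d (gen x * gen y)) = \<gamma> (d x) * \<gamma> y + \<gamma> (wpar e x) * \<gamma> (d y)"
        for x y
      by (simp add: der_gen_times der_gen RU_lin RU_mult \<gamma>_def)
    have "RU (der e d (scomm (of_bool a) (of_bool b) (gen x) (gen y) - gen (w_br x y))) = 0"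
      using \<gamma>_bracket[OF par[OF xy(1)] xy(2), symmetric] \<gamma>_bracket[OF xy(1) par[OF xy(2)], symmetric]
        s[of x y, unfolded wpar_homogeneous[OF xy(1)]] s[of y x, unfolded wpar_homogeneous[OF xy(2)]]
        deriv[of x y, unfolded wpar_homogeneous[OF xy(1)]]
      by (cases e; cases a; cases b;
          simp add: der_lin RU_lin scomm_if der_gen \<gamma>_lin w_br_minus flip: \<gamma>_def;
          simp (no_asm) add: algebra_simps)
    then show ?thesis using bracket by simp
  qed (simp_all add: der_lin der_gen const_mult w_scale_eq RU_lin qlinear_add[OF lind]
      qlinear_scaleQ[OF lind] \<gamma>_lin flip: \<gamma>_def)
  then show ?thesis by (simp add: RU_zero_iff)
qed

text \<open>The sign automorphism has to be included in the induction because of the super-Leibniz rule.\<close>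

lemma der_IU:
  assumes "superderivation e d" "x \<in> IU"
  shows "der e d x \<in> IU"
proof -
  let ?K = "{u. u \<in> IU \<and> parity_hom e u \<in> IU \<and> der e d u \<in> IU}"
  have hom: "parity_hom e 0 = 0" "parity_hom e (u + v) = parity_hom e u + parity_hom e v"
    "parity_hom e (u * v) = parity_hom e u * parity_hom e v" for u v
    by (simp_all add: parity_hom_def subst_lin subst_mult)
  have "two_sided_ideal ?K"
    unfolding two_sided_ideal_def
  proof (intro conjI ballI allI)
    fix u v assume "u \<in> ?K" "v \<in> ?K"
    then show "u + v \<in> ?K" by (simp add: hom der_lin IU_ideal(2))
  next
    fix u a assume u: "u \<in> ?K"
    then show "a * u \<in> ?K" "u * a \<in> ?K"
      by (simp_all add: hom der_mult IU_ideal(2) IU_ideal(3) IU_ideal(4))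
  qed (simp add: hom der_lin IU_ideal(1))
  moreover have "UR \<subseteq> ?K"
    using parity_hom_relator der_relator[OF assms(1)] relator_in_ideal by blast
  ultimately show ?thesis using ideal_of_least assms(2) by blast
qed

text \<open>Superderivations are determined by their values on generators, and these matter only up to
  the ideal. This gives the linearity of \<open>\<psi>\<^sub>m(\<xi>)\<close> in \<open>\<xi>\<close>.\<close>

lemma der_cong:
  assumes "\<And>x. \<gamma> (d x) = \<gamma> (d1 x) + r *\<^sub>Q \<gamma> (d2 x)"
  shows "RU (der e d u) = RU (der e d1 u) + r *\<^sub>Q RU (der e d2 u)"
  by (induction u rule: free_algebra_induct)
     (simp_all add: der_lin RU_lin der_gen_times RU_mult assms scaleQ_add_right distrib_left distrib_right
       mult_scaleQ_left mult_scaleQ_right scaleQ_scaleQ algebra_simps flip: \<gamma>_def)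

lemma der_zero: "RU (der e (\<lambda>x. 0) u) = 0"
  using der_cong[of "\<lambda>x. 0" "\<lambda>x. 0" "1" "\<lambda>x. 0" e u] by (simp add: \<gamma>_lin scaleQ_one)

text \<open>The supercommutator of two superderivations is a superderivation, hence zero if it is zero
  on generators. The hypotheses on \<open>wpar\<close> say that \<open>d1\<close> and \<open>d2\<close> are homogeneous.\<close>

lemma der_supercommute:
  assumes "\<And>x. d1 (d2 x) = (if e \<and> f then - d2 (d1 x) else d2 (d1 x))"
    and "\<And>x. wpar f (d1 x) = (if e \<and> f then - d1 (wpar f x) else d1 (wpar f x))"
    and "\<And>x. wpar e (d2 x) = (if e \<and> f then - d2 (wpar e x) else d2 (wpar e x))"
    and "qlinear d1" "qlinear d2"
  shows "RU (der e d1 (der f d2 u)) = (if e \<and> f then - RU (der f d2 (der e d1 u)) else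
      RU (der f d2 (der e d1 u)))"
proof (induction u rule: free_algebra_induct)
  case (gen x u)
  have w: "wpar e (wpar f x) = wpar f (wpar e x)" by (cases e; cases f) (simp_all add: wpar_False)
  have expand: "RU (der e d1 (der f d2 (gen x * u))) = \<gamma> (d1 (d2 x)) * RU u +
      \<gamma> (wpar e (d2 x)) * RU (der e d1 u)
      + (\<gamma> (d1 (wpar f x)) * RU (der f d2 u) + \<gamma> (wpar e (wpar f x)) * RU
          (der e d1 (der f d2 u)))" for e f d1 d2
    by (simp add: der_gen_times der_lin RU_lin RU_mult \<gamma>_def)
  show ?case
  proof (cases "e \<and> f")
    case True
    then show ?thesis
      unfolding expand w assms(1-3) using gen by (simp only: True if_True simp_thms \<gamma>_lin)
          (simp add: algebra_simps)
  next
    case False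
    then show ?thesis
      unfolding expand w assms(1-3) using gen by (simp only: False if_False \<gamma>_lin) (simp add: algebra_simps)
  qed
qed (auto simp: der_lin RU_lin scaleQ_minus_right)

end

section \<open>The action of \<open>W\<^sup>\<ge>\<close> on the enveloping algebra\<close>

context graded_coefficients
begin

text \<open>Multiplications by polynomials commute, so only the coefficients \<open>\<xi>\<close>, \<open>\<mu>\<close> contribute a sign.
  Formally, the elements of \<open>z\<close>-degree zero supercommute with each other.\<close>

lemma power_sum_der_supercommute:
  assumes "\<xi> \<in> H e" "\<mu> \<in> H f"
  shows "power_sum_der m \<xi> (power_sum_der n \<mu> x) = (if e \<and> f then -
      power_sum_der n \<mu> (power_sum_der m \<xi> x) else power_sum_der n \<mu> (power_sum_der m \<xi> x))"
proof (induction x rule: w_plus_induct)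
  case (zD k i \<nu>)
  have "\<xi> * (\<mu> * \<nu>) = (if e \<and> f then - (\<mu> * (\<xi> * \<nu>)) else \<mu> * (\<xi> * \<nu>))"
    using supercomm[OF assms] by (simp flip: mult.assoc)
  then show ?case by (auto simp: power_sum_der_zD power_sum_der_zP qlinear_minus[OF qlinear_zP] mult.left_commute)
qed (auto simp: power_sum_der_lin)

lemma wpar_power_sum_der:
  assumes "\<xi> \<in> H e"
  shows "wpar f (power_sum_der m \<xi> x) = (if e \<and> f then - power_sum_der m \<xi> (wpar f x) else
      power_sum_der m \<xi> (wpar f x))"
proof (induction x rule: w_plus_induct)
  case (zD k n \<nu>)
  have "par (\<xi> * \<nu>) = (if e then - (\<xi> * par \<nu>) else \<xi> * par \<nu>)"
  proof -
    have "par (\<xi> * hpart g \<nu>) = (if e then - (\<xi> * par (hpart g \<nu>)) else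
        \<xi> * par (hpart g \<nu>))" for g
      using mult_H[OF assms hpart_H[of g \<nu>]] hpart_H[of g \<nu>] by (cases e; cases g) (simp_all add: H_iff)
    then have "par (\<xi> * (hpart False \<nu> + hpart True \<nu>)) =
      (if e then - (\<xi> * par (hpart False \<nu> + hpart True \<nu>)) else
          \<xi> * par (hpart False \<nu> + hpart True \<nu>))"
      by (simp add: distrib_left par_add)
    then show ?thesis by (simp only: hpart_sum)
  qed
  then show ?case by (auto simp: power_sum_der_zD wpar_zP wpar_zD qlinear_minus[OF qlinear_zP])
qed (auto simp: power_sum_der_lin wpar_lin)

text \<open>The central generator may act as zero, since the relations only require that it acts
  centrally. An arbitrary coefficient of \<open>\<psi>\<^sub>m\<close> is split into its even and its odd part, as the
  Leibniz rule depends on the parity.\<close>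

primrec act_gen :: "'h W_gen \<Rightarrow> 'h w_plus free_algebra \<Rightarrow> 'h w_plus free_algebra" where
  "act_gen (Psi m \<xi>) u = der False (power_sum_der m (hpart False \<xi>)) u +
      der True (power_sum_der m (hpart True \<xi>)) u"
| "act_gen (T n \<xi>) u = gen (zD 1 n \<xi>) * u"
| "act_gen Central u = 0"

definition act :: "'h W_gen free_algebra \<Rightarrow> 'h w_plus free_algebra \<Rightarrow> 'h w_plus
    free_algebra" where
  "act x u = word_linear (\<lambda>gs. foldr act_gen gs u) x"

lemma qlinear_act_gen: "qlinear (act_gen g)"
  by (cases g) (auto intro!: qlinearI simp: der_lin scaleQ_add_right distrib_left mult_scaleQ_right)

lemma qlinear_act: "qlinear (\<lambda>x. act x u)"
  by (simp add: act_def[abs_def] qlinear_word_linear)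

lemmas act_lin = qlinear_rules[OF qlinear_act]

lemma act_one [simp]: "act 1 u = u"
  by (simp add: act_def word_linear_one)

lemma act_gen_times: "act (gen g * x) u = act_gen g (act x u)"
  unfolding act_def by (rule word_linear_gen_times) (simp_all add: qlinear_act_gen)

lemma act_gen_eq: "act (gen g) u = act_gen g u"
  using act_gen_times[of g 1 u] by simp

lemma act_mult: "act (x * y) u = act x (act y u)"
  by (induction x rule: free_algebra_induct)
     (simp_all add: act_lin distrib_right mult_scaleQ_left act_gen_times mult.assoc)

lemma act_gen_IU: "u \<in> IU \<Longrightarrow> act_gen g u \<in> IU"
  by (cases g) (simp_all add: IU_ideal(1-3) der_IU[OF superderivation_power_sum_der[OF hpart_H]])

lemma act_IU: "u \<in> IU \<Longrightarrow> act x u \<in> IU"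
  by (induction x arbitrary: u rule: free_algebra_induct)
     (simp_all add: act_lin IU_ideal(1,2) IU_scaleQ act_gen_times act_gen_IU)

lemma act_gen_Psi:
  assumes "\<xi> \<in> H e"
  shows "RU (act_gen (Psi m \<xi>) u) = RU (der e (power_sum_der m \<xi>) u)"
proof -
  have "power_sum_der m (hpart (\<not> e) \<xi>) = (\<lambda>x. 0)" "hpart e \<xi> = \<xi>"
    using hpart_eq[OF assms] by (auto simp: power_sum_der_zero)
  then show ?thesis by (cases e) (simp_all add: RU_lin der_zero)
qed

lemma RU_act_gen_cong: "RU u = RU v \<Longrightarrow> RU (act_gen g u) = RU (act_gen g v)"
  using act_gen_IU[of "u - v" g]
  by (simp add: RU_zero_iff[symmetric] RU_lin qlinear_diff[OF qlinear_act_gen])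

lemma RU_der_cong: "superderivation e d \<Longrightarrow> RU u = RU v \<Longrightarrow> RU (der e d u) =
    RU (der e d v)"
  using der_IU[of e d "u - v"] by (simp add: RU_zero_iff[symmetric] RU_lin der_lin)

text \<open>The substitution by which words in the generators \<open>T\<close> act; zero is a default value for the
  other generators.\<close>

definition \<Phi> :: "'h W_gen free_algebra \<Rightarrow> 'h w_plus free_algebra" where
  "\<Phi> = subst (\<lambda>g. case g of T n \<xi> \<Rightarrow> gen (zD 1 n \<xi>) | _ \<Rightarrow> 0)"

lemma \<Phi>_simps: "\<Phi> (x * y) = \<Phi> x * \<Phi> y" "\<Phi> 1 = 1" "\<Phi> (t n \<xi>) = gen (zD 1 n \<xi>)"
  by (simp_all add: \<Phi>_def subst_mult)

lemma qlinear_\<Phi>: "qlinear \<Phi>"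
  by (simp add: \<Phi>_def qlinear_subst)

text \<open>On \<open>W\<^sup>+\<close> the action is left multiplication, so the value at \<open>1\<close> recovers \<open>\<Phi>\<close>.\<close>

lemma act_T_alg: "x \<in> T_alg \<Longrightarrow> act x u = \<Phi> x * u"
  by (induction x arbitrary: u rule: T_alg.induct)
     (simp_all add: \<Phi>_simps act_gen_eq qlinear_scaleQ[OF qlinear_\<Phi>] qlinear_add[OF qlinear_\<Phi>]
       act_lin act_mult mult_scaleQ_left distrib_right mult.assoc)

definition \<rho> :: "'h W_gen free_algebra \<Rightarrow> 'h w_plus free_algebra endo" where
  "\<rho> x = RU (\<Phi> x)"

lemma qlinear_\<rho>: "qlinear \<rho>"
  unfolding \<rho>_def[abs_def] by (rule qlinear_comp[OF qlinear_RU qlinear_\<Phi>])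

lemmas \<rho>_lin = qlinear_rules[OF qlinear_\<rho>]

lemma \<rho>_mult: "\<rho> (x * y) = \<rho> x * \<rho> y"
  by (simp add: \<rho>_def \<Phi>_simps RU_mult)

lemma \<rho>_t: "\<rho> (t n \<xi>) = \<gamma> (zD 1 n \<xi>)"
  by (simp add: \<rho>_def \<Phi>_simps \<gamma>_def)

lemma \<rho>_scomm: "\<rho> (scomm p r x y) = scomm p r (\<rho> x) (\<rho> y)"
  by (rule hom_scomm[OF qlinear_\<rho> \<rho>_mult])

lemma \<rho>_numeral: "\<rho> (numeral k * x) = numeral k *\<^sub>Q \<rho> x"
  by (simp add: \<rho>_lin flip: scaleQ_numeral)

lemma act_T_alg_zero: "x \<in> T_alg \<Longrightarrow> \<rho> x = 0 \<Longrightarrow> RU (act x u) = 0"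
  by (simp add: act_T_alg RU_mult \<rho>_def)

lemma zD_H: "\<xi> \<in> H e \<Longrightarrow> zD k n \<xi> \<in> w_over (H e)"
  by (simp add: w_over_closed(4)[OF q_subspace_H])

lemma \<gamma>_scomm:
  assumes "x \<in> w_over (H (odd p))" "y \<in> w_over (H (odd r))"
  shows "scomm p r (\<gamma> x) (\<gamma> y) = \<gamma> (w_br x y)"
  using \<gamma>_bracket[OF assms] by (simp add: scomm_parity[of p r])

lemma mult_H_odd: "\<xi> \<in> H (odd p) \<Longrightarrow> \<mu> \<in> H (odd r) \<Longrightarrow>
    \<xi> * \<mu> \<in> H (odd (p + r))"
  using mult_H[of \<xi> "odd p" \<mu> "odd r"] by (cases "even p"; cases "even r"; simp)

lemma w_br_H_odd: "x \<in> w_over (H (odd p)) \<Longrightarrow> y \<in> w_over (H (odd r)) \<Longrightarrow>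
    w_br x y \<in> w_over (H (odd (p + r)))"
  using w_br_parity[of x "odd p" y "odd r"] by (cases "even p"; cases "even r"; simp)

lemma supercomm_scaleQ:
  assumes "\<xi> \<in> H (odd p)" "\<mu> \<in> H (odd r)"
  shows "\<xi> * \<mu> = (-1) ^ (p * r) *\<^sub>Q (\<mu> * \<xi>)"
  using supercomm[OF assms]
  by (cases "even p"; cases "even r") (simp_all add: scaleQ_one scaleQ_neg1 minus_one_power_iff)

text \<open>The polynomial identity behind the symmetrized cubic relation.\<close>

lemma cubic_polynomials:
  "poly_bracket 1 2 (Dv ^ a) (poly_bracket 1 1 (Dv ^ b) (Dv ^ (c + 1))) +
      poly_bracket 1 2 (Dv ^ a) (poly_bracket 1 1 (Dv ^ c) (Dv ^ (b + 1)))
   + poly_bracket 1 2 (Dv ^ b) (poly_bracket 1 1 (Dv ^ a) (Dv ^ (c + 1))) +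
       poly_bracket 1 2 (Dv ^ b) (poly_bracket 1 1 (Dv ^ c) (Dv ^ (a + 1)))
   + poly_bracket 1 2 (Dv ^ c) (poly_bracket 1 1 (Dv ^ a) (Dv ^ (b + 1))) +
       poly_bracket 1 2 (Dv ^ c) (poly_bracket 1 1 (Dv ^ b) (Dv ^ (a + 1))) = 0"
  by (rule eval_Dq_eqI) (simp add: eval_Dq_poly_bracket, simp add: field_simps)

lemma \<rho>_nested:
  assumes "\<xi>1 \<in> H (odd d1)" "\<xi>2 \<in> H (odd d2)" "\<xi>3 \<in> H (odd d3)"
  shows "\<rho> (scomm d3 (d2 + d1) (t a \<xi>3) (scomm d2 d1 (t b \<xi>2) (t c \<xi>1))) =
     \<gamma> (zP 3 (poly_bracket 1 2 (Dv ^ a) (poly_bracket 1 1 (Dv ^ b) (Dv ^ c))) (\<xi>3 * (\<xi>2 * \<xi>1)))"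
proof -
  have w: "w_br (zD 1 b \<xi>2) (zD 1 c \<xi>1) \<in> w_over (H (odd (d2 + d1)))"
    using assms zD_H by (intro w_br_H_odd) auto
  have "w_br (zD 1 a \<xi>3) (w_br (zD 1 b \<xi>2) (zD 1 c \<xi>1)) =
      zP 3 (poly_bracket 1 2 (Dv ^ a) (poly_bracket 1 1 (Dv ^ b) (Dv ^ c))) (\<xi>3 * (\<xi>2 * \<xi>1))"
    using w_bracket_zP[of 1 2 "Dv ^ a" \<xi>3] by (simp only: w_br_degree_one) (simp add: zP_Dv numeral_3_eq_3)
  then show ?thesis
    using assms w zD_H by (simp add: \<rho>_scomm \<rho>_t \<gamma>_scomm)
qed

lemma \<rho>_sign: "\<rho> ((-1) ^ n * x) = (-1) ^ n *\<^sub>Q \<rho> x"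
  by (cases "even n") (simp_all add: \<rho>_lin scaleQ_one scaleQ_neg1)

text \<open>The Koszul signs turn the six coefficients \<open>\<xi>\<^sub>k \<xi>\<^sub>j \<xi>\<^sub>i\<close> into the same product \<open>\<xi>\<^sub>3 \<xi>\<^sub>2 \<xi>\<^sub>1\<close>, so
  that the sum becomes \<open>cubic_polynomials\<close>.\<close>

lemma \<rho>_cubic:
  assumes \<xi>: "\<And>i. i \<in> {1..3::nat} \<Longrightarrow> \<xi> i \<in> H (odd (d i))"
  shows "\<rho> (\<Sum>w | w permutes {1..3}. koszul_sign d w *
       scomm (d (w 3)) (d (w 2) + d (w 1)) (t (m (w 3)) (\<xi> (w 3)))
         (scomm (d (w 2)) (d (w 1)) (t (m (w 2)) (\<xi> (w 2))) (t (m (w 1) + 1) (\<xi> (w 1))))) = 0"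
proof -
  define P where "P i j k = poly_bracket 1 2 (Dv ^ m k) (poly_bracket 1 1 (Dv ^ m j) (Dv ^ (m i + 1)))" for i j k
  define \<mu> where "\<mu> = \<xi> 3 * (\<xi> 2 * \<xi> 1)"
  define F where "F i j k = (-1) ^ (inversion_degree d i j + inversion_degree d i k + inversion_degree d j k) *
       scomm (d k) (d j + d i) (t (m k) (\<xi> k)) (scomm (d j) (d i) (t (m j) (\<xi> j)) (t (m i +
           1) (\<xi> i)))" for i j k
  have sgn: "(-1) ^ n * ((-1) ^ n * r) = (r :: rat)" "(-1) ^ n * (-1) ^ n = (1 :: rat)" for n r
    by (simp_all flip: power_add mult.assoc)
  have x: "\<xi> 1 \<in> H (odd (d 1))" "\<xi> 2 \<in> H (odd (d 2))"
      "\<xi> 3 \<in> H (odd (d 3))" using \<xi> by auto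
  have comm: "\<xi> 1 * \<xi> 2 = (-1) ^ (d 1 * d 2) *\<^sub>Q (\<xi> 2 * \<xi> 1)"
      "\<xi> 1 * \<xi> 3 = (-1) ^ (d 1 * d 3) *\<^sub>Q (\<xi> 3 * \<xi> 1)"
    "\<xi> 2 * \<xi> 3 = (-1) ^ (d 2 * d 3) *\<^sub>Q (\<xi> 3 * \<xi> 2)"
    using supercomm_scaleQ x by blast+
  have comm': "\<xi> 1 * (\<xi> 2 * y) = (-1) ^ (d 1 * d 2) *\<^sub>Q (\<xi> 2 * (\<xi> 1 * y))"
    "\<xi> 1 * (\<xi> 3 * y) = (-1) ^ (d 1 * d 3) *\<^sub>Q (\<xi> 3 * (\<xi> 1 * y))"
    "\<xi> 2 * (\<xi> 3 * y) = (-1) ^ (d 2 * d 3) *\<^sub>Q (\<xi> 3 * (\<xi> 2 * y))" for y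
    using arg_cong[OF comm(1), of "\<lambda>x. x * y"] arg_cong[OF comm(2), of "\<lambda>x. x * y"]
      arg_cong[OF comm(3), of "\<lambda>x. x * y"] by (simp_all add: mult_scaleQ_left mult.assoc)
  have F: "\<rho> (F i j k) = \<gamma> (zP 3 (P i j k) ((-1) ^ (inversion_degree d i j + inversion_degree d i k +
      inversion_degree d j k) *\<^sub>Q (\<xi> k * (\<xi> j * \<xi> i))))"
    if "i \<in> {1..3}" "j \<in> {1..3}" "k \<in> {1..3}" for i j k
    using \<xi>[OF that(1)] \<xi>[OF that(2)] \<xi>[OF that(3)]
    unfolding F_def \<rho>_sign by (simp only: \<rho>_nested P_def qlinear_scaleQ[OF qlinear_zP] \<gamma>_lin)
  have "\<rho> (F 1 2 3) = \<gamma> (zP 3 (P 1 2 3) \<mu>)" "\<rho> (F 1 3 2) = \<gamma> (zP 3 (P 1 3 2) \<mu>)"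
    "\<rho> (F 2 1 3) = \<gamma> (zP 3 (P 2 1 3) \<mu>)" "\<rho> (F 2 3 1) = \<gamma> (zP 3 (P 2 3 1) \<mu>)"
    "\<rho> (F 3 1 2) = \<gamma> (zP 3 (P 3 1 2) \<mu>)" "\<rho> (F 3 2 1) = \<gamma> (zP 3 (P 3 2 1) \<mu>)"
    by (simp_all add: F inversion_degree_def \<mu>_def comm[simplified] comm'[simplified] mult_scaleQ_right
        scaleQ_scaleQ power_add sgn scaleQ_one mult.assoc mult.commute mult.left_commute)
  moreover have "P 1 2 3 + P 1 3 2 + P 2 1 3 + P 2 3 1 + P 3 1 2 + P 3 2 1 = 0"
    unfolding P_def using cubic_polynomials[of "m 3" "m 2" "m 1"] by (simp only: ac_simps)
  then have "\<gamma> (zP 3 (P 1 2 3 + P 1 3 2 + P 2 1 3 + P 2 3 1 + P 3 1 2 + P 3 2 1) \<mu>) = 0"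
    by (simp add: zP_zero_left \<gamma>_lin)
  ultimately have "\<rho> (F 1 2 3 + F 1 3 2 + F 2 1 3 + F 2 3 1 + F 3 1 2 + F 3 2 1) = 0"
    by (simp only: zP_add_left \<gamma>_lin \<rho>_lin)
  then have "\<rho> (\<Sum>w | w permutes {1..3}. F (w 1) (w 2) (w 3)) = 0"
    by (simp only: sum_permutations_3)
  then show ?thesis
    unfolding koszul_sign_eq F_def .
qed

text \<open>The relators without \<open>\<psi>\<close> act by left multiplication with elements that are zero in \<open>U(w\<^sup>+)\<close>.
  The relations with \<open>\<psi>\<close> are linearity and supercommutation of superderivations, and the Leibniz
  rule for a letter \<open>z D\<^sup>n \<mu>\<close>, on which \<open>power_sum_der\<close> has the value \<open>m z D\<^sup>m\<^sup>+\<^sup>n\<^sup>-\<^sup>1 \<xi>\<mu>\<close>.\<close>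

lemma relator_acts_trivially:
  assumes "x \<in> WR"
  shows "RU (act x u) = 0"
  using assms
proof cases
  case (psi_add n \<xi> \<mu>)
  have "RU (act_gen (Psi n (\<xi> + \<mu>)) u) = RU (act_gen (Psi n \<xi>) u) + RU (act_gen (Psi n \<mu>) u)"
    using der_cong[of "power_sum_der n (hpart e (\<xi> + \<mu>))" "power_sum_der n (hpart e \<xi>)" 1
        "power_sum_der n (hpart e \<mu>)" e u for e]
    by (simp add: RU_lin qlinear_add[OF qlinear_hpart] power_sum_der_add \<gamma>_lin scaleQ_one)
  then show ?thesis by (simp add: psi_add act_lin act_gen_eq RU_lin del: act_gen.simps)
next
  case (psi_scale n r \<xi>)
  have "RU (act_gen (Psi n (r *\<^sub>Q \<xi>)) u) = r *\<^sub>Q RU (act_gen (Psi n \<xi>) u)"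
    using der_cong[of "power_sum_der n (hpart e (r *\<^sub>Q \<xi>))" "\<lambda>x. 0" r
        "power_sum_der n (hpart e \<xi>)" e u for e]
    by (simp add: RU_lin qlinear_scaleQ[OF qlinear_hpart] power_sum_der_scaleQ \<gamma>_lin der_zero scaleQ_add_right)
  then show ?thesis by (simp add: psi_scale act_lin act_gen_eq RU_lin const_mult del: act_gen.simps)
next
  case (T_add n \<xi> \<mu>)
  show ?thesis unfolding T_add
    by (rule act_T_alg_zero) (auto intro!: T_alg_intros simp: \<rho>_lin \<rho>_t zD_add \<gamma>_lin)
next
  case (T_scale n r \<xi>)
  show ?thesis unfolding T_scale const_mult
    by (rule act_T_alg_zero) (auto intro!: T_alg_intros simp: \<rho>_lin \<rho>_t zD_scaleQ \<gamma>_lin)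
next
  case (central g)
  show ?thesis
    by (simp add: central act_lin act_gen_times act_gen_eq qlinear_0[OF qlinear_act_gen] RU_lin)
next
  case (psi_psi \<xi> p \<mu> r m n)
  have \<xi>: "\<xi> \<in> H (odd p)" and \<mu>: "\<mu> \<in> H (odd r)" using psi_psi G_H by auto
  let ?D1 = "der (odd p) (power_sum_der m \<xi>)" and ?D2 = "der (odd r) (power_sum_der n \<mu>)"
  have 1: "RU (act_gen (Psi m \<xi>) (act_gen (Psi n \<mu>) u)) = RU (?D1 (?D2 u))"
    using act_gen_Psi[OF \<xi>] RU_der_cong[OF superderivation_power_sum_der[OF \<xi>] act_gen_Psi[OF \<mu>]] by simp
  have 2: "RU (act_gen (Psi n \<mu>) (act_gen (Psi m \<xi>) u)) = RU (?D2 (?D1 u))"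
    using act_gen_Psi[OF \<mu>] RU_der_cong[OF superderivation_power_sum_der[OF \<mu>] act_gen_Psi[OF \<xi>]] by simp
  have "RU (?D1 (?D2 u)) = (if odd p \<and> odd r then - RU (?D2 (?D1 u)) else RU (?D2 (?D1 u)))"
    by (rule der_supercommute) (use power_sum_der_supercommute[OF \<xi> \<mu>] wpar_power_sum_der[OF \<xi>]
        wpar_power_sum_der[OF \<mu>] qlinear_power_sum_der in auto)
  then show ?thesis
    unfolding psi_psi(1) scomm_if
    by (auto simp: act_lin act_mult act_gen_times act_gen_eq RU_lin 1 2 simp del: act_gen.simps)
next
  case (psi_T \<xi> p \<mu> r m n)
  have \<xi>: "\<xi> \<in> H (odd p)" and \<mu>: "\<mu> \<in> H (odd r)" using psi_T G_H by auto
  let ?D = "der (odd p) (power_sum_der m \<xi>)" and ?z = "zD 1 n \<mu>"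
  have w: "wpar (odd p) ?z = (if odd p \<and> odd r then - ?z else ?z)"
    by (rule wpar_homogeneous[OF zD_H[OF \<mu>]])
  have 1: "RU (act_gen (Psi m \<xi>) (gen ?z * u)) =
      of_nat m *\<^sub>Q \<gamma> (zD 1 (m + n - 1) (\<xi> * \<mu>)) * RU u + \<gamma> (wpar (odd p) ?z) * RU (?D u)"
    unfolding act_gen_Psi[OF \<xi>] der_gen_times power_sum_der_degree_one by
        (simp add: RU_lin RU_mult \<gamma>_lin flip: \<gamma>_def)
  have 2: "RU (gen ?z * act_gen (Psi m \<xi>) u) = \<gamma> ?z * RU (?D u)"
    unfolding RU_mult act_gen_Psi[OF \<xi>] \<gamma>_def ..
  have 3: "RU (act (of_nat m * t (m + n - 1) (\<xi> * \<mu>)) u) =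
      of_nat m *\<^sub>Q \<gamma> (zD 1 (m + n - 1) (\<xi> * \<mu>)) * RU u"
    unfolding scaleQ_of_nat[symmetric] by (simp add: act_lin act_gen_eq RU_lin RU_mult mult_scaleQ_left flip:
        \<gamma>_def)
  have "RU (act (scomm p r (psi m \<xi>) (t n \<mu>)) u) = of_nat m *\<^sub>Q \<gamma> (zD 1 (m + n -
      1) (\<xi> * \<mu>)) * RU u"
    using 1 2 unfolding scomm_if w
    by (cases "odd p \<and> odd r") (simp_all add: act_lin act_gen_times act_gen_eq RU_lin \<gamma>_lin del:
        act_gen.simps(1))
  then show ?thesis unfolding psi_T(1) act_lin RU_lin 3 by simp
next
  case (T_T \<xi> p \<mu> r \<nu> l m n)
  have H: "\<xi> \<in> H (odd p)" "\<mu> \<in> H (odd r)" "\<nu> \<in> H (odd l)" using T_T G_H by auto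
  have w: "w_br (zD 1 m (\<xi> * \<mu>)) (zD 1 n \<nu>) = w_br (zD 1 m \<xi>) (zD 1 n (\<mu> * \<nu>))"
    by (simp only: w_br_degree_one mult.assoc)
  have "\<rho> (scomm (p + r) l (t m (\<xi> * \<mu>)) (t n \<nu>)) =
      \<rho> (scomm p (r + l) (t m \<xi>) (t n (\<mu> * \<nu>)))"
    unfolding \<rho>_scomm \<rho>_t
    by (subst (1 2) \<gamma>_scomm) (use H w[simplified] in \<open>simp_all add: zD_H mult_H_odd del: even_add
        odd_add\<close>)
  then show ?thesis unfolding T_T(1)
    by (intro act_T_alg_zero) (auto intro!: T_alg_intros simp: \<rho>_lin)
next
  case (quadratic \<xi> p \<mu> r m n)
  have H: "\<xi> \<in> H (odd p)" "\<mu> \<in> H (odd r)" using quadratic G_H by auto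
  have H': "q ^ 2 * \<mu> \<in> H (odd r)" using mult_H[OF q_power_H H(2), of 2] by simp
  have s: "\<rho> (scomm p r (t i \<xi>) (t j \<mu>)) = \<gamma> (w_br (zD 1 i \<xi>) (zD 1 j \<mu>))"
    "\<rho> (scomm p r (t i \<xi>) (t j (q ^ 2 * \<mu>))) = \<gamma>
        (w_br (zD 1 i \<xi>) (zD 1 j (q ^ 2 * \<mu>)))" for i j
    unfolding \<rho>_scomm \<rho>_t using H H' by (simp_all add: \<gamma>_scomm zD_H)
  have "\<rho> (santicomm i k (t m (0 * a)) x) = 0" for i k a x
    by (cases "even (i * k)") (simp_all add: santicomm_def \<rho>_lin \<rho>_mult \<rho>_t \<gamma>_lin
        \<rho>_sign minus_one_power_iff)
  then have \<Delta>: "\<rho> (\<Sum>((i, a), (j, b))\<leftarrow>\<Delta>'. santicomm i (j + p +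
      r) (t m (0 * a)) (t n (b * \<xi> * \<mu>))) = 0" for \<Delta>'
    by (induction \<Delta>') (auto simp: \<rho>_lin)
  let ?R = "scomm p r (t m \<xi>) (t (n + 3) \<mu>) - 3 * scomm p r (t (m + 1) \<xi>) (t (n + 2) \<mu>)
      + 3 * scomm p r (t (m + 2) \<xi>) (t (n + 1) \<mu>) - scomm p r (t (m + 3) \<xi>) (t n \<mu>)
      - scomm p r (t m \<xi>) (t (n + 1) (q ^ 2 * \<mu>)) + scomm p r (t (m + 1) \<xi>) (t n (q ^ 2 * \<mu>))
      + (\<Sum>((i, a), (j, b))\<leftarrow>\<Delta>. santicomm i (j + p + r) (t m (0 * a)) (t n (b * \<xi> * \<mu>)))"
  have "\<rho> ?R = 0"
    using arg_cong[OF w_br_quadratic[of m \<xi> n \<mu>], of \<gamma>, unfolded \<gamma>_lin]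
    unfolding \<rho>_lin \<rho>_numeral s \<Delta> by (simp only: diff_add_eq add_0_right) (simp add: algebra_simps)
  moreover have "?R \<in> T_alg"
    by (intro T_alg_add T_alg_diff T_alg_mult T_alg_numeral T_alg_scomm T_alg_gen T_alg_sum_list)
       (auto intro!: T_alg_santicomm T_alg_gen)
  ultimately show ?thesis unfolding quadratic(1) by (intro act_T_alg_zero)
next
  case (cubic \<xi> d m)
  show ?thesis unfolding cubic(1)
  proof (rule act_T_alg_zero[OF _ \<rho>_cubic])
    show "\<xi> i \<in> H (odd (d i))" if "i \<in> {1..3}" for i using cubic(2)[OF that] G_H by blast
  qed (intro T_alg_sum T_alg_mult koszul_sign_in_T_alg T_alg_scomm T_alg_gen)
next
  case (psi_vanish \<xi> p n)
  \<comment> \<open>\<open>2 n - 2 + p < 0\<close> leaves only \<open>n = 0\<close>, and the power sum with factor \<open>n\<close> is zero\<close>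
  then have n: "n = 0" and \<xi>: "\<xi> \<in> H (odd p)" using G_H by auto
  have "power_sum_der 0 \<xi> x = 0" for x
    by (induction x rule: w_plus_induct)
       (simp_all add: power_sum_der_lin power_sum_der_zD power_sum_def zP_zero_left)
  then have "power_sum_der 0 \<xi> = (\<lambda>x. 0)" by auto
  then show ?thesis
    unfolding psi_vanish(1) n act_gen_eq act_gen_Psi[OF \<xi>] by (simp add: der_zero)
qed

lemma act_IW: "x \<in> IW \<Longrightarrow> act x u \<in> IU"
proof -
  let ?K = "{x. \<forall>u. act x u \<in> IU}"
  have "two_sided_ideal ?K"
    by (auto simp: two_sided_ideal_def act_lin act_mult IU_ideal(1,2) intro: act_IU)
  moreover have "WR \<subseteq> ?K"
    using relator_acts_trivially by (auto simp: RU_zero_iff)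
  ultimately show "x \<in> IW \<Longrightarrow> act x u \<in> IU" using ideal_of_least by blast
qed

text \<open>That \<open>x\<close> vanishes in \<open>W\<^sup>\<ge>\<close> may depend on relations with \<open>\<psi>\<^sub>n(\<xi>)\<close> and the central element, even
  if \<open>x\<close> is a combination of \<open>T\<close>-words. This is why all of \<open>W\<^sup>\<ge>\<close> has to act.\<close>

lemma \<Phi>_IW: "x \<in> T_alg \<Longrightarrow> x \<in> IW \<Longrightarrow> \<Phi> x \<in> IU"
  using act_IW[of x 1] by (simp add: act_T_alg)

end

section \<open>Parity of words\<close>

definition par_words :: "(bool \<Rightarrow> 'g set) \<Rightarrow> bool \<Rightarrow> 'g free_algebra set" where
  "par_words P e = {x. \<forall>w\<in>Poly_Mapping.keys x. list_parity P e (letters w)}"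

lemma list_parity_append:
  "list_parity P e xs \<Longrightarrow> list_parity P f ys \<Longrightarrow> list_parity P (e \<noteq> f) (xs @ ys)"
proof (induction xs arbitrary: e)
  case (Cons g gs)
  then consider "g \<in> P False" "list_parity P e gs" | "g \<in> P True" "list_parity P (\<not> e) gs" by auto
  then show ?case
  proof cases
    case 1
    then show ?thesis using Cons.IH[OF 1(2) Cons.prems(2)] by simp
  next
    case 2
    then show ?thesis using Cons.IH[OF 2(2) Cons.prems(2)] by (cases e) simp_all
  qed
qed simp

lemma par_words_zero: "0 \<in> par_words P e"
  by (simp add: par_words_def)

lemma par_words_add: "x \<in> par_words P e \<Longrightarrow> y \<in> par_words P e \<Longrightarrow> x +
    y \<in> par_words P e"
  using keys_add[of x y] by (auto simp: par_words_def)

lemma par_words_scaleQ: "x \<in> par_words P e \<Longrightarrow> r *\<^sub>Q x \<in> par_words P e"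
  by (auto simp: par_words_def in_keys_iff lookup_scaleQ)

lemma par_words_minus: "x \<in> par_words P e \<Longrightarrow> - x \<in> par_words P e"
  using par_words_scaleQ[of x P e "-1"] by (simp add: scaleQ_neg1)

lemma par_words_diff: "x \<in> par_words P e \<Longrightarrow> y \<in> par_words P e \<Longrightarrow> x -
    y \<in> par_words P e"
  using par_words_add[of x P e "- y"] par_words_minus[of y P e] by simp

lemma par_words_mult: "x \<in> par_words P e \<Longrightarrow> y \<in> par_words P f \<Longrightarrow>
    x * y \<in> par_words P (e \<noteq> f)"
proof -
  assume x: "x \<in> par_words P e" and y: "y \<in> par_words P f"
  have "list_parity P (e \<noteq> f) (letters w)" if w: "w \<in> Poly_Mapping.keys (x * y)" for w
  proof -
    obtain a b where "w = a + b" "a \<in> Poly_Mapping.keys x" "b \<in> Poly_Mapping.keys y"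
      using keys_mult[of x y] w by blast
    then show ?thesis
      using x y list_parity_append[of P e "letters a" f "letters b"]
      by (simp add: par_words_def plus_word_def)
  qed
  then show ?thesis by (simp add: par_words_def)
qed

lemma monomial_par_words: "monomial gs \<in> par_words P e \<longleftrightarrow> list_parity P e gs"
  by (simp add: par_words_def monomial_def)

lemma one_par_words: "1 \<in> par_words P False"
  using monomial_par_words[of "[]" P False] by simp

lemma gen_par_words: "g \<in> P e \<Longrightarrow> gen g \<in> par_words P e"
  using monomial_par_words[of "[g]" P e] by (cases e) (simp_all add: monomial_Cons)

lemma par_words_induct [consumes 1, case_names zero add scaleQ monomial]:
  assumes "x \<in> par_words P e" "S 0" "\<And>x y. S x \<Longrightarrow> S y \<Longrightarrow> S (x + y)"
      "\<And>r x. S x \<Longrightarrow> S (r *\<^sub>Q x)"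
    "\<And>gs. list_parity P e gs \<Longrightarrow> S (monomial gs)"
  shows "S x"
proof -
  have "S (\<Sum>w\<in>A. Poly_Mapping.single w (Poly_Mapping.lookup x w))" if "finite A"
      "A \<subseteq> Poly_Mapping.keys x" for A
    using that
  proof (induction A)
    case (insert w A)
    then have "S (Poly_Mapping.single w (Poly_Mapping.lookup x w))"
      unfolding single_eq_monomial using assms(1) by (intro assms(4,5)) (auto simp: par_words_def)
    then show ?case using insert assms(3) by simp
  qed (use assms in simp)
  moreover have "(\<Sum>w\<in>Poly_Mapping.keys x. Poly_Mapping.single w (Poly_Mapping.lookup x w)) = x"
    by (rule poly_mapping_eqI)
       (simp add: lookup_sum lookup_single when_def in_keys_iff)
  ultimately show ?thesis by (metis finite_keys order_refl)
qed

section \<open>Presented superalgebras\<close>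

lemma a_rcosets_free_ring: "a_rcosets\<^bsub>free_ring\<^esub> I = range (coset I)"
  by (auto simp: A_RCOSETS_def RCOSETS_def a_r_coset_def)

lemma coset_mult: "rcoset_mult free_ring (ideal_of R) (coset (ideal_of R) x) (coset (ideal_of R) y) =
    coset (ideal_of R) (x * y)"
  using ideal.rcoset_mult_add[OF ring.genideal_ideal[OF ring_free_ring, of R], of x y]
  by (simp add: free_ring_def)

lemma coset_add: "set_add free_ring (coset (ideal_of R) x) (coset (ideal_of R) y) = coset (ideal_of R) (x + y)"
proof -
  note I = two_sided_idealD[OF two_sided_ideal_of[of R]]
  have "\<exists>a b. a - x \<in> ideal_of R \<and> b - y \<in> ideal_of R \<and> z = a + b" if
      "z - (x + y) \<in> ideal_of R" for z
    by (rule exI[of _ x], rule exI[of _ "z - x"]) (use that I(1) in \<open>simp add: algebra_simps\<close>)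
  moreover have "a + b - (x + y) \<in> ideal_of R" if "a - x \<in> ideal_of R" "b - y \<in> ideal_of R" for a b
    using I(2)[OF that] by (simp add: algebra_simps)
  ultimately show ?thesis
    by (auto simp: set_add_def set_mult_def free_ring_def coset_eq[unfolded free_ring_def])
qed

lemma coset_zero: "coset (ideal_of R) 0 = ideal_of R"
  by (simp add: coset_eq)

text \<open>Calculation with cosets is reduced to calculation with representatives in the free algebra.\<close>

lemma presented_superalgebra_simps:
  fixes P :: "bool \<Rightarrow> 'g set" and R :: "'g free_algebra set"
  defines "A \<equiv> presented_superalgebra P R"
  shows "carrier A = range (coset (ideal_of R))"
    "monoid.mult A (coset (ideal_of R) x) (coset (ideal_of R) y) = coset (ideal_of R) (x * y)"
    "add A (coset (ideal_of R) x) (coset (ideal_of R) y) = coset (ideal_of R) (x + y)"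
    "one A = coset (ideal_of R) 1" "ring.zero A = coset (ideal_of R) 0"
    "scalar A r (coset (ideal_of R) x) = coset (ideal_of R) (r *\<^sub>Q x)"
    "component A e = coset (ideal_of R) ` par_words P e"
proof -
  have one: "one free_ring = (1 :: 'g free_algebra)" by (simp add: free_ring_def)
  show "carrier A = range (coset (ideal_of R))"
    by (simp add: A_def presented_superalgebra_def Let_def FactRing_def a_rcosets_free_ring)
  show "monoid.mult A (coset (ideal_of R) x) (coset (ideal_of R) y) = coset (ideal_of R) (x * y)"
    "add A (coset (ideal_of R) x) (coset (ideal_of R) y) = coset (ideal_of R) (x + y)"
    "one A = coset (ideal_of R) 1" "ring.zero A = coset (ideal_of R) 0"
    "scalar A r (coset (ideal_of R) x) = coset (ideal_of R) (r *\<^sub>Q x)"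
    "component A e = coset (ideal_of R) ` par_words P e"
    by (simp_all add: A_def presented_superalgebra_def Let_def FactRing_def coset_mult coset_add
        coset_zero const_mult par_words_def one)
qed

lemma presented_a_inv:
  "a_inv (presented_superalgebra P R) (coset (ideal_of R) x) = coset (ideal_of R) (- x)"
proof -
  let ?A = "presented_superalgebra P R"
  note simps = presented_superalgebra_simps[of P R]
  have "abelian_group ?A"
  proof (rule abelian_groupI)
    fix X assume "X \<in> carrier ?A"
    then obtain x where x: "X = coset (ideal_of R) x" by (auto simp: simps)
    show "\<exists>Y\<in>carrier ?A. Y \<oplus>\<^bsub>?A\<^esub> X = \<zero>\<^bsub>?A\<^esub>"
      by (rule bexI[of _ "coset (ideal_of R) (- x)"]) (simp_all add: x simps)
  qed (auto simp: simps ac_simps)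
  then show ?thesis
    by (rule abelian_group.minus_equality) (simp_all add: simps)
qed

section \<open>The map from the enveloping algebra to \<open>W\<^sup>+\<close>\<close>

context graded_coefficients
begin

abbreviation "W_par \<equiv> par_words (W_parity G)"
abbreviation "U_par \<equiv> par_words (w_parity G)"

definition RW :: "'h W_gen free_algebra \<Rightarrow> 'h W_gen free_algebra endo" where
  "RW = quotient_rep IW"

lemma qlinear_RW: "qlinear RW" and RW_mult: "RW (x * y) = RW x * RW y" and RW_zero_iff:
    "RW x = 0 \<longleftrightarrow> x \<in> IW"
  unfolding RW_def by (rule quotient_rep[OF two_sided_ideal_of])+

lemmas RW_lin = qlinear_rules[OF qlinear_RW]

lemma RW_scomm: "RW (scomm p r x y) = scomm p r (RW x) (RW y)"
  by (rule hom_scomm[OF qlinear_RW RW_mult])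

lemma RW_commutator: "RW (commutator x y) = commutator (RW x) (RW y)"
  by (simp add: commutator_def RW_lin RW_mult)

lemma RW_relator: "x \<in> WR \<Longrightarrow> RW x = 0"
  by (simp add: RW_zero_iff relator_in_ideal)

lemma RW_numeral: "RW (numeral k * x) = numeral k * RW x"
  by (simp add: RW_lin flip: scaleQ_numeral)

definition \<tau> :: "nat \<Rightarrow> 'h \<Rightarrow> 'h W_gen free_algebra endo" where
  "\<tau> n \<xi> = RW (t n \<xi>)"

lemma qlinear_\<tau>: "qlinear (\<tau> n)"
proof (rule qlinearI)
  show "\<tau> n (\<xi> + \<mu>) = \<tau> n \<xi> + \<tau> n \<mu>" for \<xi> \<mu>
    using RW_relator[OF W_relators.T_add[of n \<xi> \<mu> G 0
        "q ^ 2" \<Delta>]] by (simp add: \<tau>_def RW_lin algebra_simps)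
  show "\<tau> n (r *\<^sub>Q \<xi>) = r *\<^sub>Q \<tau> n \<xi>" for r \<xi>
    using RW_relator[OF W_relators.T_scale[of n r \<xi> G 0 "q ^ 2" \<Delta>]] by
        (simp add: \<tau>_def RW_lin const_mult)
qed

lemmas \<tau>_lin = qlinear_rules[OF qlinear_\<tau>]

lemma coefficient_induct [case_names zero add G]:
  assumes "S 0" "\<And>x y. S x \<Longrightarrow> S y \<Longrightarrow> S (x + y)"
      "\<And>p x. x \<in> G p \<Longrightarrow> S x"
  shows "S x"
proof -
  have "S (hpart e x)" for e
    using hpart_H[of e x] by (induction rule: parity_part_induct) (use assms in auto)
  then show ?thesis using assms(2) hpart_sum by metis
qed

lemma scomm_0: "scomm 0 r = commutator" "scomm r 0 = commutator"
  by (intro ext; simp add: scomm_if commutator_def)+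

lemma \<tau>_relations:
  assumes "\<xi> \<in> G p" "\<mu> \<in> G r"
  shows "scomm p r (\<tau> 0 \<xi>) (\<tau> n \<mu>) = commutator (\<tau> 0 1) (\<tau> n (\<xi> * \<mu>))"
    "commutator (\<tau> m \<xi>) (\<tau> n 1) = commutator (\<tau> m 1) (\<tau> n \<xi>)"
    "commutator (RW (psi 2 1)) (\<tau> n \<xi>) = 2 *\<^sub>Q \<tau> (Suc n) \<xi>"
  using RW_relator[OF W_relators.T_T[where m = 0, OF one_G assms]]
    RW_relator[OF W_relators.T_T[where m = m, OF one_G assms(1) one_G]]
    RW_relator[OF W_relators.psi_T[where m = 2, OF one_G assms(1)]]
  by (simp_all add: RW_lin RW_scomm RW_commutator \<tau>_def scomm_0 RW_numeral scaleQ_numeral)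

lemma \<tau>_quadratic:
  assumes "\<xi> \<in> G r"
  shows "commutator (\<tau> m 1) (\<tau> (n + 3) \<xi>) - 3 * commutator (\<tau> (m + 1) 1) (\<tau> (n + 2) \<xi>)
        + 3 * commutator (\<tau> (m + 2) 1) (\<tau> (n + 1) \<xi>) - commutator (\<tau> (m + 3) 1) (\<tau> n \<xi>) =
        commutator (\<tau> m 1) (\<tau> (n + 1) (q ^ 2 * \<xi>)) -
          commutator (\<tau> (m + 1) 1) (\<tau> n (q ^ 2 * \<xi>))"
proof -
  have "RW (santicomm i k (t m (0 * a)) x) = 0" for i k a x
    using \<tau>_lin(1)[of m]
    by (cases "even (i * k)") (simp_all add: santicomm_def RW_lin RW_mult minus_one_power_iff flip: \<tau>_def)
  then have "RW (\<Sum>((i, a), (j, b))\<leftarrow>\<Delta>'. santicomm i (j + 0 +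
      r) (t m (0 * a)) (t n (b * 1 * \<xi>))) = 0" for \<Delta>'
    by (induction \<Delta>') (auto simp: RW_lin)
  with RW_relator[OF W_relators.quadratic[OF one_G assms, where m = m and n = n]]
  show ?thesis
    unfolding scomm_0 RW_lin RW_numeral RW_commutator \<tau>_def by (simp only: add_0_right) (simp add: algebra_simps)
qed

text \<open>The coefficients \<open>1, 1, \<xi>\<close> with indices \<open>0, 0, a\<close>. The two coefficients \<open>1\<close> are
  interchangeable, which is why each term occurs twice.\<close>

lemma \<tau>_cubic:
  assumes "\<xi> \<in> G p"
  shows "commutator (\<tau> 0 1) (commutator (\<tau> 0 1) (\<tau> (Suc a) \<xi>)) +
      commutator (\<tau> 0 1) (commutator (\<tau> a \<xi>) (\<tau> 1 1))
        + commutator (\<tau> a \<xi>) (commutator (\<tau> 0 1) (\<tau> 1 1)) = 0"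
proof -
  define d where "d i = (if i = 3 then p else 0)" for i :: nat
  define m where "m i = (if i = 3 then a else 0)" for i :: nat
  define \<nu> where "\<nu> i = (if i = 3 then \<xi> else 1)" for i :: nat
  define F where "F i j k = (-1) ^ (inversion_degree d i j + inversion_degree d i k + inversion_degree d j k) *
       scomm (d k) (d j + d i) (t (m k) (\<nu> k)) (scomm (d j) (d i) (t (m j) (\<nu> j)) (t (m i +
           1) (\<nu> i)))" for i j k
  have "\<nu> i \<in> G (d i)" for i by (simp add: \<nu>_def d_def assms one_G)
  then have "RW (\<Sum>w | w permutes {1..3}. F (w 1) (w 2) (w 3)) = 0"
    unfolding F_def koszul_sign_eq[symmetric] by (intro RW_relator W_relators.cubic)
  then have "RW (F 1 2 3 + F 1 3 2 + F 2 1 3 + F 2 3 1 + F 3 1 2 + F 3 2 1) = 0"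
    by (simp only: sum_permutations_3)
  moreover have "inversion_degree d i j = 0" if "i \<noteq> 3 \<or> j \<noteq> 3" for i j
    using that by (auto simp: inversion_degree_def d_def)
  ultimately have "2 *\<^sub>Q (commutator (\<tau> 0 1) (commutator (\<tau> 0 1) (\<tau> (Suc a) \<xi>)) +
      commutator (\<tau> 0 1) (commutator (\<tau> a \<xi>) (\<tau> 1 1))
        + commutator (\<tau> a \<xi>) (commutator (\<tau> 0 1) (\<tau> 1 1))) = 0"
    by (simp add: F_def d_def m_def \<nu>_def RW_lin RW_scomm RW_commutator scomm_0 scaleQ_numeral
        algebra_simps mult_2 flip: \<tau>_def)
  then show ?thesis by (subst (asm) scaleQ_eq_0) auto
qed

lemma W_yangian_generators: "yangian_generators H par q \<tau> (RW (psi 2 1))"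
proof (unfold_locales, goal_cases)
  case (1 n)
  show ?case by (rule qlinear_\<tau>)
next
  case (2 \<xi> e \<mu> f n)
  from 2(1) show ?case
  proof (induction rule: parity_part_induct)
    case (G p \<xi>)
    from 2(2) show ?case
    proof (induction rule: parity_part_induct)
      case (G r \<mu>)
      then show ?case
        using \<tau>_relations(1)[OF \<open>\<xi> \<in> G p\<close> G(1), of n] \<open>odd p =
          e\<close> by (simp add: scomm_parity[of p r])
    qed (simp_all add: \<tau>_lin scomm_lin commutator_lin distrib_left)
  qed (simp_all add: \<tau>_lin scomm_lin commutator_lin distrib_right)
next
  case (3 m \<xi> n)
  show ?case by (induction \<xi> rule: coefficient_induct)
    (simp_all add: \<tau>_lin commutator_lin \<tau>_relations(2)[OF _ one_G])
next
  case (4 m n \<xi>)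
  show ?case
  proof (induction \<xi> rule: coefficient_induct)
    case (add x y)
    have "3 * (a + b) = 3 * a + 3 * b" for a b :: "'h W_gen free_algebra endo" by (rule distrib_left)
    with arg_cong2[OF add, of "(+)"] show ?case
      by (simp only: \<tau>_lin commutator_lin distrib_left) (simp only: algebra_simps)
  qed (simp_all only: \<tau>_lin commutator_lin \<tau>_quadratic mult_zero_right diff_0_right add_0_right)
next
  case (5 a \<xi>)
  show ?case
  proof (induction \<xi> rule: coefficient_induct)
    case (add x y)
    from arg_cong2[OF add, of "(+)"] show ?case
      by (simp only: \<tau>_lin commutator_lin) (simp add: algebra_simps)
  qed (simp_all only: \<tau>_lin commutator_lin \<tau>_cubic add_0_right)
next
  case (6 n \<xi>)
  show ?case by (induction \<xi> rule: coefficient_induct)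
    (simp_all add: \<tau>_lin commutator_lin scaleQ_add_right \<tau>_relations(3)[OF _ one_G])
qed

interpretation Y: yangian_generators H par q \<tau> "RW (psi 2 1)"
  by (rule W_yangian_generators)

lemma \<gamma>_z0: "\<gamma> (w_br z0 x) = commutator (\<gamma> z0) (\<gamma> x)"
proof (induction x rule: w_plus_induct)
  case (zD k n \<xi>)
  have "\<gamma> (w_br z0 (zD (Suc k) n (hpart e \<xi>))) = commutator (\<gamma> z0)
      (\<gamma> (zD (Suc k) n (hpart e \<xi>)))" for e
    using \<gamma>_bracket[OF z0_H zD_H[OF hpart_H[of e \<xi>]], of "Suc k" n] by (simp add: scomm_0)
  from this[of False] this[of True]
  have "\<gamma> (w_br z0 (zD (Suc k) n (hpart False \<xi> + hpart True \<xi>))) =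
      commutator (\<gamma> z0) (\<gamma> (zD (Suc k) n (hpart False \<xi> + hpart True \<xi>)))"
    by (simp only: zD_add w_br_add \<gamma>_lin commutator_lin)
  then show ?case by (simp only: hpart_sum)
qed (simp_all add: w_br_zero w_br_add \<gamma>_lin commutator_lin)

text \<open>One and the same element of the free algebra represents the image of \<open>x\<close> under \<open>lie_map\<close> and
  is mapped to the class of \<open>x\<close> by \<open>\<Phi>\<close>. Both properties are compatible with \<open>ad z\<close>, whence the
  induction. The set \<open>M\<close> will be the algebra of \<open>T\<close>-words, or its part of a given parity.\<close>

lemma lift_to_W:
  assumes "q_subspace V" "x \<in> w_over V" "0 \<in> M" "\<And>x y. x \<in> M \<Longrightarrow>
      y \<in> M \<Longrightarrow> x + y \<in> M" "\<And>r x. x \<in> M \<Longrightarrow> r *\<^sub>Q x \<in> M"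
    and "\<And>n \<xi>. \<xi> \<in> V \<Longrightarrow> t n \<xi> \<in> M"
        "\<And>x. x \<in> M \<Longrightarrow> commutator (t 0 1) x \<in> M"
  shows "\<exists>y\<in>M. RW y = Y.lie_map x \<and> \<rho> y = \<gamma> x"
  using assms(1,2)
proof (induction x rule: w_plus_generated)
  case zero
  show ?case by (rule bexI[of _ 0]) (simp_all add: RW_lin \<rho>_lin Y.lie_map_lin \<gamma>_lin assms)
next
  case (add x y)
  then obtain x' y' where "x' \<in> M" "RW x' = Y.lie_map x" "\<rho> x' = \<gamma> x" "y' \<in> M"
      "RW y' = Y.lie_map y" "\<rho> y' = \<gamma> y" by blast
  then show ?case by (intro bexI[of _ "x' + y'"]) (simp_all add: RW_lin \<rho>_lin Y.lie_map_lin \<gamma>_lin assms)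
next
  case (scaleQ r x)
  then obtain x' where "x' \<in> M" "RW x' = Y.lie_map x" "\<rho> x' = \<gamma> x" by blast
  then show ?case by (intro bexI[of _ "r *\<^sub>Q x'"]) (simp_all add: RW_lin \<rho>_lin Y.lie_map_lin
      \<gamma>_lin assms)
next
  case (degree_one n \<xi>)
  then show ?case
    using Y.lie_map_zD_1[of n \<xi>] \<rho>_t[of n \<xi>] assms(6) \<tau>_def by metis
next
  case (ad_z x)
  then obtain x' where x': "x' \<in> M" "RW x' = Y.lie_map x" "\<rho> x' = \<gamma> x" by blast
  have "RW (commutator (t 0 1) x') = commutator (\<tau> 0 1) (Y.lie_map x)"
    using x' by (simp add: commutator_def RW_lin RW_mult \<tau>_def)
  moreover have "\<rho> (commutator (t 0 1) x') = commutator (\<gamma> z0) (\<gamma> x)"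
    using x' by (simp add: commutator_def \<rho>_lin \<rho>_mult \<rho>_t z0_def)
  ultimately show ?case
    by (intro bexI[of _ "commutator (t 0 1) x'"]) (simp_all add: Y.lie_map_z0 \<gamma>_z0 assms x')
qed

definition lift_W :: "'h w_plus \<Rightarrow> 'h W_gen free_algebra" where
  "lift_W x = (SOME y. y \<in> T_alg \<and> RW y = Y.lie_map x \<and> \<rho> y = \<gamma> x)"

lemma lift_W: "lift_W x \<in> T_alg" "RW (lift_W x) = Y.lie_map x" "\<rho> (lift_W x) = \<gamma> x"
proof -
  have "\<exists>y\<in>T_alg. RW y = Y.lie_map x \<and> \<rho> y = \<gamma> x"
    by (rule lift_to_W[OF q_subspace_UNIV])
       (auto simp: w_over_def commutator_def intro: T_alg_intros)
  then have "\<exists>y. y \<in> T_alg \<and> RW y = Y.lie_map x \<and> \<rho> y = \<gamma> x" by blast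
  from someI_ex[OF this] show "lift_W x \<in> T_alg" "RW (lift_W x) = Y.lie_map x" "\<rho> (lift_W x) = \<gamma> x"
    unfolding lift_W_def by auto
qed

lemma t_par_words: "\<xi> \<in> H e \<Longrightarrow> t n \<xi> \<in> W_par e"
  by (rule gen_par_words) (auto simp: W_parity_def)

lemma homogeneous_lift:
  assumes "x \<in> w_over (H e)"
  shows "\<exists>y\<in>T_alg \<inter> W_par e. \<rho> y = \<gamma> x"
proof -
  have "commutator (t 0 1) y \<in> W_par e" if "y \<in> W_par e" for y
    using par_words_mult[OF t_par_words[OF one_H, of 0] that] par_words_mult[OF that t_par_words[OF one_H, of 0]]
    by (simp add: commutator_def par_words_diff)
  then have "\<exists>y\<in>T_alg \<inter> W_par e. RW y = Y.lie_map x \<and> \<rho> y = \<gamma> x"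
    by (intro lift_to_W[OF q_subspace_H assms])
       (auto simp: par_words_zero par_words_add par_words_scaleQ t_par_words intro: T_alg_intros,
        simp add: commutator_def T_alg_intros)
  then show ?thesis by blast
qed

text \<open>The inverse map on the level of free algebras.\<close>

definition \<Psi> :: "'h w_plus free_algebra \<Rightarrow> 'h W_gen free_algebra" where
  "\<Psi> = subst lift_W"

lemma \<Psi>_simps: "\<Psi> (x * y) = \<Psi> x * \<Psi> y" "\<Psi> 1 = 1" "\<Psi> (gen w) = lift_W w" "qlinear \<Psi>"
  by (simp_all add: \<Psi>_def subst_mult qlinear_subst)

lemmas \<Psi>_lin = qlinear_rules[OF \<Psi>_simps(4)]

lemma \<Psi>_relator:
  assumes "r \<in> UR"
  shows "RW (\<Psi> r) = 0"
  using assms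
proof cases
  case (add x y)
  then show ?thesis by (simp add: \<Psi>_lin \<Psi>_simps RW_lin lift_W Y.lie_map_lin)
next
  case (scale c x)
  then show ?thesis by (simp add: \<Psi>_lin \<Psi>_simps RW_lin lift_W Y.lie_map_lin w_scale_eq const_mult)
next
  case (bracket x e y f)
  have "\<Psi> (scomm p r a b) = scomm p r (\<Psi> a) (\<Psi> b)" for p r a b
    by (rule hom_scomm[OF \<Psi>_simps(4,1)])
  then show ?thesis
    using bracket Y.lie_map_bracket[of x e y f] by (simp add: \<Psi>_lin \<Psi>_simps RW_lin RW_scomm lift_W
        w_parity_eq)
qed

lemma \<Psi>_IU: "u \<in> IU \<Longrightarrow> \<Psi> u \<in> IW"
proof -
  have "two_sided_ideal {u. \<Psi> u \<in> IW}"
    using two_sided_idealD[OF two_sided_ideal_of[of WR]] by (auto simp: two_sided_ideal_def \<Psi>_lin \<Psi>_simps)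
  moreover have "UR \<subseteq> {u. \<Psi> u \<in> IW}" using \<Psi>_relator by (auto simp: RW_zero_iff)
  ultimately show "u \<in> IU \<Longrightarrow> \<Psi> u \<in> IW" using ideal_of_least by blast
qed

lemma \<Psi>_\<Phi>: "x \<in> T_alg \<Longrightarrow> RW (\<Psi> (\<Phi> x)) = RW x"
  by (induction x rule: T_alg.induct)
     (simp_all add: \<Phi>_simps \<Psi>_simps \<Psi>_lin RW_lin RW_mult qlinear_add[OF qlinear_\<Phi>]
       qlinear_scaleQ[OF qlinear_\<Phi>] lift_W Y.lie_map_zD_1[simplified] flip: \<tau>_def)

text \<open>\<open>\<Phi>\<close> respects the relations by the action, and \<open>\<Psi>\<close>, which respects them by \<open>lie_map_bracket\<close>,
  is a left inverse on \<open>T_alg\<close> modulo relations.\<close>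

lemma \<Phi>_IU_iff: "x \<in> T_alg \<Longrightarrow> \<Phi> x \<in> IU \<longleftrightarrow> x \<in> IW"
  using \<Phi>_IW[of x] \<Psi>_\<Phi>[of x] \<Psi>_IU[of "\<Phi> x"] by (auto simp flip: RW_zero_iff)

lemma \<Phi>_surj: "\<exists>x\<in>T_alg. \<rho> x = RU u"
proof (induction u rule: free_algebra_induct)
  case zero
  show ?case by (rule bexI[of _ 0]) (simp_all add: \<rho>_lin RU_lin T_alg_zero)
next
  case (add u v)
  then obtain x y where "x \<in> T_alg" "\<rho> x = RU u" "y \<in> T_alg" "\<rho> y = RU v" by blast
  then show ?case by (intro bexI[of _ "x + y"]) (simp_all add: \<rho>_lin RU_lin T_alg_add)
next
  case (scaleQ r u)
  then obtain x where "x \<in> T_alg" "\<rho> x = RU u" by blast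
  then show ?case by (intro bexI[of _ "r *\<^sub>Q x"]) (simp_all add: \<rho>_lin RU_lin T_alg_scaleQ)
next
  case one
  show ?case by (rule bexI[of _ 1]) (simp_all add: \<rho>_def \<Phi>_simps T_alg_one)
next
  case (gen g u)
  then obtain x where "x \<in> T_alg" "\<rho> x = RU u" by blast
  then show ?case
    by (intro bexI[of _ "lift_W g * x"]) (simp_all add: \<rho>_mult RU_mult lift_W T_alg_mult \<gamma>_def)
qed

lemma \<Phi>_surj_homogeneous:
  assumes "u \<in> U_par e"
  shows "\<exists>x\<in>T_alg \<inter> W_par e. \<rho> x = RU u"
  using assms
proof (induction rule: par_words_induct)
  case zero
  show ?case by (rule bexI[of _ 0]) (simp_all add: \<rho>_lin RU_lin T_alg_zero par_words_zero)
next
  case (add u v)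
  then obtain x y where "x \<in> T_alg \<inter> W_par e" "\<rho> x = RU u"
    "y \<in> T_alg \<inter> W_par e" "\<rho> y = RU v" by blast
  then show ?case by (intro bexI[of _ "x + y"]) (simp_all add: \<rho>_lin RU_lin T_alg_add par_words_add)
next
  case (scaleQ r u)
  then obtain x where "x \<in> T_alg \<inter> W_par e" "\<rho> x = RU u" by blast
  then show ?case by (intro bexI[of _ "r *\<^sub>Q x"]) (simp_all add: \<rho>_lin RU_lin T_alg_scaleQ
      par_words_scaleQ)
next
  case (monomial gs)
  then show ?case
  proof (induction gs arbitrary: e)
    case Nil
    then show ?case by (intro bexI[of _ 1]) (auto simp: \<rho>_def \<Phi>_simps T_alg_one one_par_words)
  next
    case (Cons g gs)
    then obtain f where f: "g \<in> w_parity G f" "list_parity (w_parity G) (f \<noteq> e) gs" by auto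
    obtain x where x: "x \<in> T_alg \<inter> W_par (f \<noteq> e)" "\<rho> x = RU (monomial gs)"
      using Cons.IH[OF f(2)] by blast
    obtain y where y: "y \<in> T_alg \<inter> W_par f" "\<rho> y = \<gamma> g"
      using homogeneous_lift f(1) w_parity_eq by blast
    have "(f \<noteq> (f \<noteq> e)) = e" by auto
    then have "y * x \<in> W_par e"
      using par_words_mult[of y _ f x "f \<noteq> e"] x y by simp
    then show ?case
      using x y by (intro bexI[of _ "y * x"]) (simp_all add: T_alg_mult \<rho>_mult monomial_Cons RU_mult
          \<gamma>_def)
  qed
qed

text \<open>An element of \<open>W\<^sup>+\<close> is even or odd if it is so in \<open>W\<^sup>\<ge>\<close>, where a homogeneous representative
  may contain \<open>\<psi>\<^sub>n(\<xi>)\<close>. To see that \<open>\<Phi>\<close> nevertheless preserves the parity, the action on \<open>1\<close> is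
  used once more, now together with the fact that superderivations and left multiplications
  respect parities.\<close>

lemma der_par_words:
  assumes d: "superderivation e d" and u: "u \<in> U_par f"
  shows "der e d u \<in> U_par (e \<noteq> f)"
  using u
proof (induction rule: par_words_induct)
  case (monomial gs)
  then show ?case
  proof (induction gs arbitrary: f)
    case (Cons x xs)
    then obtain g where g': "x \<in> w_parity G g" "list_parity (w_parity G) (g \<noteq> f) xs" by auto
    then have g: "x \<in> w_over (H g)" "list_parity (w_parity G) (g \<noteq> f) xs" by (simp_all only: w_parity_eq)
    have dx: "gen (d x) \<in> U_par (e \<noteq> g)"
      using d g(1) by (intro gen_par_words) (auto simp: superderivation_def w_parity_eq)
    have "wpar e x \<in> w_over (H g)"
      using wpar_homogeneous[OF g(1), of e] w_over_closed(3)[OF q_subspace_H g(1), of "-1"] g(1)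
      by (auto simp: scaleQ_neg1)
    then have wx: "gen (wpar e x) \<in> U_par g"
      by (intro gen_par_words) (simp add: w_parity_eq)
    have "gen (d x) * monomial xs \<in> U_par (e \<noteq> f)"
      using par_words_mult[OF dx, of "monomial xs" "g \<noteq> f"] g(2) by
          (cases e; cases g; simp add: monomial_par_words)
    moreover have "gen (wpar e x) * der e d (monomial xs) \<in> U_par (e \<noteq> f)"
      using par_words_mult[OF wx Cons.IH[OF g(2)]] by (cases e; cases g; simp)
    ultimately show ?case by (simp add: monomial_Cons der_gen_times par_words_add)
  qed (simp add: par_words_zero)
qed (simp_all add: der_lin par_words_zero par_words_add par_words_scaleQ)

lemma act_gen_par_words:
  assumes "g \<in> W_parity G e" "u \<in> U_par f"
  shows "\<exists>v\<in>U_par (e \<noteq> f). RU (act_gen g u) = RU v"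
proof -
  from assms(1) consider m \<xi> where "g = Psi m \<xi>" "\<xi> \<in> H e" | n \<xi> where "g = T n \<xi>"
      "\<xi> \<in> H e" | "g = Central"
    by (auto simp: W_parity_def split: if_splits)
  then show ?thesis
  proof cases
    case 1
    then show ?thesis
      using act_gen_Psi[OF 1(2)] der_par_words[OF superderivation_power_sum_der[OF 1(2)] assms(2)] by blast
  next
    case 2
    then have "gen (zD 1 n \<xi>) \<in> U_par e"
      by (intro gen_par_words) (simp add: w_parity_eq zD_H[simplified])
    then show ?thesis using par_words_mult[OF _ assms(2)] 2(1) by auto
  next
    case 3
    then show ?thesis using par_words_zero by force
  qed
qed

lemma act_par_words:
  assumes "x \<in> W_par e"
  shows "\<exists>v\<in>U_par e. RU (act x 1) = RU v"
  using assms
proof (induction rule: par_words_induct)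
  case zero
  show ?case by (rule bexI[of _ 0]) (simp_all add: act_lin par_words_zero)
next
  case (add x y)
  then obtain v w where "v \<in> U_par e" "RU (act x 1) = RU v"
    "w \<in> U_par e" "RU (act y 1) = RU w" by blast
  then show ?case by (intro bexI[of _ "v + w"]) (simp_all add: act_lin RU_lin par_words_add)
next
  case (scaleQ r x)
  then obtain v where "v \<in> U_par e" "RU (act x 1) = RU v" by blast
  then show ?case by (intro bexI[of _ "r *\<^sub>Q v"]) (simp_all add: act_lin RU_lin par_words_scaleQ)
next
  case (monomial gs)
  then show ?case
  proof (induction gs arbitrary: e)
    case Nil
    then show ?case by (intro bexI[of _ 1]) (auto simp: one_par_words)
  next
    case (Cons g gs)
    then obtain f where f: "g \<in> W_parity G f" "list_parity (W_parity G) (f \<noteq> e) gs" by auto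
    obtain v where v: "v \<in> U_par (f \<noteq> e)" "RU (act (monomial gs) 1) = RU v"
      using Cons.IH[OF f(2)] by blast
    have "(f \<noteq> (f \<noteq> e)) = e" by auto
    then show ?case
      using act_gen_par_words[OF f(1) v(1)] RU_act_gen_cong[OF v(2), of g] by (simp add: monomial_Cons act_gen_times)
  qed
qed

section \<open>The isomorphism over graded coefficients\<close>

abbreviation "A_W \<equiv> W_ge G 0 (q ^ 2) \<Delta>"
abbreviation "A_Wp \<equiv> W_plus G 0 (q ^ 2) \<Delta>"
abbreviation "A_U \<equiv> enveloping_algebra w_scale w_br (w_parity G)"

lemmas A_W_simps = presented_superalgebra_simps[of "W_parity G" WR, folded W_ge_def]
lemmas A_U_simps = presented_superalgebra_simps[of "w_parity G" UR, folded enveloping_algebra_def]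

text \<open>The scalars belong to the generating set since a generated ring need not be closed under
  scalars.\<close>

lemma generated_T_alg:
  "generate_ring A_W ({coset IW (t n \<xi>) | n \<xi>. True} \<union> range
      (\<lambda>r. scalar A_W r (one A_W))) = coset IW ` T_alg"
  (is "generate_ring _ ?X = _")
proof (intro equalityI subsetI)
  fix X assume "X \<in> generate_ring A_W ?X"
  then show "X \<in> coset IW ` T_alg"
  proof induction
    case (incl h)
    then show ?case by (auto simp: A_W_simps intro: T_alg_intros)
  next
    case (a_inv h)
    then show ?case
      using presented_a_inv[of "W_parity G" WR] by (auto simp: W_ge_def intro: T_alg_minus)
  qed (auto simp: A_W_simps intro: T_alg.intros)
next
  fix X assume "X \<in> coset IW ` T_alg"
  then obtain x where "x \<in> T_alg" "X = coset IW x" by blast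
  then show "X \<in> generate_ring A_W ?X"
  proof (induction x arbitrary: X rule: T_alg.induct)
    case T_alg_one
    then show ?case using generate_ring.one[of A_W ?X] by (simp add: A_W_simps)
  next
    case (T_alg_gen n \<xi>)
    then show ?case by (auto intro: generate_ring.incl)
  next
    case (T_alg_scaleQ x r)
    have "coset IW (r *\<^sub>Q 1) \<in> generate_ring A_W ?X"
      by (rule generate_ring.incl) (auto simp: A_W_simps)
    from generate_ring.eng_mult[OF this T_alg_scaleQ.IH[OF refl]]
    show ?case using T_alg_scaleQ by (simp add: A_W_simps mult_scaleQ_left)
  next
    case (T_alg_add x y)
    from generate_ring.eng_add[OF T_alg_add.IH(1)[OF refl] T_alg_add.IH(2)[OF refl]]
    show ?case using T_alg_add by (simp add: A_W_simps)
  next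
    case (T_alg_mult x y)
    from generate_ring.eng_mult[OF T_alg_mult.IH(1)[OF refl] T_alg_mult.IH(2)[OF refl]]
    show ?case using T_alg_mult by (simp add: A_W_simps)
  qed
qed

lemma A_Wp_simps:
  "carrier A_Wp = coset IW ` T_alg" "monoid.mult A_Wp = monoid.mult A_W" "add A_Wp = add A_W"
  "one A_Wp = one A_W" "scalar A_Wp = scalar A_W" "component A_Wp e = component A_W e \<inter> coset IW ` T_alg"
  unfolding W_plus_def generated_subalgebra_def Let_def generated_T_alg by simp_all

text \<open>\<open>\<Phi>\<close> is injective on cosets by \<open>\<Phi>_IU_iff\<close> and surjective by \<open>\<Phi>_surj\<close>. That the parities
  correspond is shown by homogeneous lifts in one direction, and by the action in the other.\<close>

theorem W_plus_iso_enveloping: "\<exists>h. h \<in> superalgebra_iso A_Wp A_U"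
proof -
  note IW = two_sided_ideal_of[of WR] and IU = two_sided_ideal_of[of UR]
  \<comment> \<open>a \<open>T\<close>-word representing the class is chosen, and \<open>\<Phi>_IU_iff\<close> makes the choice immaterial\<close>
  define h where "h X = coset IU (\<Phi> (SOME x. x \<in> T_alg \<and> X = coset IW x))" for X
  have \<Phi>_lin: "\<Phi> (x + y) = \<Phi> x + \<Phi> y" "\<Phi> (x - y) = \<Phi> x - \<Phi> y"
      "\<Phi> (r *\<^sub>Q x) = r *\<^sub>Q \<Phi> x" for x y r
    by (simp_all add: qlinear_add[OF qlinear_\<Phi>] qlinear_diff[OF qlinear_\<Phi>]
        qlinear_scaleQ[OF qlinear_\<Phi>])
  have h: "h (coset IW x) = coset IU (\<Phi> x)" if "x \<in> T_alg" for x
  proof -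
    define y where "y = (SOME x'. x' \<in> T_alg \<and> coset IW x = coset IW x')"
    have "\<exists>x'. x' \<in> T_alg \<and> coset IW x = coset IW x'" using that by blast
    then have "y \<in> T_alg \<and> coset IW x = coset IW y" unfolding y_def by (rule someI_ex)
    then have y: "y \<in> T_alg" "x - y \<in> IW" using coset_eq_iff[OF IW, of x y] by simp_all
    then have "\<Phi> x - \<Phi> y \<in> IU"
      using \<Phi>_IU_iff[OF T_alg_diff[OF that y(1)]] by (simp only: \<Phi>_lin)
    then have "coset IU (\<Phi> x) = coset IU (\<Phi> y)" by (simp only: coset_eq_iff[OF IU])
    then show ?thesis unfolding h_def y_def by (rule sym)
  qed
  have RU_eq: "coset IU u = coset IU v \<longleftrightarrow> RU u = RU v" for u v
    by (simp add: coset_eq_iff[OF IU] RU_lin flip: RU_zero_iff)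
  have hom: "h \<in> ring_hom A_Wp A_U"
  proof (rule ring_hom_memI)
    show "h (one A_Wp) = one A_U"
      by (simp add: A_Wp_simps A_W_simps A_U_simps h T_alg_one \<Phi>_simps)
  qed (auto simp: A_Wp_simps A_W_simps A_U_simps h T_alg_mult T_alg_add \<Phi>_simps \<Phi>_lin)
  have "bij_betw h (carrier A_Wp) (carrier A_U)"
  proof (rule bij_betwI')
    fix X Y assume "X \<in> carrier A_Wp" "Y \<in> carrier A_Wp"
    then obtain x y where xy: "X = coset IW x" "x \<in> T_alg" "Y = coset IW y" "y \<in> T_alg"
      by (auto simp: A_Wp_simps)
    show "h X = h Y \<longleftrightarrow> X = Y"
      using \<Phi>_IU_iff[OF T_alg_diff[OF xy(2,4)]]
      by (simp add: xy h coset_eq_iff[OF IW] coset_eq_iff[OF IU] \<Phi>_lin)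
  next
    fix X assume "X \<in> carrier A_Wp"
    then show "h X \<in> carrier A_U" by (auto simp: A_Wp_simps A_U_simps h)
  next
    fix Y assume "Y \<in> carrier A_U"
    then obtain u where u: "Y = coset IU u" by (auto simp: A_U_simps)
    obtain x where "x \<in> T_alg" "\<rho> x = RU u" using \<Phi>_surj by blast
    then show "\<exists>X\<in>carrier A_Wp. Y = h X"
      by (intro bexI[of _ "coset IW x"]) (auto simp: A_Wp_simps h u RU_eq \<rho>_def)
  qed
  moreover have "h (scalar A_Wp r X) = scalar A_U r (h X)" if "X \<in> carrier A_Wp" for r X
    using that by (auto simp: A_Wp_simps A_W_simps A_U_simps h T_alg_scaleQ \<Phi>_lin)
  moreover have "h ` component A_Wp e = component A_U e" for e
  proof (intro equalityI subsetI)
    fix Y assume "Y \<in> h ` component A_Wp e"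
    then obtain x x' where x: "x \<in> T_alg" "x' \<in> W_par e" "coset IW x = coset IW x'"
      "Y = h (coset IW x)"
      by (auto simp: A_Wp_simps A_W_simps)
    \<comment> \<open>\<open>x'\<close> need not be a \<open>T\<close>-word, so \<open>\<Phi>\<close> cannot be applied to it, but it acts on \<open>1\<close> as \<open>x\<close> does\<close>
    have "act (x - x') 1 \<in> IU"
      using x(3) by (intro act_IW) (simp add: coset_eq_iff[OF IW])
    then have "RU (\<Phi> x) = RU (act x' 1)"
      by (simp add: act_lin act_T_alg[OF x(1)] RU_lin flip: RU_zero_iff)
    with act_par_words[OF x(2)] obtain v where "v \<in> U_par e" "RU (\<Phi> x) = RU v"
      by auto
    moreover from this have "Y = coset IU v" using x(4) h[OF x(1)] by (simp only: RU_eq)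
    ultimately show "Y \<in> component A_U e" by (simp add: A_U_simps)
  next
    fix Y assume "Y \<in> component A_U e"
    then obtain u where u: "Y = coset IU u" "u \<in> U_par e" by (auto simp: A_U_simps)
    obtain x where x: "x \<in> T_alg \<inter> W_par e" "\<rho> x = RU u"
      using \<Phi>_surj_homogeneous[OF u(2)] by blast
    then have "Y = h (coset IW x)" by (simp add: h u RU_eq \<rho>_def)
    then show "Y \<in> h ` component A_Wp e"
      using x by (auto simp: A_Wp_simps A_W_simps)
  qed
  ultimately have "h \<in> superalgebra_iso A_Wp A_U"
    using hom by (simp add: superalgebra_iso_def ring_iso_def)
  then show ?thesis by blast
qed

end

section \<open>The cohomology algebra of a space\<close>

lemma qlinear_parity_inv: "qlinear parity_inv"
  by (rule qlinearI) (simp_all add: parity_inv_simps)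

lemma zero_in_cohomology_group: "0 \<in> cohomology_group p"
proof -
  have "single_cochain p (\<lambda>_. 0) = (0 :: 'a cochain)"
    by (rule cochain_eqI) (simp add: cochain_at_single zero_cochain.rep_eq)
  then have "(0 :: 'a cohomology) = cohomology_class p (\<lambda>_. 0)"
    by (simp add: cohomology_class_def zero_cohomology_def)
  moreover have "delta (single_cochain p (\<lambda>_. 0)) = (0 :: 'a cochain)"
    using \<open>single_cochain p (\<lambda>_. 0) = 0\<close> by simp
  ultimately show ?thesis unfolding cohomology_group_def by blast
qed

lemma one_in_cohomology_group: "1 \<in> cohomology_group 0"
proof -
  have "single_cochain 0 (\<lambda>_. 1) = (1 :: 'a cochain)"
    by (rule cochain_eqI) (auto simp: cochain_at_single one_cochain.rep_eq)
  then have "(1 :: 'a cohomology) = cohomology_class 0 (\<lambda>_. 1)"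
      "delta (single_cochain 0 (\<lambda>_. 1)) = (0 :: 'a cochain)"
    by (simp_all add: cohomology_class_def one_cohomology_def delta_one)
  then show ?thesis unfolding cohomology_group_def by blast
qed

text \<open>Even and odd classes are the eigenvectors of the parity involution: comparing \<open>x\<close> with \<open>\<plusminus>\<close>
  its image removes the components of the other parity.\<close>

lemma parity_part_cohomology:
  "x \<in> parity_part cohomology_group e \<longleftrightarrow>
      parity_inv x = (if e then - x else (x :: 'a::topological_space cohomology))"
proof
  assume "x \<in> parity_part cohomology_group e"
  then show "parity_inv x = (if e then - x else x)"
    by (induction rule: parity_part_induct)
       (auto simp: qlinear_0[OF qlinear_parity_inv] parity_inv_simps parity_inv_cohomology_group)
next
  assume par: "parity_inv x = (if e then - x else x)"
  obtain N f where f: "x = (\<Sum>d\<le>N. f d)" "\<And>d. f d \<in> cohomology_group d"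
    by (rule cohomology_decomposition) blast
  define g where "g d = (if odd d = e then f d else 0)" for d
  have "x + x = x + (if e then - parity_inv x else parity_inv x)" using par by simp
  also have "\<dots> = (\<Sum>d\<le>N. f d + (if e then - parity_inv (f d) else parity_inv (f d)))"
    by (simp add: f(1) qlinear_sum[OF qlinear_parity_inv] sum.distrib sum_negf)
  also have "\<dots> = (\<Sum>d\<le>N. g d + g d)"
    by (intro sum.cong refl) (auto simp: g_def parity_inv_cohomology_group[OF f(2)])
  also have "\<dots> = (\<Sum>d\<le>N. g d) + (\<Sum>d\<le>N. g d)" by (simp add: sum.distrib)
  finally have "(x - (\<Sum>d\<le>N. g d)) + (x - (\<Sum>d\<le>N. g d)) = 0" by (simp add: algebra_simps)
  then have "x - (\<Sum>d\<le>N. g d) = 0" by (rule twice_eq_0)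
  then have "x = (\<Sum>d\<le>N. g d)" by simp
  moreover have "g d \<in> cohomology_group d \<and> (odd d \<noteq> e \<longrightarrow> g d = 0)" for d
    using f(2) zero_in_cohomology_group by (auto simp: g_def)
  ultimately show "x \<in> parity_part cohomology_group e"
    unfolding parity_part_def by blast
qed

lemma parity_part_supercomm:
  assumes "x \<in> parity_part cohomology_group e" "y \<in> parity_part cohomology_group f"
  shows "x * y = (if e \<and> f then - (y * x) else y * (x :: 'a::topological_space cohomology))"
  using assms(1)
proof (induction rule: parity_part_induct)
  case (G p x)
  from assms(2) show ?case
  proof (induction rule: parity_part_induct)
    case (G r y)
    then show ?case
      using cohomology_group_supercomm[OF \<open>x \<in> cohomology_group p\<close> G(1)] \<open>odd p =
          e\<close> by auto
  qed (auto simp: distrib_left distrib_right)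
qed (auto simp: distrib_left distrib_right)

lemma cohomology_graded_coefficients:
  fixes q :: "'a::topological_space cohomology"
  assumes "q \<in> cohomology_group 2"
  shows "graded_coefficients cohomology_group parity_inv q"
proof (unfold_locales, goal_cases)
  case (6 x e y f)
  then show ?case by (auto simp: parity_part_cohomology parity_inv_simps)
next
  case (7 x e y f)
  then show ?case by (rule parity_part_supercomm)
next
  case 8
  show ?case using parity_inv_cohomology_group[OF assms] by (simp add: parity_part_cohomology)
qed (simp_all add: parity_inv_simps parity_part_cohomology zero_in_cohomology_group one_in_cohomology_group)

theorem theorem1:
  fixes A :: "'a::t2_space chart set" and q :: "'a cohomology"
  assumes "complex_surface A" and "compact (UNIV :: 'a set)" and "connected (UNIV :: 'a set)"
    and "chern1 A = 0"
    and "q \<in> cohomology_group 2" and "s2_class A = q ^ 2"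
  shows "\<exists>h. h \<in> superalgebra_iso (W_plus_surface A) (U_w_plus q)"
  using graded_coefficients.W_plus_iso_enveloping[OF cohomology_graded_coefficients[OF assms(5)]]
  by (simp add: W_plus_surface_def U_w_plus_def assms(4,6))

end
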